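(* Let $n\ge2$. Let $\mathrm{Ker}^+(D_s)$ denote the kernel of the symplectic Dirac operator $D_s$ acting on $L(-\tfrac12\omega_n)$-valued polynomials, i.e. on $\mathcal P\otimes L(-\tfrac12\omega_n)$, and let $\mathrm{Ker}^-(D_s)$ denote the kernel of $D_s$ acting on $L(\omega_{n-1}-\tfrac32\omega_n)$-valued polynomials, i.e. on $\mathcal P\otimes L(\omega_{n-1}-\tfrac32\omega_n)$. Then, as $\mathfrak{sp}(2n,\mathbb R)$-modules, $$\mathrm{Ker}^+(D_s)\simeq\bigoplus_{l\in\mathbb N_0}\Big(L(2l\omega_1-\tfrac12\omega_n)\oplus L((2l+1)\omega_1-\tfrac12\omega_n)\Big)$$ and $$\mathrm{Ker}^-(D_s)\simeq\bigoplus_{l\in\mathbb N_0}\Big(L(2l\omega_1+\omega_{n-1}-\tfrac32\omega_n)\oplus L((2l+1)\omega_1+\omega_{n-1}-\tfrac32\omega_n)\Big).$$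
   Context: $\mathbb N_0=\{0,1,2,\dots\}$. Let $V=\mathbb R^{2n}$ with symplectic form $\omega$ and symplectic basis $e_1,f_1,\dots,e_n,f_n$: $\omega(e_i,e_j)=\omega(f_i,f_j)=0$, $\omega(e_i,f_j)=\delta_{ij}$. Let $x_1,\dots,x_{2n}$ be the coordinates for which a point of $V$ is $\sum_{j=1}^n(x_{2j-1}f_j+x_{2j}e_j)$. $\mathcal P=\mathbb C[x_1,\dots,x_{2n}]$. The Segal-Shale-Weil module is $\mathcal C=\mathbb C[q_1,\dots,q_n]$, on which the vectors $e_j,f_j$ act as operators with $[e_i,e_j]=[f_i,f_j]=0$, $e_if_j-f_je_i=\delta_{ij}$; concretely $e_j=\sqrt{-1}\,q_j$ and $f_j=\sqrt{-1}\,\partial_{q_j}$. Each $A\in\mathfrak{sp}(2n,\mathbb R)=\mathfrak{sp}(V,\omega)$ acts on $\mathcal C$ by the unique element $L(A)$ of the real span of $e_ie_j$, $f_if_j$, $e_if_j+f_je_i$ satisfying $[L(A),v]=Av$ for all $v\in V$; it acts on $\mathcal P$ by the natural (contragredient) action on polynomial functions on $V$, and on $\mathcal P\otimes\mathcal C$ by the tensor product action. Weights: the Cartan subalgebra has basis $H_i=\tfrac12(e_if_i+f_ie_i)$, acting on $\mathcal C$ as $-(q_i\partial_{q_i}+\tfrac12)$; $\epsilon_1,\dots,\epsilon_n$ is the dual basis; simple roots are $\epsilon_i-\epsilon_{i+1}$ ($1\le i\le n-1$, root space spanned by $q_{i+1}\partial_{q_i}$) and $2\epsilon_n$ (root space spanned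 by $\partial_{q_n}^2$); fundamental weights are $\omega_i=\epsilon_1+\dots+\epsilon_i$. $L(\mu)$ denotes the simple highest weight module of highest weight $\mu$. One has $\mathcal C=L(-\tfrac12\omega_n)\oplus L(\omega_{n-1}-\tfrac32\omega_n)$, the two summands being the even and the odd polynomials in $q$ respectively. The symplectic Dirac operator is $D_s=\sum_{j=1}^n(\partial_{x_{2j-1}}e_j-\partial_{x_{2j}}f_j)$ on $\mathcal P\otimes\mathcal C$; it commutes with $\mathfrak{sp}(2n,\mathbb R)$. *)

theory Defs
  imports
    "HOL-Library.Poly_Mapping"
    "HOL-Library.Product_Plus"
    "Jordan_Normal_Form.Matrix"
begin

section \<open>Complex polynomials in variables indexed by natural numbers\<close>

type_synonym cpoly = "(nat \<Rightarrow>\<^sub>0 nat) \<Rightarrow>\<^sub>0 complex"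

definition var :: "nat \<Rightarrow> cpoly" where
  "var k = Poly_Mapping.single (Poly_Mapping.single k 1) 1"

definition scl :: "complex \<Rightarrow> cpoly \<Rightarrow> cpoly" where
  "scl c p = Poly_Mapping.single 0 c * p"

text \<open>Partial derivative. The truncated subtraction of exponents is harmless, since the
  coefficient vanishes when \<open>k\<close> does not occur in \<open>m\<close>.\<close>
definition pd :: "nat \<Rightarrow> cpoly \<Rightarrow> cpoly" where
  "pd k p = (\<Sum>m\<in>Poly_Mapping.keys p.
     Poly_Mapping.single (m - Poly_Mapping.single k 1)
       (of_nat (Poly_Mapping.lookup m k) * Poly_Mapping.lookup p m))"

definition polys :: "nat \<Rightarrow> cpoly set" where
  "polys N = {p. \<forall>m\<in>Poly_Mapping.keys p. Poly_Mapping.keys m \<subseteq> {1..N}}"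

section \<open>The symplectic space and its Lie algebra\<close>

text \<open>Points of \<open>V\<close> are vectors of dimension \<open>2n\<close>; the coordinates \<open>x\<^sub>1, \<dots>, x\<^sub>2\<^sub>n\<close> are numbered
  from 1, vector entries from 0. The point with coordinates \<open>x\<close> is
  \<open>\<Sum>j. x\<^sub>2\<^sub>j\<^sub>-\<^sub>1 f\<^sub>j + x\<^sub>2\<^sub>j e\<^sub>j\<close>, so \<open>f\<^sub>j\<close> and \<open>e\<^sub>j\<close> are the unit vectors number \<open>2j-1\<close> and \<open>2j\<close>.\<close>
definition crd :: "real vec \<Rightarrow> nat \<Rightarrow> real" where
  "crd v k = v $ (k - 1)"

text \<open>Normalised by \<open>\<omega>(e\<^sub>i, f\<^sub>j) = \<delta>\<^sub>i\<^sub>j\<close>.\<close>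
definition symp_form :: "nat \<Rightarrow> real vec \<Rightarrow> real vec \<Rightarrow> real" where
  "symp_form n v w =
     (\<Sum>j=1..n. crd v (2*j) * crd w (2*j-1) - crd v (2*j-1) * crd w (2*j))"

definition sp :: "nat \<Rightarrow> real mat set" where
  "sp n = {A \<in> carrier_mat (2*n) (2*n).
     \<forall>v\<in>carrier_vec (2*n). \<forall>w\<in>carrier_vec (2*n).
       symp_form n (A *\<^sub>v v) w + symp_form n v (A *\<^sub>v w) = 0}"

section \<open>The Segal-Shale-Weil module\<close>

text \<open>Here \<open>var j\<close> is \<open>q\<^sub>j\<close>, for \<open>1 \<le> j \<le> n\<close>.\<close>

definition e_op :: "nat \<Rightarrow> cpoly \<Rightarrow> cpoly" where
  "e_op j p = scl \<i> (var j * p)"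

definition f_op :: "nat \<Rightarrow> cpoly \<Rightarrow> cpoly" where
  "f_op j p = scl \<i> (pd j p)"

definition vec_op :: "nat \<Rightarrow> real vec \<Rightarrow> cpoly \<Rightarrow> cpoly" where
  "vec_op n v p = (\<Sum>j=1..n. scl (of_real (crd v (2*j-1))) (f_op j p)
                            + scl (of_real (crd v (2*j))) (e_op j p))"

definition quad_ops :: "nat \<Rightarrow> (cpoly \<Rightarrow> cpoly) set" where
  "quad_ops n = {T. \<exists>a b c :: nat \<Rightarrow> nat \<Rightarrow> real. T = (\<lambda>p. \<Sum>i=1..n. \<Sum>j=1..n.
       scl (of_real (a i j)) (e_op i (e_op j p))
     + scl (of_real (b i j)) (f_op i (f_op j p))
     + scl (of_real (c i j)) (e_op i (f_op j p) + f_op j (e_op i p)))}"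

text \<open>The operator \<open>L(A)\<close> by which \<open>A \<in> sp n\<close> acts on the Segal-Shale-Weil module.\<close>
definition ssw :: "nat \<Rightarrow> real mat \<Rightarrow> cpoly \<Rightarrow> cpoly" where
  "ssw n A = (THE T. T \<in> quad_ops n \<and>
     (\<forall>v\<in>carrier_vec (2*n). \<forall>p. T (vec_op n v p) - vec_op n v (T p) = vec_op n (A *\<^sub>v v) p))"

text \<open>The even and the odd polynomials in \<open>q\<^sub>1, \<dots>, q\<^sub>n\<close>, that is, the summands
  \<open>L(-1/2 \<omega>\<^sub>n)\<close> and \<open>L(\<omega>\<^sub>n\<^sub>-\<^sub>1 - 3/2 \<omega>\<^sub>n)\<close> of the Segal-Shale-Weil module.\<close>
definition ssw_even :: "nat \<Rightarrow> cpoly set" where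
  "ssw_even n = {p \<in> polys n. \<forall>m\<in>Poly_Mapping.keys p. even (\<Sum>j=1..n. Poly_Mapping.lookup m j)}"

definition ssw_odd :: "nat \<Rightarrow> cpoly set" where
  "ssw_odd n = {p \<in> polys n. \<forall>m\<in>Poly_Mapping.keys p. odd (\<Sum>j=1..n. Poly_Mapping.lookup m j)}"

section \<open>Polynomials on \<open>V\<close> and spinor-valued polynomials\<close>

text \<open>The contragredient action on polynomial functions, \<open>(A p)(v) = - dp\<^sub>v (A v)\<close>, that is, the
  derivative at \<open>t = 0\<close> of \<open>p (exp (-t A) v)\<close>. Here \<open>var k\<close> is \<open>x\<^sub>k\<close>, for \<open>1 \<le> k \<le> 2n\<close>.\<close>
definition poly_act :: "nat \<Rightarrow> real mat \<Rightarrow> cpoly \<Rightarrow> cpoly" where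
  "poly_act n A p = - (\<Sum>k=1..2*n.
     (\<Sum>l=1..2*n. scl (of_real (A $$ (k-1, l-1))) (var l)) * pd k p)"

text \<open>The tensor product of the polynomials in \<open>x\<close> and the polynomials in \<open>q\<close>, as polynomials
  in \<open>x\<close> whose coefficients are polynomials in \<open>q\<close>: the element \<open>u\<close> stands for
  \<open>\<Sum>m. x\<^sup>m \<otimes> lookup u m\<close>.\<close>
type_synonym cpoly2 = "(nat \<Rightarrow>\<^sub>0 nat) \<Rightarrow>\<^sub>0 cpoly"

definition tens :: "cpoly \<Rightarrow> cpoly \<Rightarrow> cpoly2" where
  "tens p c = Poly_Mapping.map (\<lambda>a. scl a c) p"

text \<open>The operator \<open>S \<otimes> T\<close> for linear \<open>S\<close> and \<open>T\<close>.\<close>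
definition tens_op :: "(cpoly \<Rightarrow> cpoly) \<Rightarrow> (cpoly \<Rightarrow> cpoly) \<Rightarrow> cpoly2 \<Rightarrow> cpoly2" where
  "tens_op S T u = (\<Sum>m\<in>Poly_Mapping.keys u.
     tens (S (Poly_Mapping.single m 1)) (T (Poly_Mapping.lookup u m)))"

definition tens_scl :: "complex \<Rightarrow> cpoly2 \<Rightarrow> cpoly2" where
  "tens_scl c u = Poly_Mapping.map (scl c) u"

definition tens_act :: "nat \<Rightarrow> real mat \<Rightarrow> cpoly2 \<Rightarrow> cpoly2" where
  "tens_act n A u = tens_op (poly_act n A) id u + tens_op id (ssw n A) u"

definition valued_polys :: "nat \<Rightarrow> cpoly set \<Rightarrow> cpoly2 set" where
  "valued_polys N S = {u. \<forall>m\<in>Poly_Mapping.keys u.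
     Poly_Mapping.keys m \<subseteq> {1..N} \<and> Poly_Mapping.lookup u m \<in> S}"

definition symp_dirac :: "nat \<Rightarrow> cpoly2 \<Rightarrow> cpoly2" where
  "symp_dirac n u =
     (\<Sum>j=1..n. tens_op (pd (2*j-1)) (e_op j) u - tens_op (pd (2*j)) (f_op j) u)"

section \<open>Complex modules over the symplectic Lie algebra\<close>

text \<open>The carrier is a subset of a type that provides the addition.\<close>
record 'v sp_rep =
  carr :: "'v set"
  smul :: "complex \<Rightarrow> 'v \<Rightarrow> 'v"
  act :: "real mat \<Rightarrow> 'v \<Rightarrow> 'v"

definition sp_module :: "nat \<Rightarrow> 'v::ab_group_add sp_rep \<Rightarrow> bool" where
  "sp_module n M \<longleftrightarrow>
     0 \<in> carr M \<and>
     (\<forall>u\<in>carr M. \<forall>v\<in>carr M. u + v \<in> carr M) \<and>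
     (\<forall>c. \<forall>v\<in>carr M. smul M c v \<in> carr M) \<and>
     (\<forall>c. \<forall>u\<in>carr M. \<forall>v\<in>carr M. smul M c (u + v) = smul M c u + smul M c v) \<and>
     (\<forall>c d. \<forall>v\<in>carr M. smul M (c + d) v = smul M c v + smul M d v) \<and>
     (\<forall>c d. \<forall>v\<in>carr M. smul M (c * d) v = smul M c (smul M d v)) \<and>
     (\<forall>v\<in>carr M. smul M 1 v = v) \<and>
     (\<forall>A\<in>sp n. \<forall>v\<in>carr M. act M A v \<in> carr M) \<and>
     (\<forall>A\<in>sp n. \<forall>u\<in>carr M. \<forall>v\<in>carr M. act M A (u + v) = act M A u + act M A v) \<and>
     (\<forall>A\<in>sp n. \<forall>c. \<forall>v\<in>carr M. act M A (smul M c v) = smul M c (act M A v)) \<and>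
     (\<forall>A\<in>sp n. \<forall>B\<in>sp n. \<forall>v\<in>carr M. act M (A + B) v = act M A v + act M B v) \<and>
     (\<forall>A\<in>sp n. \<forall>r::real. \<forall>v\<in>carr M. act M (r \<cdot>\<^sub>m A) v = smul M (of_real r) (act M A v)) \<and>
     (\<forall>A\<in>sp n. \<forall>B\<in>sp n. \<forall>v\<in>carr M.
        act M (A * B - B * A) v = act M A (act M B v) - act M B (act M A v))"

definition sp_submodule :: "nat \<Rightarrow> 'v::ab_group_add sp_rep \<Rightarrow> 'v set \<Rightarrow> bool" where
  "sp_submodule n M W \<longleftrightarrow> W \<subseteq> carr M \<and> 0 \<in> W \<and>
     (\<forall>u\<in>W. \<forall>v\<in>W. u + v \<in> W) \<and>
     (\<forall>c. \<forall>v\<in>W. smul M c v \<in> W) \<and>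
     (\<forall>A\<in>sp n. \<forall>v\<in>W. act M A v \<in> W)"

definition simple_module :: "nat \<Rightarrow> 'v::ab_group_add sp_rep \<Rightarrow> bool" where
  "simple_module n M \<longleftrightarrow> sp_module n M \<and> carr M \<noteq> {0} \<and>
     (\<forall>W. sp_submodule n M W \<longrightarrow> W = {0} \<or> W = carr M)"

definition sp_iso ::
    "nat \<Rightarrow> 'v::ab_group_add sp_rep \<Rightarrow> 'w::ab_group_add sp_rep \<Rightarrow> bool" where
  "sp_iso n M N \<longleftrightarrow> sp_module n M \<and> sp_module n N \<and>
     (\<exists>\<phi>. bij_betw \<phi> (carr M) (carr N) \<and>
        (\<forall>u\<in>carr M. \<forall>v\<in>carr M. \<phi> (u + v) = \<phi> u + \<phi> v) \<and>
        (\<forall>c. \<forall>v\<in>carr M. \<phi> (smul M c v) = smul N c (\<phi> v)) \<and>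
        (\<forall>A\<in>sp n. \<forall>v\<in>carr M. \<phi> (act M A v) = act N A (\<phi> v)))"

definition dsum2 :: "'v::ab_group_add sp_rep \<Rightarrow> 'w::ab_group_add sp_rep \<Rightarrow> ('v \<times> 'w) sp_rep" where
  "dsum2 M N = \<lparr>carr = carr M \<times> carr N,
     smul = (\<lambda>c (u, v). (smul M c u, smul N c v)),
     act = (\<lambda>A (u, v). (act M A u, act N A v))\<rparr>"

text \<open>The direct sum of a sequence of modules, as finitely supported sequences.\<close>
definition dsum :: "(nat \<Rightarrow> 'v::ab_group_add sp_rep) \<Rightarrow> (nat \<Rightarrow>\<^sub>0 'v) sp_rep" where
  "dsum M = \<lparr>carr = {u. \<forall>l. Poly_Mapping.lookup u l \<in> carr (M l)},
     smul = (\<lambda>c. Poly_Mapping.mapp (\<lambda>l. smul (M l) c)),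
     act = (\<lambda>A. Poly_Mapping.mapp (\<lambda>l. act (M l) A))\<rparr>"

section \<open>Highest weight modules\<close>

text \<open>The element of \<open>sp n\<close> acting on the Segal-Shale-Weil module by a given operator; the map
  \<open>ssw n\<close> is injective on \<open>sp n\<close>, with image \<open>quad_ops n\<close>.\<close>
definition sp_of :: "nat \<Rightarrow> (cpoly \<Rightarrow> cpoly) \<Rightarrow> real mat" where
  "sp_of n T = (THE A. A \<in> sp n \<and> ssw n A = T)"

definition cartan :: "nat \<Rightarrow> nat \<Rightarrow> real mat" where
  "cartan n i = sp_of n (\<lambda>p. scl (1/2) (e_op i (f_op i p) + f_op i (e_op i p)))"

text \<open>A vector spanning the root space of the \<open>i\<close>-th simple root, which is
  \<open>\<epsilon>\<^sub>i - \<epsilon>\<^sub>i\<^sub>+\<^sub>1\<close> for \<open>i < n\<close> and \<open>2\<epsilon>\<^sub>n\<close> for \<open>i = n\<close>.\<close>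
definition simple_root_vec :: "nat \<Rightarrow> nat \<Rightarrow> real mat" where
  "simple_root_vec n i =
     sp_of n (if i < n then (\<lambda>p. var (i+1) * pd i p) else (\<lambda>p. pd n (pd n p)))"

text \<open>A weight \<open>\<mu>\<close> is given by its coordinates \<open>\<mu> 1, \<dots>, \<mu> n\<close> with respect to
  \<open>\<epsilon>\<^sub>1, \<dots>, \<epsilon>\<^sub>n\<close>, which are its values on \<open>cartan n 1, \<dots>, cartan n n\<close>. The root vectors of
  the simple roots generate those of all positive roots.\<close>
definition highest_weight_vector ::
    "nat \<Rightarrow> (nat \<Rightarrow> complex) \<Rightarrow> 'v::ab_group_add sp_rep \<Rightarrow> 'v \<Rightarrow> bool" where
  "highest_weight_vector n \<mu> M v \<longleftrightarrow> v \<in> carr M \<and> v \<noteq> 0 \<and>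
     (\<forall>i\<in>{1..n}. act M (cartan n i) v = smul M (\<mu> i) v) \<and>
     (\<forall>i\<in>{1..n}. act M (simple_root_vec n i) v = 0)"

definition highest_weight_module ::
    "nat \<Rightarrow> (nat \<Rightarrow> complex) \<Rightarrow> 'v::ab_group_add sp_rep \<Rightarrow> bool" where
  "highest_weight_module n \<mu> M \<longleftrightarrow> sp_module n M \<and>
     (\<exists>v. highest_weight_vector n \<mu> M v \<and> (\<forall>W. sp_submodule n M W \<and> v \<in> W \<longrightarrow> W = carr M))"

text \<open>The simple highest weight module \<open>L(\<mu>)\<close> is determined up to isomorphism. Highest weight
  modules have countable dimension, so a copy of \<open>L(\<mu>)\<close> lives on a subspace of
  the space of finitely supported complex sequences.\<close>
definition L :: "nat \<Rightarrow> (nat \<Rightarrow> complex) \<Rightarrow> (nat \<Rightarrow>\<^sub>0 complex) sp_rep" where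
  "L n \<mu> = (SOME M. simple_module n M \<and> highest_weight_module n \<mu> M)"

definition fund_weight :: "nat \<Rightarrow> nat \<Rightarrow> complex" where
  "fund_weight i j = (if 1 \<le> j \<and> j \<le> i then 1 else 0)"

section \<open>The kernels of the symplectic Dirac operator\<close>

definition Ker_plus :: "nat \<Rightarrow> cpoly2 sp_rep" where
  "Ker_plus n = \<lparr>carr = {u \<in> valued_polys (2*n) (ssw_even n). symp_dirac n u = 0},
     smul = tens_scl, act = tens_act n\<rparr>"

definition Ker_minus :: "nat \<Rightarrow> cpoly2 sp_rep" where
  "Ker_minus n = \<lparr>carr = {u \<in> valued_polys (2*n) (ssw_odd n). symp_dirac n u = 0},
     smul = tens_scl, act = tens_act n\<rparr>"

end

(* The homogeneous components of the kernel are shown to be simple highest weight modules. Write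
   a_j, b_j for the coordinates x_{2j-1}, x_{2j}. A vector u of degree l in the kernel that is
   killed by the operators b_i d/da_j + b_j d/da_i - d^2/dq_i dq_j is killed by all d/da_j and has
   degree at most one in q: combining these equations with D u = 0, the component w of u of degree
   k in a and d in q satisfies beta Delta w = d(d-1)/2 w, where beta = sum b_i q_i and
   Delta = sum d^2/db_i dq_i generate an sl(2), and this excludes d = 2, 3 just below the top value
   of k. The remaining positive root vectors then leave a single line, spanned by b_1^l or b_1^l q_n,
   so every nonzero submodule contains this vector. It generates the component, because
   otherwise the orthogonal complement, for a contravariant form, of the submodule generated by it
   would contain it, although it is not isotropic. Simple highest weight modules are determined
   by their highest weight, and the kernel is the direct sum of its homogeneous components. *)

theory Submission
  imports Defs "HOL-Library.Nat_Bijection"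
begin

section \<open>Coefficients\<close>

text \<open>Each homogeneous component is infinite-dimensional, since the degree in q is unbounded,
  and this shapes two steps. Singular vectors exist because a shifted height is bounded below on
  monomials and decreases under positive root vectors. Orthogonal complements are formed inside
  eigenspaces of the sum of the \<open>cartan n i\<close>, which are finite-dimensional in a fixed
  degree in x. The eigenvalue d(d-1)/2 arises on multiplying the singular equations by q_i q_j and
  summing: Euler's identity gives d(d-1) on one side, and D u = 0 turns the other into twice beta
  Delta. If beta Delta w = t w in degree b in the b_j and d in q, then Delta w has the eigenvalue t
  - (n + b + d - 2). Negative eigenvalues do not occur, so 0 < t < n + b + d - 2 is impossible. For
  d = 3 and b = 1 the bound is 3 < n + 2, which is where n \<ge> 2 enters. The modules
  \<open>L n \<mu>\<close> are arbitrary choices, known only through being simple of highest weight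
  \<mu>; every identification with them goes through uniqueness.\<close>

definition unit_exp :: "nat \<Rightarrow> (nat \<Rightarrow>\<^sub>0 nat)" where
  "unit_exp k = Poly_Mapping.single k 1"

lemma lookup_unit_exp: "Poly_Mapping.lookup (unit_exp k) l = (if k = l then 1 else 0)"
  by (simp add: unit_exp_def lookup_single when_def)

lemma unit_exp_diff_add: "Poly_Mapping.lookup m k \<noteq> 0 \<Longrightarrow> m - unit_exp k + unit_exp k = m"
  by (rule poly_mapping_eqI) (auto simp: lookup_add lookup_minus lookup_unit_exp)

lemma unit_exp_add_diff_self: "Poly_Mapping.lookup m k \<noteq> 0 \<Longrightarrow> unit_exp k + (m - unit_exp k) = m"
  by (subst add.commute) (rule unit_exp_diff_add)

lemma unit_exp_diff_commute:
  "(m :: nat \<Rightarrow>\<^sub>0 nat) - unit_exp k - unit_exp l = m - unit_exp l - unit_exp k"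
  by (rule poly_mapping_eqI) (auto simp: lookup_minus)

lemma unit_exp_add_diff_neq:
  "k \<noteq> l \<Longrightarrow> m + unit_exp k - unit_exp l = m - unit_exp l + (unit_exp k :: nat \<Rightarrow>\<^sub>0 nat)"
  by (rule poly_mapping_eqI) (auto simp: lookup_minus lookup_add lookup_unit_exp)

lemma lookup_scl [simp]: "Poly_Mapping.lookup (scl c p) m = c * Poly_Mapping.lookup p m"
  unfolding scl_def mult_map_scale_conv_mult[symmetric]
  by (simp add: Poly_Mapping.map.rep_eq when_def)

text \<open>Truncated subtraction forces the case distinction: if \<open>k\<close> does not occur in
  \<open>m\<close>, then \<open>m - unit_exp k\<close> is \<open>m\<close> itself.\<close>

lemma lookup_var_mult:
  "Poly_Mapping.lookup (var k * p) m =
     (if Poly_Mapping.lookup m k = 0 then 0 else Poly_Mapping.lookup p (m - unit_exp k))"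
proof -
  have s: "Poly_Mapping.lookup (var k * p) m =
      (\<Sum>q. (Poly_Mapping.lookup p q when m = unit_exp k + q))"
    unfolding lookup_mult var_def unit_exp_def[symmetric]
    by (subst Sum_any.expand_superset[of "{unit_exp k}"])
      (auto simp: lookup_single when_def split: if_splits)
  show ?thesis
  proof (cases "Poly_Mapping.lookup m k = 0")
    case True
    then have "m \<noteq> unit_exp k + q" for q
      by (metis add_eq_0_iff_both_eq_0 lookup_add lookup_unit_exp zero_neq_one)
    then show ?thesis using True by (simp add: s)
  next
    case False
    then have "(m = unit_exp k + q) = (q = m - unit_exp k)" for q
      by (metis add.commute add_diff_cancel_left' unit_exp_diff_add)
    then show ?thesis using False by (simp add: s)
  qed
qed

lemma lookup_pd:
  "Poly_Mapping.lookup (pd k p) m =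
     of_nat (Suc (Poly_Mapping.lookup m k)) * Poly_Mapping.lookup p (m + unit_exp k)"
proof -
  have "Poly_Mapping.lookup (pd k p) m = (\<Sum>r\<in>Poly_Mapping.keys p.
      (of_nat (Poly_Mapping.lookup r k) * Poly_Mapping.lookup p r when r - unit_exp k = m))"
    by (simp add: pd_def lookup_sum lookup_single unit_exp_def)
  also have "\<dots> = (\<Sum>r\<in>Poly_Mapping.keys p. if r = m + unit_exp k then
      of_nat (Suc (Poly_Mapping.lookup m k)) * Poly_Mapping.lookup p r else 0)"
  proof (rule sum.cong[OF refl])
    fix r
    show "(of_nat (Poly_Mapping.lookup r k) * Poly_Mapping.lookup p r when r - unit_exp k = m) =
      (if r = m + unit_exp k then
        of_nat (Suc (Poly_Mapping.lookup m k)) * Poly_Mapping.lookup p r else 0)"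
      \<comment> \<open>If \<open>k\<close> does not occur in \<open>r\<close>, truncated
        subtraction gives \<open>r - unit_exp k = r\<close>, but then the exponent in front makes
        the term vanish.\<close>
      using unit_exp_diff_add[of r k]
      by (cases "Poly_Mapping.lookup r k = 0") (auto simp: when_def lookup_add lookup_unit_exp)
  qed
  also have "\<dots> = of_nat (Suc (Poly_Mapping.lookup m k)) * Poly_Mapping.lookup p (m + unit_exp k)"
    by (auto simp: in_keys_iff)
  finally show ?thesis .
qed

text \<open>The coefficient of x^m q^r. Identities between differential operators are reduced to
  identities between these numbers, with \<open>cf_eqI\<close> as extensionality.\<close>

definition cf :: "cpoly2 \<Rightarrow> (nat \<Rightarrow>\<^sub>0 nat) \<Rightarrow> (nat \<Rightarrow>\<^sub>0 nat) \<Rightarrow> complex" where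
  "cf u m r = Poly_Mapping.lookup (Poly_Mapping.lookup u m) r"

lemma cf_eqI: "(\<And>m r. cf u m r = cf w m r) \<Longrightarrow> u = w"
  by (intro poly_mapping_eqI) (simp add: cf_def)

lemma cf_linear [simp]:
  "cf 0 m r = 0" "cf (u + w) m r = cf u m r + cf w m r" "cf (u - w) m r = cf u m r - cf w m r"
  "cf (- u) m r = - cf u m r" "cf (tens_scl c u) m r = c * cf u m r"
  "cf (sum f I) m r = (\<Sum>i\<in>I. cf (f i) m r)"
  by (simp_all add: cf_def lookup_add lookup_minus lookup_sum tens_scl_def
      Poly_Mapping.map.rep_eq when_def)

lemma scl_linear [simp]:
  "scl c 0 = 0" "scl 0 p = 0" "scl 1 p = p" "scl c (scl d p) = scl (c * d) p"
  by (auto intro!: poly_mapping_eqI)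

lemma lookup_tens: "Poly_Mapping.lookup (tens p c) m = scl (Poly_Mapping.lookup p m) c"
  by (auto simp: tens_def Poly_Mapping.map.rep_eq when_def)

lemma lookup_tens_op:
  "Poly_Mapping.lookup (tens_op S T u) m = (\<Sum>r\<in>Poly_Mapping.keys u.
     scl (Poly_Mapping.lookup (S (Poly_Mapping.single r 1)) m) (T (Poly_Mapping.lookup u r)))"
  by (simp add: tens_op_def lookup_sum lookup_tens)

lemma lookup_tens_op_id:
  assumes "T 0 = 0"
  shows "Poly_Mapping.lookup (tens_op id T u) m = T (Poly_Mapping.lookup u m)"
proof -
  have "Poly_Mapping.lookup (tens_op id T u) m = (\<Sum>r\<in>Poly_Mapping.keys u.
     if r = m then T (Poly_Mapping.lookup u r) else 0)"
    unfolding lookup_tens_op by (rule sum.cong) (auto simp: lookup_single when_def)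
  then show ?thesis using assms by (auto simp: in_keys_iff)
qed

lemma lookup_tens_op_pd:
  assumes "T 0 = 0"
  shows "Poly_Mapping.lookup (tens_op (pd k) T u) m =
     scl (of_nat (Suc (Poly_Mapping.lookup m k))) (T (Poly_Mapping.lookup u (m + unit_exp k)))"
proof -
  have "Poly_Mapping.lookup (tens_op (pd k) T u) m = (\<Sum>r\<in>Poly_Mapping.keys u.
     if r = m + unit_exp k then
       scl (of_nat (Suc (Poly_Mapping.lookup m k))) (T (Poly_Mapping.lookup u r)) else 0)"
    unfolding lookup_tens_op by (rule sum.cong) (auto simp: lookup_single lookup_pd when_def)
  then show ?thesis using assms by (auto simp: in_keys_iff)
qed

lemma lookup_tens_op_var_pd:
  "Poly_Mapping.lookup (tens_op (\<lambda>p. var l * pd k p) id u) m =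
     (if Poly_Mapping.lookup m l = 0 then 0
      else Poly_Mapping.lookup (tens_op (pd k) id u) (m - unit_exp l))"
  by (simp add: lookup_tens_op lookup_var_mult)

section \<open>Differential operators on spinor-valued polynomials\<close>

definition x_mul :: "nat \<Rightarrow> cpoly2 \<Rightarrow> cpoly2" where
  "x_mul k = tens_op (\<lambda>p. var k * p) id"

definition x_pd :: "nat \<Rightarrow> cpoly2 \<Rightarrow> cpoly2" where
  "x_pd k = tens_op (pd k) id"

definition q_mul :: "nat \<Rightarrow> cpoly2 \<Rightarrow> cpoly2" where
  "q_mul k = tens_op id (\<lambda>p. var k * p)"

definition q_pd :: "nat \<Rightarrow> cpoly2 \<Rightarrow> cpoly2" where
  "q_pd k = tens_op id (pd k)"

lemma pd_0 [simp]: "pd k 0 = 0"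
  by (simp add: pd_def)

lemma cf_x_pd: "cf (x_pd k u) m r = of_nat (Suc (Poly_Mapping.lookup m k)) * cf u (m + unit_exp k) r"
  by (simp add: cf_def x_pd_def lookup_tens_op_pd)

lemma cf_q_pd: "cf (q_pd k u) m r = of_nat (Suc (Poly_Mapping.lookup r k)) * cf u m (r + unit_exp k)"
  by (simp add: cf_def q_pd_def lookup_tens_op_id lookup_pd)

lemma cf_q_mul: "cf (q_mul k u) m r =
    (if Poly_Mapping.lookup r k = 0 then 0 else cf u m (r - unit_exp k))"
  by (simp add: cf_def q_mul_def lookup_tens_op_id lookup_var_mult)

lemma cf_x_mul: "cf (x_mul k u) m r =
    (if Poly_Mapping.lookup m k = 0 then 0 else cf u (m - unit_exp k) r)"
proof -
  have "Poly_Mapping.lookup (x_mul k u) m = (\<Sum>r\<in>Poly_Mapping.keys u.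
     if r = m - unit_exp k then
       (if Poly_Mapping.lookup m k = 0 then 0 else Poly_Mapping.lookup u r) else 0)"
    unfolding lookup_tens_op x_mul_def
    by (rule sum.cong) (auto simp: lookup_single lookup_var_mult when_def)
  then show ?thesis by (auto simp: in_keys_iff cf_def)
qed

lemmas cf_ops = cf_x_pd cf_q_pd cf_q_mul cf_x_mul

lemma x_mul_linear [simp]:
  "x_mul k 0 = 0" "x_mul k (u + w) = x_mul k u + x_mul k w" "x_mul k (u - w) = x_mul k u - x_mul k w"
  "x_mul k (- u) = - x_mul k u" "x_mul k (tens_scl c u) = tens_scl c (x_mul k u)"
  "x_mul k (sum f I) = (\<Sum>i\<in>I. x_mul k (f i))"
  by (auto intro!: cf_eqI simp: cf_ops)

lemma x_pd_linear [simp]: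
  "x_pd k 0 = 0" "x_pd k (u + w) = x_pd k u + x_pd k w" "x_pd k (u - w) = x_pd k u - x_pd k w"
  "x_pd k (- u) = - x_pd k u" "x_pd k (tens_scl c u) = tens_scl c (x_pd k u)"
  "x_pd k (sum f I) = (\<Sum>i\<in>I. x_pd k (f i))"
  by (auto intro!: cf_eqI simp: cf_ops algebra_simps sum_distrib_left sum.distrib)

lemma q_mul_linear [simp]:
  "q_mul k 0 = 0" "q_mul k (u + w) = q_mul k u + q_mul k w" "q_mul k (u - w) = q_mul k u - q_mul k w"
  "q_mul k (- u) = - q_mul k u" "q_mul k (tens_scl c u) = tens_scl c (q_mul k u)"
  "q_mul k (sum f I) = (\<Sum>i\<in>I. q_mul k (f i))"
  by (auto intro!: cf_eqI simp: cf_ops)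

lemma q_pd_linear [simp]:
  "q_pd k 0 = 0" "q_pd k (u + w) = q_pd k u + q_pd k w" "q_pd k (u - w) = q_pd k u - q_pd k w"
  "q_pd k (- u) = - q_pd k u" "q_pd k (tens_scl c u) = tens_scl c (q_pd k u)"
  "q_pd k (sum f I) = (\<Sum>i\<in>I. q_pd k (f i))"
  by (auto intro!: cf_eqI simp: cf_ops algebra_simps sum_distrib_left sum.distrib)

lemma tens_scl_linear [simp]:
  "tens_scl c 0 = 0" "tens_scl 0 u = 0" "tens_scl 1 u = u"
  "tens_scl c (tens_scl d u) = tens_scl (c * d) u" "tens_scl (- 1) u = - u"
  "tens_scl c (u + w) = tens_scl c u + tens_scl c w"
  "tens_scl c (u - w) = tens_scl c u - tens_scl c w" "tens_scl c (- u) = - tens_scl c u"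
  "tens_scl c (sum f I) = (\<Sum>i\<in>I. tens_scl c (f i))"
  by (auto intro!: cf_eqI simp: algebra_simps sum_distrib_left)

lemma ops_commute:
  "x_mul k (x_mul l u) = x_mul l (x_mul k u)" "x_pd k (x_pd l u) = x_pd l (x_pd k u)"
  "q_mul i (q_mul j u) = q_mul j (q_mul i u)" "q_pd i (q_pd j u) = q_pd j (q_pd i u)"
  "q_mul i (x_mul k u) = x_mul k (q_mul i u)" "q_mul i (x_pd k u) = x_pd k (q_mul i u)"
  "q_pd i (x_mul k u) = x_mul k (q_pd i u)" "q_pd i (x_pd k u) = x_pd k (q_pd i u)"
  by (auto intro!: cf_eqI simp: cf_ops lookup_minus lookup_add lookup_unit_exp
      unit_exp_diff_commute ac_simps)

lemma x_pd_x_mul: "x_pd k (x_mul l u) = x_mul l (x_pd k u) + (if k = l then u else 0)"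
  by (auto intro!: cf_eqI simp: cf_ops lookup_minus lookup_add lookup_unit_exp
      unit_exp_add_diff_neq unit_exp_diff_add unit_exp_add_diff_self algebra_simps)

lemma q_pd_q_mul: "q_pd k (q_mul l u) = q_mul l (q_pd k u) + (if k = l then u else 0)"
  by (auto intro!: cf_eqI simp: cf_ops lookup_minus lookup_add lookup_unit_exp
      unit_exp_add_diff_neq unit_exp_diff_add unit_exp_add_diff_self algebra_simps)

section \<open>The symplectic Lie algebra in coordinates\<close>

text \<open>One family of generators indexed like the coordinates of V, so that commutator
  computations need not distinguish the kinds e and f.\<close>

definition zop :: "nat \<Rightarrow> cpoly \<Rightarrow> cpoly" where
  "zop k = (if even k then e_op (k div 2) else f_op (Suc k div 2))"

definition idx :: "nat \<Rightarrow> nat set" where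
  "idx n = {1..2*n}"

lemma finite_idx [simp]: "finite (idx n)"
  by (simp add: idx_def)

text \<open>The basis vectors \<open>z\<^sub>2\<^sub>j\<^sub>-\<^sub>1 = f\<^sub>j\<close> and \<open>z\<^sub>2\<^sub>j = e\<^sub>j\<close> satisfy \<open>\<omega>(z\<^sub>k, z\<^sub>l) = 0\<close> unless \<open>l\<close> is the
  partner of \<open>k\<close>, in which case the value is \<open>- sg k\<close>.\<close>
definition partner :: "nat \<Rightarrow> nat" where
  "partner k = (if odd k then k + 1 else k - 1)"

definition sg :: "nat \<Rightarrow> real" where
  "sg k = (if odd k then 1 else - 1)"

definition omega :: "nat \<Rightarrow> nat \<Rightarrow> real" where
  "omega k l = (if l = partner k then - sg k else 0)"

definition ent :: "real mat \<Rightarrow> nat \<Rightarrow> nat \<Rightarrow> real" where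
  "ent A k l = A $$ (k - 1, l - 1)"

lemma partner_in [simp]: "k \<in> idx n \<Longrightarrow> partner k \<in> idx n"
  by (auto simp: idx_def partner_def) presburger+

lemma partner_partner [simp]: "k \<in> idx n \<Longrightarrow> partner (partner k) = k"
  by (auto simp: idx_def partner_def)

lemma sg_partner [simp]: "k \<in> idx n \<Longrightarrow> sg (partner k) = - sg k"
  by (auto simp: idx_def partner_def sg_def)

lemma sg_square [simp]: "sg k * sg k = 1" "sg k * (sg k * x) = x"
  by (auto simp: sg_def)

lemma sg_nonzero [simp]: "sg k \<noteq> 0"
  by (auto simp: sg_def)

lemma partner_odd_even [simp]:
  "1 \<le> j \<Longrightarrow> partner (2*j) = 2*j - 1" "1 \<le> j \<Longrightarrow> partner (2*j - Suc 0) = 2*j"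
  "sg (2*j) = - 1" "1 \<le> j \<Longrightarrow> sg (2*j - Suc 0) = 1"
  by (auto simp: partner_def sg_def)

lemma sum_partner: "(\<Sum>k\<in>idx n. g (partner k)) = (\<Sum>k\<in>idx n. g k)"
  by (rule sum.reindex_bij_witness[where i = partner and j = partner])
    (auto intro: partner_partner partner_in)

lemma sum_pairs:
  fixes g :: "nat \<Rightarrow> 'a::comm_monoid_add"
  shows "(\<Sum>k\<in>idx n. g k) = (\<Sum>j=1..n. g (2*j-1) + g (2*j))"
  unfolding idx_def by (induction n) (auto simp: add.assoc)

lemma scl_add: "scl c (p + q) = scl c p + scl c q" "scl (c + d) p = scl c p + scl d p"
  "scl c (p - q) = scl c p - scl c q" "scl (c - d) p = scl c p - scl d p"
  "scl (- c) p = - scl c p" "scl c (- p) = - scl c p"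
  by (auto intro!: poly_mapping_eqI simp: lookup_add lookup_minus algebra_simps)

lemma scl_2: "scl 2 p = p + p"
  using scl_add(2)[of 1 1 p] by simp

lemma scl_sum: "scl c (sum f I) = (\<Sum>i\<in>I. scl c (f i))" "scl (sum g I) p = (\<Sum>i\<in>I. scl (g i) p)"
  by (auto intro!: poly_mapping_eqI simp: lookup_sum sum_distrib_left sum_distrib_right)

lemma zop_linear:
  "zop k 0 = 0" "zop k (p + q) = zop k p + zop k q" "zop k (p - q) = zop k p - zop k q"
  "zop k (- p) = - zop k p" "zop k (scl c p) = scl c (zop k p)"
  "zop k (sum f I) = (\<Sum>i\<in>I. zop k (f i))"
  by (auto intro!: poly_mapping_eqI simp: zop_def e_op_def f_op_def lookup_pd lookup_var_mult
      lookup_add lookup_minus lookup_sum distrib_left right_diff_distrib mult.left_commute sum_distrib_left)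

lemma pd_commute: "pd k (pd l p) = pd l (pd k p)"
  by (rule poly_mapping_eqI) (auto simp: lookup_pd lookup_add lookup_unit_exp ac_simps)

lemma pd_var_mult: "pd k (var l * p) = var l * pd k p + (if k = l then p else 0)"
  by (rule poly_mapping_eqI)
    (auto simp: lookup_pd lookup_var_mult lookup_add lookup_unit_exp unit_exp_add_diff_neq
      unit_exp_diff_add lookup_minus distrib_right distrib_left
      left_diff_distrib)

lemma var_mult_scl: "var k * scl c p = scl c (var k * p)"
  by (rule poly_mapping_eqI) (simp add: lookup_var_mult)

lemma pd_linear:
  "pd k (scl c p) = scl c (pd k p)" "pd k (p + q) = pd k p + pd k q"
  by (rule poly_mapping_eqI, simp add: lookup_pd lookup_add algebra_simps)+

lemma idx_cases [consumes 1, case_names even odd]: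
  assumes "k \<in> idx n"
  obtains i where "i \<in> {1..n}" "k = 2*i" | i where "i \<in> {1..n}" "k = 2*i - 1"
proof (cases "even k")
  case True
  then show ?thesis using assms that(1)[of "k div 2"] by (auto simp: idx_def)
next
  case False
  then show ?thesis using assms that(2)[of "Suc k div 2"] by (auto simp: idx_def elim!: oddE)
qed

lemma zop_even: "zop (2*j) = e_op j"
  and zop_odd: "1 \<le> j \<Longrightarrow> zop (2*j - 1) = f_op j"
  by (auto simp: zop_def)

lemma omega_eqs:
  assumes "1 \<le> i" "1 \<le> j"
  shows "omega (2*i) (2*j) = 0" "omega (2*i - 1) (2*j - 1) = 0"
    "omega (2*i) (2*j - 1) = (if i = j then 1 else 0)"
    "omega (2*i - 1) (2*j) = (if i = j then - 1 else 0)"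
  using assms by (auto simp: omega_def partner_def sg_def) presburger+

lemma zop_commute:
  assumes "k \<in> idx n" "l \<in> idx n"
  shows "zop k (zop l p) = zop l (zop k p) + scl (of_real (omega k l)) p"
  using assms(1)
proof (cases rule: idx_cases)
  case (even i)
  note k = this
  from assms(2) show ?thesis
  proof (cases rule: idx_cases)
    case (even j)
    then show ?thesis using k
      by (simp add: omega_eqs zop_even e_op_def var_mult_scl mult.left_commute)
  next
    case (odd j)
    then show ?thesis using k
      by (simp only: zop_even zop_odd omega_eqs atLeastAtMost_iff)
        (auto simp: e_op_def f_op_def var_mult_scl pd_linear pd_var_mult scl_add intro!: poly_mapping_eqI simp: lookup_add)
  qed
next
  case (odd i)
  note k = this
  from assms(2) show ?thesis
  proof (cases rule: idx_cases)
    case (even j)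
    then show ?thesis using k
      by (simp only: zop_even zop_odd omega_eqs atLeastAtMost_iff)
        (auto simp: e_op_def f_op_def var_mult_scl pd_linear pd_var_mult scl_add intro!: poly_mapping_eqI simp: lookup_add)
  next
    case (odd j)
    then show ?thesis using k
      by (simp only: omega_eqs zop_odd atLeastAtMost_iff)
        (simp add: f_op_def pd_linear pd_commute)
  qed
qed

lemma zop_commute2:
  assumes "a \<in> idx n" "b \<in> idx n" "k \<in> idx n"
  shows "zop a (zop b (zop k p)) - zop k (zop a (zop b p)) =
    scl (of_real (omega b k)) (zop a p) + scl (of_real (omega a k)) (zop b p)"
  by (simp add: zop_commute[OF assms(2,3)] zop_commute[OF assms(1,3)] zop_linear)

lemma sum_single_index:
  fixes g :: "nat \<Rightarrow> 'a::comm_monoid_add"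
  assumes "finite I" "a \<in> I" "\<And>k. k \<in> I \<Longrightarrow> k \<noteq> a \<Longrightarrow> g k = 0"
  shows "sum g I = g a"
  by (subst sum.mono_neutral_right[of I "{a}"]) (use assms in auto)

lemma sum_omega:
  assumes "b \<in> idx n"
  shows "(\<Sum>k\<in>idx n. scl (of_real (sg k) * of_real (omega b k)) (g k)) = g (partner b)"
proof -
  have "(\<Sum>k\<in>idx n. scl (of_real (sg k) * of_real (omega b k)) (g k)) =
      scl (of_real (sg (partner b)) * of_real (omega b (partner b))) (g (partner b))"
    by (rule sum_single_index) (use partner_in[OF assms] in \<open>auto simp: omega_def\<close>)
  also have "\<dots> = g (partner b)"
    using assms by (simp add: omega_def of_real_mult[symmetric] del: of_real_mult)
  finally show ?thesis .
qed

text \<open>Commutators with T, contracted against the dual basis. The value depends on T only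
  through what the condition in \<open>ssw\<close> prescribes, and on symmetrised quadratic
  operators it returns 2 T.\<close>

definition comm_sum :: "nat \<Rightarrow> (cpoly \<Rightarrow> cpoly) \<Rightarrow> cpoly \<Rightarrow> cpoly" where
  "comm_sum n T p = (\<Sum>k\<in>idx n. scl (of_real (sg k))
     (T (zop k (zop (partner k) p)) - zop k (T (zop (partner k) p))))"

text \<open>By the derivation rule only the partners of \<open>a\<close> and \<open>b\<close>
  contribute; this is Euler's identity for a quadratic expression.\<close>

lemma comm_sum_zop_zop:
  assumes "a \<in> idx n" "b \<in> idx n"
  shows "comm_sum n (\<lambda>p. zop a (zop b p)) p = zop a (zop b p) + zop b (zop a p)"
proof -
  have "comm_sum n (\<lambda>p. zop a (zop b p)) p = (\<Sum>k\<in>idx n.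
      scl (of_real (sg k) * of_real (omega b k)) (zop a (zop (partner k) p)) +
      scl (of_real (sg k) * of_real (omega a k)) (zop b (zop (partner k) p)))"
    unfolding comm_sum_def using assms
    by (intro sum.cong refl) (simp add: zop_commute2 scl_add)
  also have "\<dots> = zop a (zop b p) + zop b (zop a p)"
    using assms by (simp add: sum.distrib sum_omega)
  finally show ?thesis .
qed

lemma comm_sum_linear:
  "comm_sum n (\<lambda>p. T p + T' p) p = comm_sum n T p + comm_sum n T' p"
  "comm_sum n (\<lambda>p. scl c (T p)) p = scl c (comm_sum n T p)"
  "comm_sum n (\<lambda>p. \<Sum>i\<in>I. S i p) p = (\<Sum>i\<in>I. comm_sum n (S i) p)"
proof -
  show "comm_sum n (\<lambda>p. T p + T' p) p = comm_sum n T p + comm_sum n T' p"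
    by (simp add: comm_sum_def zop_linear scl_add sum.distrib[symmetric] algebra_simps)
  show "comm_sum n (\<lambda>p. scl c (T p)) p = scl c (comm_sum n T p)"
    by (simp add: comm_sum_def zop_linear scl_add scl_sum mult.commute)
  show "comm_sum n (\<lambda>p. \<Sum>i\<in>I. S i p) p = (\<Sum>i\<in>I. comm_sum n (S i) p)"
    unfolding comm_sum_def
    by (subst sum.swap) (simp add: zop_linear scl_add scl_sum sum_subtractf)
qed

text \<open>The generators of \<open>quad_ops\<close> are symmetric in their two factors, so both
  orders produced by \<open>comm_sum_zop_zop\<close> give the same operator. An additive constant
  would be annihilated; symmetry is what pins down the constant term of L(A).\<close>

lemma comm_sum_quad_ops:
  assumes "T \<in> quad_ops n"
  shows "comm_sum n T p = scl 2 (T p)"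
proof -
  obtain a b c :: "nat \<Rightarrow> nat \<Rightarrow> real" where T: "T = (\<lambda>p. \<Sum>i=1..n. \<Sum>j=1..n.
       scl (of_real (a i j)) (e_op i (e_op j p))
     + scl (of_real (b i j)) (f_op i (f_op j p))
     + scl (of_real (c i j)) (e_op i (f_op j p) + f_op j (e_op i p)))"
    using assms by (auto simp: quad_ops_def)
  have idx: "2*i \<in> idx n" "2*i - 1 \<in> idx n" if "i \<in> {1..n}" for i
    using that by (auto simp: idx_def)
  have ee: "comm_sum n (\<lambda>p. e_op i (e_op j p)) p = scl 2 (e_op i (e_op j p))"
    if ij: "i \<in> {1..n}" "j \<in> {1..n}" for i j
    using comm_sum_zop_zop[OF idx(1)[OF ij(1)] idx(1)[OF ij(2)], of p] ij
      zop_commute[OF idx(1)[OF ij(1)] idx(1)[OF ij(2)], of p]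
    by (simp add: zop_even scl_2 omega_eqs)
  have ff: "comm_sum n (\<lambda>p. f_op i (f_op j p)) p = scl 2 (f_op i (f_op j p))"
    if ij: "i \<in> {1..n}" "j \<in> {1..n}" for i j
  proof -
    have "zop (2*i-1) = f_op i" "zop (2*j-1) = f_op j" "omega (2*i-1) (2*j-1) = 0"
      using ij by (simp_all only: zop_odd omega_eqs atLeastAtMost_iff)
    then show ?thesis
      using comm_sum_zop_zop[OF idx(2)[OF ij(1)] idx(2)[OF ij(2)], of p]
        zop_commute[OF idx(2)[OF ij(1)] idx(2)[OF ij(2)], of p]
      by (simp add: scl_2)
  qed
  \<comment> \<open>The two mixed products are treated together: for one of them alone
    \<open>comm_sum\<close> gives the sum of both orders and not twice the product.\<close>
  have ef: "scl d (comm_sum n (\<lambda>p. e_op i (f_op j p)) p) + scl d (comm_sum n (\<lambda>p. f_op j (e_op i p)) p) =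
      scl d (scl 2 (e_op i (f_op j p) + f_op j (e_op i p)))"
    if ij: "i \<in> {1..n}" "j \<in> {1..n}" for i j d
  proof -
    have "zop (2*i) = e_op i" "zop (2*j-1) = f_op j"
      using ij by (simp_all only: zop_odd zop_even atLeastAtMost_iff)
    then have "comm_sum n (\<lambda>p. e_op i (f_op j p)) p + comm_sum n (\<lambda>p. f_op j (e_op i p)) p =
        scl 2 (e_op i (f_op j p) + f_op j (e_op i p))"
      using comm_sum_zop_zop[OF idx(1)[OF ij(1)] idx(2)[OF ij(2)], of p]
        comm_sum_zop_zop[OF idx(2)[OF ij(2)] idx(1)[OF ij(1)], of p]
      by (simp add: scl_2 ac_simps)
    then show ?thesis by (simp only: scl_add(1)[symmetric])
  qed
  show ?thesis
    unfolding T comm_sum_linear scl_sum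
    by (intro sum.cong refl) (simp add: ee ff ef scl_add(1) mult.commute)
qed

section \<open>Matrix entries and the defining relation of the symplectic Lie algebra\<close>

lemma crd_mult_mat_vec:
  assumes "A \<in> carrier_mat (2*n) (2*n)" "v \<in> carrier_vec (2*n)" "k \<in> idx n"
  shows "crd (A *\<^sub>v v) k = (\<Sum>l\<in>idx n. ent A k l * crd v l)"
proof -
  have "crd (A *\<^sub>v v) k = (\<Sum>l=0..<2*n. A $$ (k - 1, l) * v $ l)"
    using assms by (auto simp: crd_def scalar_prod_def idx_def)
  also have "\<dots> = (\<Sum>l\<in>idx n. ent A k l * crd v l)"
    by (rule sum.reindex_bij_witness[where i = "\<lambda>l. l - 1" and j = Suc])
      (auto simp: ent_def crd_def idx_def)
  finally show ?thesis .
qed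

lemma ent_mult:
  assumes "A \<in> carrier_mat (2*n) (2*n)" "B \<in> carrier_mat (2*n) (2*n)" "k \<in> idx n" "l \<in> idx n"
  shows "ent (A * B) k l = (\<Sum>m\<in>idx n. ent A k m * ent B m l)"
proof -
  have "ent (A * B) k l = (\<Sum>m=0..<2*n. A $$ (k - 1, m) * B $$ (m, l - 1))"
    using assms by (auto simp: ent_def scalar_prod_def idx_def)
  also have "\<dots> = (\<Sum>m\<in>idx n. ent A k m * ent B m l)"
    by (rule sum.reindex_bij_witness[where i = "\<lambda>l. l - 1" and j = Suc]) (auto simp: ent_def idx_def)
  finally show ?thesis .
qed

lemma ent_linear:
  assumes "A \<in> carrier_mat (2*n) (2*n)" "B \<in> carrier_mat (2*n) (2*n)" "k \<in> idx n" "l \<in> idx n"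
  shows "ent (A + B) k l = ent A k l + ent B k l" "ent (A - B) k l = ent A k l - ent B k l"
  using assms by (auto simp: ent_def idx_def)

lemma ent_smult:
  assumes "A \<in> carrier_mat (2*n) (2*n)" "k \<in> idx n" "l \<in> idx n"
  shows "ent (r \<cdot>\<^sub>m A) k l = r * ent A k l"
  using assms by (auto simp: ent_def idx_def)

lemma ent_eqI:
  assumes "A \<in> carrier_mat (2*n) (2*n)" "B \<in> carrier_mat (2*n) (2*n)"
    and "\<And>k l. k \<in> idx n \<Longrightarrow> l \<in> idx n \<Longrightarrow> ent A k l = ent B k l"
  shows "A = B"
proof (rule eq_matI)
  fix i j assume "i < dim_row B" "j < dim_col B"
  then show "A $$ (i, j) = B $$ (i, j)"
    using assms(3)[of "Suc i" "Suc j"] assms(2) by (auto simp: ent_def idx_def)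
qed (use assms in auto)

definition mat_of :: "nat \<Rightarrow> (nat \<Rightarrow> nat \<Rightarrow> real) \<Rightarrow> real mat" where
  "mat_of n g = mat (2*n) (2*n) (\<lambda>(i, j). g (i + 1) (j + 1))"

lemma mat_of_carrier [simp]: "mat_of n g \<in> carrier_mat (2*n) (2*n)"
  by (simp add: mat_of_def)

lemma ent_mat_of [simp]: "k \<in> idx n \<Longrightarrow> l \<in> idx n \<Longrightarrow> ent (mat_of n g) k l = g k l"
  by (auto simp: ent_def mat_of_def idx_def)

lemma symp_form_crd: "symp_form n v w = (\<Sum>k\<in>idx n. - sg k * crd v k * crd w (partner k))"
  unfolding symp_form_def sum_pairs
  by (rule sum.cong) auto

lemma crd_unit_vec: "k \<in> idx n \<Longrightarrow> l \<in> idx n \<Longrightarrow>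
    crd (unit_vec (2*n) (l - 1)) k = (if k = l then 1 else 0)"
  by (auto simp: crd_def idx_def)

lemma sp_carrier: "A \<in> sp n \<Longrightarrow> A \<in> carrier_mat (2*n) (2*n)"
  by (simp add: sp_def)

text \<open>Testing the invariance of the form on the unit vectors number \<open>l\<close> and
  \<open>partner k\<close> isolates the entry at (k, l) and its mirror image. Conversely, the
  entrywise relation makes the two double sums cancel after a reindexing by partners.\<close>

lemma sp_iff:
  "A \<in> sp n \<longleftrightarrow> A \<in> carrier_mat (2*n) (2*n) \<and>
    (\<forall>k\<in>idx n. \<forall>l\<in>idx n. ent A k l = - sg k * sg l * ent A (partner l) (partner k))"
proof (intro iffI conjI ballI)
  fix k l assume A: "A \<in> sp n" and kl: "k \<in> idx n" "l \<in> idx n"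
  let ?k = "partner k"
  let ?v = "unit_vec (2*n) (l - 1)" and ?w = "unit_vec (2*n) (?k - 1)"
  have k': "?k \<in> idx n" and k'': "partner ?k = k" using kl partner_in partner_partner by blast+
  have inj: "partner m \<noteq> ?k" if "m \<in> idx n" "m \<noteq> k" for m
    using that kl partner_partner by metis
  have Av: "crd (A *\<^sub>v ?v) m = ent A m l" if "m \<in> idx n" for m
    unfolding crd_mult_mat_vec[OF sp_carrier[OF A] unit_vec_carrier that]
    by (subst sum_single_index[of _ l]) (use kl crd_unit_vec[of _ n l] in auto)
  have Aw: "crd (A *\<^sub>v ?w) m = ent A m ?k" if "m \<in> idx n" for m
    unfolding crd_mult_mat_vec[OF sp_carrier[OF A] unit_vec_carrier that]
    by (subst sum_single_index[of _ ?k]) (use k' crd_unit_vec[of _ n ?k] in auto)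
  have "symp_form n (A *\<^sub>v ?v) ?w = - sg k * ent A k l"
    unfolding symp_form_crd
    by (subst sum_single_index[of _ k])
      (use kl k' k'' partner_in crd_unit_vec[of _ n ?k] inj Av[OF kl(1)] in auto)
  moreover have "symp_form n ?v (A *\<^sub>v ?w) = - sg l * ent A (partner l) ?k"
    unfolding symp_form_crd
    by (subst sum_single_index[of _ l])
      (use kl crd_unit_vec[of _ n l] Aw in auto)
  moreover have "symp_form n (A *\<^sub>v ?v) ?w + symp_form n ?v (A *\<^sub>v ?w) = 0"
    using A unfolding sp_def mem_Collect_eq using unit_vec_carrier by blast
  ultimately have "sg k * ent A k l = - sg l * ent A (partner l) ?k"
    by simp
  then have "sg k * (sg k * ent A k l) = - sg k * sg l * ent A (partner l) ?k"
    by simp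
  then show "ent A k l = - sg k * sg l * ent A (partner l) ?k" by (simp only: sg_square)
next
  assume *: "A \<in> carrier_mat (2*n) (2*n) \<and>
    (\<forall>k\<in>idx n. \<forall>l\<in>idx n. ent A k l = - sg k * sg l * ent A (partner l) (partner k))"
  then have A: "A \<in> carrier_mat (2*n) (2*n)" by blast
  have "symp_form n (A *\<^sub>v v) w + symp_form n v (A *\<^sub>v w) = 0"
    if v: "v \<in> carrier_vec (2*n)" and w: "w \<in> carrier_vec (2*n)" for v w
  proof -
    have "symp_form n (A *\<^sub>v v) w =
        (\<Sum>k\<in>idx n. \<Sum>l\<in>idx n. - sg k * ent A k l * crd v l * crd w (partner k))"
      by (simp add: symp_form_crd crd_mult_mat_vec[OF A v] sum_distrib_left sum_distrib_right
          ac_simps)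
    moreover have "symp_form n v (A *\<^sub>v w) =
        (\<Sum>k\<in>idx n. \<Sum>l\<in>idx n. sg k * ent A k l * crd v l * crd w (partner k))"
    proof -
      have "crd (A *\<^sub>v w) (partner l) =
          (\<Sum>k\<in>idx n. ent A (partner l) (partner k) * crd w (partner k))" if "l \<in> idx n" for l
        using that by (simp add: crd_mult_mat_vec[OF A w] sum_partner[where g = "\<lambda>k. _ k * crd w k"])
      moreover have "sg k * ent A k l = - sg l * ent A (partner l) (partner k)"
        if "k \<in> idx n" "l \<in> idx n" for k l
      proof -
        have "sg k * ent A k l = sg k * (- sg k * sg l * ent A (partner l) (partner k))"
          using * that by metis
        then show ?thesis by (simp add: sg_def split: if_splits)
      qed
      ultimately show ?thesis
        unfolding symp_form_crd
        by (subst sum.swap) (simp add: sum_distrib_left ac_simps)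
    qed
    ultimately show ?thesis
      by (simp add: sum_negf)
  qed
  then show "A \<in> sp n" using A by (auto simp: sp_def)
qed (simp add: sp_carrier)

text \<open>The second index is moved with \<open>omega\<close>. The defining relation of
  \<open>sp n\<close> then becomes symmetry of this array, which collects the coefficients of z_k
  z_l in 2 L(A).\<close>

definition quad_coeff :: "real mat \<Rightarrow> nat \<Rightarrow> nat \<Rightarrow> real" where
  "quad_coeff A k l = - sg l * ent A k (partner l)"

lemma quad_coeff_sym:
  assumes "A \<in> sp n" "k \<in> idx n" "l \<in> idx n"
  shows "quad_coeff A k l = quad_coeff A l k"
proof -
  have "ent A k (partner l) = - sg k * sg (partner l) * ent A (partner (partner l)) (partner k)"
    using assms(1) assms(2) partner_in[OF assms(3)] unfolding sp_iff by blast
  then show ?thesis using assms by (auto simp: quad_coeff_def)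
qed

text \<open>The operator \<open>L(A)\<close> is half the image of \<open>\<Sum>\<^sub>k A z\<^sub>k \<otimes> z\<^sup>k\<close>, where \<open>z\<^sup>k\<close> is the
  dual basis with respect to \<open>\<omega>\<close>.\<close>
definition quad_op :: "nat \<Rightarrow> real mat \<Rightarrow> cpoly \<Rightarrow> cpoly" where
  "quad_op n A p = scl (1/2) (\<Sum>k\<in>idx n. \<Sum>l\<in>idx n.
     scl (of_real (quad_coeff A k l)) (zop k (zop l p)))"

lemma quad_op_linear:
  "quad_op n A 0 = 0" "quad_op n A (p + q) = quad_op n A p + quad_op n A q"
  "quad_op n A (scl c p) = scl c (quad_op n A p)"
  "quad_op n A (sum f I) = (\<Sum>i\<in>I. quad_op n A (f i))"
proof -
  show *: "quad_op n A 0 = 0" "quad_op n A (p + q) = quad_op n A p + quad_op n A q" for p q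
    by (simp_all add: quad_op_def zop_linear scl_add sum.distrib scl_sum)
  show "quad_op n A (scl c p) = scl c (quad_op n A p)"
    by (simp add: quad_op_def zop_linear scl_sum ac_simps)
  show "quad_op n A (sum f I) = (\<Sum>i\<in>I. quad_op n A (f i))"
    by (induction I rule: infinite_finite_induct) (simp_all add: *)
qed

lemma vec_op_zop: "vec_op n v p = (\<Sum>k\<in>idx n. scl (of_real (crd v k)) (zop k p))"
  unfolding vec_op_def sum_pairs
  by (intro sum.cong refl) (simp add: zop_even zop_odd[simplified])

text \<open>The derivation rule yields two sums, which agree by the symmetry of
  \<open>quad_coeff\<close>; this absorbs the factor 1/2.\<close>

lemma quad_op_commute_zop:
  assumes A: "A \<in> sp n" and r: "r \<in> idx n"
  shows "quad_op n A (zop r p) - zop r (quad_op n A p) =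
    (\<Sum>k\<in>idx n. scl (of_real (ent A k r)) (zop k p))"
proof -
  have om: "omega l r = (if l = partner r then sg r else 0)" if "l \<in> idx n" for l
    using that r by (auto simp: omega_def)
  let ?c = "\<lambda>k l. complex_of_real (quad_coeff A k l)"
  have "quad_op n A (zop r p) - zop r (quad_op n A p) =
      scl (1/2) (\<Sum>k\<in>idx n. \<Sum>l\<in>idx n. scl (?c k l) (zop k (zop l (zop r p)) - zop r (zop k (zop l p))))"
    by (simp add: quad_op_def zop_linear scl_add sum_subtractf scl_sum mult.commute)
  also have "\<dots> = scl (1/2) (\<Sum>k\<in>idx n. \<Sum>l\<in>idx n.
      scl (?c k l * of_real (omega l r)) (zop k p) + scl (?c k l * of_real (omega k r)) (zop l p))"
    using r by (simp add: zop_commute2 scl_add)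
  also have "\<dots> = scl (1/2) ((\<Sum>k\<in>idx n. \<Sum>l\<in>idx n. scl (?c k l * of_real (omega l r)) (zop k p)) +
      (\<Sum>k\<in>idx n. \<Sum>l\<in>idx n. scl (?c l k * of_real (omega k r)) (zop l p)))"
    using A by (simp add: sum.distrib quad_coeff_sym)
  also have "(\<Sum>k\<in>idx n. \<Sum>l\<in>idx n. scl (?c l k * of_real (omega k r)) (zop l p)) =
      (\<Sum>k\<in>idx n. \<Sum>l\<in>idx n. scl (?c k l * of_real (omega l r)) (zop k p))"
    by (rule sum.swap)
  also have "(\<Sum>k\<in>idx n. \<Sum>l\<in>idx n. scl (?c k l * of_real (omega l r)) (zop k p)) =
      (\<Sum>k\<in>idx n. scl (of_real (ent A k r)) (zop k p))"
  proof (intro sum.cong refl)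
    fix k
    have "(\<Sum>l\<in>idx n. scl (?c k l * of_real (omega l r)) (zop k p)) =
        scl (?c k (partner r) * of_real (omega (partner r) r)) (zop k p)"
      by (rule sum_single_index) (use r in \<open>auto simp: om\<close>)
    also have "?c k (partner r) * of_real (omega (partner r) r) = of_real (ent A k r)"
      using r by (simp add: om quad_coeff_def flip: of_real_mult)
    finally show "(\<Sum>l\<in>idx n. scl (?c k l * of_real (omega l r)) (zop k p)) =
        scl (of_real (ent A k r)) (zop k p)" .
  qed
  finally show ?thesis by (simp flip: scl_2)
qed

lemma quad_op_commute_vec_op:
  assumes A: "A \<in> sp n" and v: "v \<in> carrier_vec (2*n)"
  shows "quad_op n A (vec_op n v p) - vec_op n v (quad_op n A p) = vec_op n (A *\<^sub>v v) p"
proof -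
  have "quad_op n A (vec_op n v p) - vec_op n v (quad_op n A p) =
      (\<Sum>l\<in>idx n. scl (of_real (crd v l)) (quad_op n A (zop l p) - zop l (quad_op n A p)))"
    by (simp add: vec_op_zop quad_op_linear scl_add sum_subtractf)
  also have "\<dots> = (\<Sum>l\<in>idx n. \<Sum>k\<in>idx n. scl (of_real (ent A k l * crd v l)) (zop k p))"
    using A by (simp add: quad_op_commute_zop scl_sum mult.commute)
  also have "\<dots> = vec_op n (A *\<^sub>v v) p"
    unfolding vec_op_zop
    by (subst sum.swap)
      (simp add: crd_mult_mat_vec[OF sp_carrier[OF A] v] scl_sum flip: of_real_mult)
  finally show ?thesis .
qed

text \<open>Only the mixed terms need work: exchanging the summation indices and using symmetry puts
  e_i f_j and f_j e_i under the same coefficient.\<close>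

lemma quad_op_in_quad_ops:
  assumes "A \<in> sp n"
  shows "quad_op n A \<in> quad_ops n"
proof -
  let ?c = "quad_coeff A"
  have idx: "2*i \<in> idx n" "2*i - 1 \<in> idx n" if "i \<in> {1..n}" for i
    using that by (auto simp: idx_def)
  have "quad_op n A p = (\<Sum>i=1..n. \<Sum>j=1..n.
       scl (of_real (?c (2*i) (2*j) / 2)) (e_op i (e_op j p))
     + scl (of_real (?c (2*i-1) (2*j-1) / 2)) (f_op i (f_op j p))
     + scl (of_real (?c (2*i) (2*j-1) / 2)) (e_op i (f_op j p) + f_op j (e_op i p)))" for p
  proof -
    have "quad_op n A p = (\<Sum>i=1..n. \<Sum>j=1..n.
       scl (of_real (?c (2*i) (2*j) / 2)) (e_op i (e_op j p))
     + scl (of_real (?c (2*i-1) (2*j-1) / 2)) (f_op i (f_op j p))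
     + scl (of_real (?c (2*i) (2*j-1) / 2)) (e_op i (f_op j p)))
     + (\<Sum>i=1..n. \<Sum>j=1..n. scl (of_real (?c (2*i-1) (2*j) / 2)) (f_op i (e_op j p)))"
      unfolding quad_op_def sum_pairs scl_sum sum.distrib[symmetric]
      by (intro sum.cong refl) (simp add: zop_even zop_odd[simplified] scl_add add.assoc add.left_commute add.commute)
    also have "(\<Sum>i=1..n. \<Sum>j=1..n. scl (of_real (?c (2*i-1) (2*j) / 2)) (f_op i (e_op j p))) =
        (\<Sum>i=1..n. \<Sum>j=1..n. scl (of_real (?c (2*i) (2*j-1) / 2)) (f_op j (e_op i p)))"
      by (subst sum.swap) (intro sum.cong refl, simp only: quad_coeff_sym[OF assms idx(2) idx(1)])
    finally show ?thesis
      by (simp add: scl_add add.assoc flip: sum.distrib)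
  qed
  then show ?thesis
    unfolding quad_ops_def mem_Collect_eq
    by (intro exI[of _ "\<lambda>i j. ?c (2*i) (2*j) / 2"] exI[of _ "\<lambda>i j. ?c (2*i-1) (2*j-1) / 2"]
        exI[of _ "\<lambda>i j. ?c (2*i) (2*j-1) / 2"] ext)
qed

text \<open>A competing operator has the same commutators with every z_k, hence the same
  \<open>comm_sum\<close>, and on \<open>quad_ops\<close> this is twice the operator itself.\<close>

lemma ssw_eq:
  assumes A: "A \<in> sp n"
  shows "ssw n A = quad_op n A"
  unfolding ssw_def
proof (rule the_equality)
  show "quad_op n A \<in> quad_ops n \<and> (\<forall>v\<in>carrier_vec (2*n). \<forall>p.
      quad_op n A (vec_op n v p) - vec_op n v (quad_op n A p) = vec_op n (A *\<^sub>v v) p)"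
    using quad_op_in_quad_ops[OF A] quad_op_commute_vec_op[OF A] by blast
next
  fix T assume T: "T \<in> quad_ops n \<and> (\<forall>v\<in>carrier_vec (2*n). \<forall>p.
      T (vec_op n v p) - vec_op n v (T p) = vec_op n (A *\<^sub>v v) p)"
  have vec: "vec_op n (unit_vec (2*n) (k - 1)) p = zop k p" if "k \<in> idx n" for k p
    unfolding vec_op_zop
    by (subst sum_single_index[of _ k]) (use that crd_unit_vec[of _ n k] in auto)
  have "T (zop k p) - zop k (T p) = quad_op n A (zop k p) - zop k (quad_op n A p)"
    if k: "k \<in> idx n" for k p
  proof -
    let ?v = "unit_vec (2*n) (k - 1)"
    have "T (vec_op n ?v p) - vec_op n ?v (T p) =
        quad_op n A (vec_op n ?v p) - vec_op n ?v (quad_op n A p)"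
      using T quad_op_commute_vec_op[OF A] by (simp del: One_nat_def)
    then show ?thesis by (simp only: vec[OF k])
  qed
  then have "comm_sum n T p = comm_sum n (quad_op n A) p" for p
    by (simp add: comm_sum_def)
  then have "scl 2 (T p) = scl 2 (quad_op n A p)" for p
    using comm_sum_quad_ops[of T n p] comm_sum_quad_ops[OF quad_op_in_quad_ops[OF A], of p] T
    by simp
  then have "scl (1/2) (scl 2 (T p)) = scl (1/2) (scl 2 (quad_op n A p))" for p
    by simp
  then show "T = quad_op n A" by (auto simp: fun_eq_iff)
qed

text \<open>Commutators with the z_r recover the columns of the matrix, because the operators z_k
  are linearly independent.\<close>

lemma quad_op_inj:
  assumes A: "A \<in> sp n" and B: "B \<in> sp n" and eq: "quad_op n A = quad_op n B"
  shows "A = B"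
proof (rule ent_eqI[OF sp_carrier[OF A] sp_carrier[OF B]])
  fix m r assume m: "m \<in> idx n" and r: "r \<in> idx n"
  let ?d = "\<lambda>k. complex_of_real (ent A k r - ent B k r)"
  have *: "(\<Sum>k\<in>idx n. scl (?d k) (zop k p)) = 0" for p
    using quad_op_commute_zop[OF A r, of p] quad_op_commute_zop[OF B r, of p] eq
    by (simp add: scl_add sum_subtractf)
  have om: "omega k (partner m) = (if k = m then - sg m else 0)" if "k \<in> idx n" for k
    using partner_partner[OF that] partner_partner[OF m] by (auto simp: omega_def)
  \<comment> \<open>A second commutator, with the partner of z_m and applied to the polynomial 1,
    isolates the coefficient of z_m.\<close>
  have "0 = (\<Sum>k\<in>idx n. scl (?d k) (zop k (zop (partner m) 1))) -
      zop (partner m) (\<Sum>k\<in>idx n. scl (?d k) (zop k 1))"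
    using * by (simp add: zop_linear)
  also have "\<dots> = (\<Sum>k\<in>idx n. scl (?d k * of_real (omega k (partner m))) 1)"
    using m by (simp add: zop_linear zop_commute[of _ n "partner m"] scl_add flip: sum_subtractf)
  also have "\<dots> = scl (?d m * of_real (omega m (partner m))) 1"
    by (rule sum_single_index) (use m in \<open>simp_all add: om\<close>)
  finally have "scl (?d m * of_real (- sg m)) (1 :: cpoly) = 0"
    using m by (simp add: om)
  then have "Poly_Mapping.lookup (scl (?d m * of_real (- sg m)) (1 :: cpoly)) 0 = 0"
    by simp
  then show "ent A m r = ent B m r" by simp
qed

lemma sp_of_quad_op: "A \<in> sp n \<Longrightarrow> sp_of n (quad_op n A) = A"
  unfolding sp_of_def by (rule the_equality) (auto simp: ssw_eq dest: quad_op_inj)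

lemma sp_ent: "A \<in> sp n \<Longrightarrow> k \<in> idx n \<Longrightarrow> l \<in> idx n \<Longrightarrow>
    ent A k l = - sg k * sg l * ent A (partner l) (partner k)"
  unfolding sp_iff by blast

section \<open>Closure of the Lie algebra under its operations, and the representation property of
  L\<close>

lemma spI:
  assumes "A \<in> carrier_mat (2*n) (2*n)"
    and "\<And>k l. k \<in> idx n \<Longrightarrow> l \<in> idx n \<Longrightarrow> ent A k l = - sg k * sg l * ent A (partner l) (partner k)"
  shows "A \<in> sp n"
  using assms unfolding sp_iff by blast

lemma sp_add:
  assumes A: "A \<in> sp n" and B: "B \<in> sp n"
  shows "A + B \<in> sp n"
proof (rule spI)
  fix k l assume "k \<in> idx n" "l \<in> idx n"
  then show "ent (A + B) k l = - sg k * sg l * ent (A + B) (partner l) (partner k)"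
    using sp_ent[OF A] sp_ent[OF B]
    by (simp only: ent_linear[OF sp_carrier[OF A] sp_carrier[OF B]] partner_in distrib_left)
qed (use sp_carrier[OF A] sp_carrier[OF B] in simp)

lemma sp_smult:
  assumes A: "A \<in> sp n"
  shows "r \<cdot>\<^sub>m A \<in> sp n"
proof (rule spI)
  fix k l assume kl: "k \<in> idx n" "l \<in> idx n"
  show "ent (r \<cdot>\<^sub>m A) k l = - sg k * sg l * ent (r \<cdot>\<^sub>m A) (partner l) (partner k)"
    using kl sp_ent[OF A kl] by (simp only: ent_smult[OF sp_carrier[OF A]] partner_in) simp
qed (simp add: sp_carrier A)

lemma sp_mult_carrier: "A \<in> sp n \<Longrightarrow> B \<in> sp n \<Longrightarrow> A * B \<in> carrier_mat (2*n) (2*n)"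
  using mult_carrier_mat sp_carrier by blast

lemma sp_commutator:
  assumes A: "A \<in> sp n" and B: "B \<in> sp n"
  shows "A * B - B * A \<in> sp n"
proof (rule spI)
  have c: "A * B \<in> carrier_mat (2*n) (2*n)" "B * A \<in> carrier_mat (2*n) (2*n)"
    using A B sp_mult_carrier by blast+
  then show "A * B - B * A \<in> carrier_mat (2*n) (2*n)" using minus_carrier_mat by blast
  \<comment> \<open>The signs belonging to the summation index cancel, and the order of the factors
    is reversed; the reversal supplies the minus sign for the commutator.\<close>
  have *: "ent (A * B) k l = sg k * sg l * ent (B * A) (partner l) (partner k)"
    if A: "A \<in> sp n" and B: "B \<in> sp n" and k: "k \<in> idx n" and l: "l \<in> idx n" for A B k l
  proof -
    have "ent (A * B) k l = (\<Sum>m\<in>idx n. sg k * sg l *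
        (ent B (partner l) (partner m) * ent A (partner m) (partner k)))"
      unfolding ent_mult[OF sp_carrier[OF A] sp_carrier[OF B] k l]
      by (intro sum.cong refl) (subst sp_ent[OF A k], assumption, subst sp_ent[OF B _ l], assumption, simp)
    also have "\<dots> = sg k * sg l * (\<Sum>m\<in>idx n. ent B (partner l) m * ent A m (partner k))"
      by (simp add: sum_partner[where g = "\<lambda>m. ent B _ m * ent A m _"] flip: sum_distrib_left)
    also have "\<dots> = sg k * sg l * ent (B * A) (partner l) (partner k)"
      using k l by (simp add: ent_mult[OF sp_carrier[OF B] sp_carrier[OF A]])
    finally show ?thesis .
  qed
  fix k l assume kl: "k \<in> idx n" "l \<in> idx n"
  have "ent (A * B - B * A) k l = ent (A * B) k l - ent (B * A) k l"
    using kl by (simp add: ent_linear[OF c])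
  also have "\<dots> = - sg k * sg l * (ent (A * B) (partner l) (partner k) - ent (B * A) (partner l) (partner k))"
    unfolding *[OF A B kl] *[OF B A kl] by (simp add: algebra_simps)
  also have "\<dots> = - sg k * sg l * ent (A * B - B * A) (partner l) (partner k)"
    using kl by (simp add: ent_linear[OF c])
  finally show "ent (A * B - B * A) k l = - sg k * sg l * ent (A * B - B * A) (partner l) (partner k)" .
qed

lemma quad_coeff_linear:
  assumes "A \<in> sp n" "B \<in> sp n" "k \<in> idx n" "l \<in> idx n"
  shows "quad_coeff (A + B) k l = quad_coeff A k l + quad_coeff B k l"
    "quad_coeff (r \<cdot>\<^sub>m A) k l = r * quad_coeff A k l"
  using assms by (simp_all add: quad_coeff_def ent_linear[of _ n] ent_smult[of _ n] sp_carrier distrib_left)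

lemma quad_op_mat_linear:
  assumes "A \<in> sp n" "B \<in> sp n"
  shows "quad_op n (A + B) p = quad_op n A p + quad_op n B p"
    "quad_op n (r \<cdot>\<^sub>m A) p = scl (of_real r) (quad_op n A p)"
  using assms by (simp_all add: quad_op_def quad_coeff_linear scl_add sum.distrib scl_sum ac_simps)

text \<open>Written in the shape that the derivation rule produces when L(A) acts on the two factors
  of each term of L(B).\<close>

lemma quad_coeff_commutator:
  assumes A: "A \<in> sp n" and B: "B \<in> sp n" and k: "k \<in> idx n" and l: "l \<in> idx n"
  shows "quad_coeff (A * B - B * A) k l =
    (\<Sum>m\<in>idx n. ent A k m * quad_coeff B m l) + (\<Sum>m\<in>idx n. quad_coeff B k m * ent A l m)"
proof -
  have c: "A * B \<in> carrier_mat (2*n) (2*n)" "B * A \<in> carrier_mat (2*n) (2*n)"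
    using A B sp_mult_carrier by blast+
  have "(\<Sum>m\<in>idx n. quad_coeff B k m * ent A l m) =
      (\<Sum>m\<in>idx n. quad_coeff B k (partner m) * ent A l (partner m))"
    by (rule sum_partner[symmetric])
  also have "\<dots> = (\<Sum>m\<in>idx n. sg l * (ent B k m * ent A m (partner l)))"
  proof (intro sum.cong refl)
    fix m assume m: "m \<in> idx n"
    have "quad_coeff A l m = quad_coeff A m l" by (rule quad_coeff_sym[OF A l m])
    then have "sg m * ent A l (partner m) = sg l * ent A m (partner l)"
      by (simp add: quad_coeff_def)
    then show "quad_coeff B k (partner m) * ent A l (partner m) = sg l * (ent B k m * ent A m (partner l))"
      using m by (simp add: quad_coeff_def)
  qed
  finally have "(\<Sum>m\<in>idx n. quad_coeff B k m * ent A l m) = sg l * ent (B * A) k (partner l)"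
    using k l by (simp add: ent_mult[OF sp_carrier[OF B] sp_carrier[OF A]] sum_distrib_left)
  moreover have "(\<Sum>m\<in>idx n. ent A k m * quad_coeff B m l) = - sg l * ent (A * B) k (partner l)"
    using k l by (simp add: ent_mult[OF sp_carrier[OF A] sp_carrier[OF B]] sum_distrib_left
        quad_coeff_def sum_negf ac_simps)
  ultimately show ?thesis
    using k l by (simp add: quad_coeff_def ent_linear[OF c] algebra_simps)
qed

lemma quad_op_commutator:
  assumes A: "A \<in> sp n" and B: "B \<in> sp n"
  shows "quad_op n (A * B - B * A) p = quad_op n A (quad_op n B p) - quad_op n B (quad_op n A p)"
proof -
  let ?b = "\<lambda>k l. complex_of_real (quad_coeff B k l)" and ?a = "\<lambda>k l. complex_of_real (ent A k l)"
  have L: "quad_op n A (zop k w) = zop k (quad_op n A w) + (\<Sum>m\<in>idx n. scl (?a m k) (zop m w))"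
    if "k \<in> idx n" for k w
    using quad_op_commute_zop[OF A that, of w] by (simp add: algebra_simps)
  have "quad_op n A (quad_op n B p) - quad_op n B (quad_op n A p) =
      scl (1/2) (\<Sum>k\<in>idx n. \<Sum>l\<in>idx n. scl (?b k l)
        (quad_op n A (zop k (zop l p)) - zop k (zop l (quad_op n A p))))"
    unfolding quad_op_def[of n B]
    by (simp add: quad_op_linear scl_add sum_subtractf)
  also have "\<dots> = scl (1/2) ((\<Sum>k\<in>idx n. \<Sum>l\<in>idx n. \<Sum>m\<in>idx n. scl (?a m k * ?b k l) (zop m (zop l p))) +
      (\<Sum>k\<in>idx n. \<Sum>l\<in>idx n. \<Sum>m\<in>idx n. scl (?b k l * ?a m l) (zop k (zop m p))))"
    by (simp add: L zop_linear scl_add scl_sum sum.distrib ac_simps)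
  also have "(\<Sum>k\<in>idx n. \<Sum>l\<in>idx n. \<Sum>m\<in>idx n. scl (?a m k * ?b k l) (zop m (zop l p))) =
      (\<Sum>m\<in>idx n. \<Sum>l\<in>idx n. \<Sum>k\<in>idx n. scl (?a m k * ?b k l) (zop m (zop l p)))"
    by (subst sum.swap, subst (2) sum.swap, subst sum.swap) simp
  also have "(\<Sum>k\<in>idx n. \<Sum>l\<in>idx n. \<Sum>m\<in>idx n. scl (?b k l * ?a m l) (zop k (zop m p))) =
      (\<Sum>k\<in>idx n. \<Sum>m\<in>idx n. \<Sum>l\<in>idx n. scl (?b k l * ?a m l) (zop k (zop m p)))"
    by (intro sum.cong refl sum.swap)
  also have "scl (1/2) ((\<Sum>m\<in>idx n. \<Sum>l\<in>idx n. \<Sum>k\<in>idx n. scl (?a m k * ?b k l) (zop m (zop l p))) +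
      (\<Sum>k\<in>idx n. \<Sum>m\<in>idx n. \<Sum>l\<in>idx n. scl (?b k l * ?a m l) (zop k (zop m p)))) =
      quad_op n (A * B - B * A) p"
    by (simp add: quad_op_def quad_coeff_commutator[OF A B] scl_add scl_sum sum.distrib)
  finally show ?thesis by simp
qed

section \<open>The action on spinor-valued polynomials\<close>

definition zop2 :: "nat \<Rightarrow> cpoly2 \<Rightarrow> cpoly2" where
  "zop2 k = tens_op id (zop k)"

definition q_act :: "nat \<Rightarrow> real mat \<Rightarrow> cpoly2 \<Rightarrow> cpoly2" where
  "q_act n A = tens_op id (quad_op n A)"

definition x_act :: "nat \<Rightarrow> real mat \<Rightarrow> cpoly2 \<Rightarrow> cpoly2" where
  "x_act n A u = - (\<Sum>k\<in>idx n. \<Sum>l\<in>idx n. tens_scl (of_real (ent A k l)) (x_mul l (x_pd k u)))"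

lemma lookup_zop2: "Poly_Mapping.lookup (zop2 k u) m = zop k (Poly_Mapping.lookup u m)"
  by (simp add: zop2_def lookup_tens_op_id zop_linear)

lemma lookup_q_act: "Poly_Mapping.lookup (q_act n A u) m = quad_op n A (Poly_Mapping.lookup u m)"
  by (simp add: q_act_def lookup_tens_op_id quad_op_linear)

lemma lookup_tens_scl: "Poly_Mapping.lookup (tens_scl c u) m = scl c (Poly_Mapping.lookup u m)"
  by (auto simp: tens_scl_def Poly_Mapping.map.rep_eq when_def)

lemma lookup_x_pd: "Poly_Mapping.lookup (x_pd k u) m =
    scl (of_nat (Suc (Poly_Mapping.lookup m k))) (Poly_Mapping.lookup u (m + unit_exp k))"
  by (simp add: x_pd_def lookup_tens_op_pd)

lemma zop2_linear [simp]:
  "zop2 k 0 = 0" "zop2 k (u + w) = zop2 k u + zop2 k w" "zop2 k (u - w) = zop2 k u - zop2 k w"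
  "zop2 k (- u) = - zop2 k u" "zop2 k (tens_scl c u) = tens_scl c (zop2 k u)"
  "zop2 k (sum f I) = (\<Sum>i\<in>I. zop2 k (f i))"
  by (auto intro!: poly_mapping_eqI
      simp: lookup_zop2 lookup_add lookup_minus lookup_tens_scl lookup_sum zop_linear)

lemma q_act_linear [simp]:
  "q_act n A 0 = 0" "q_act n A (u + w) = q_act n A u + q_act n A w"
  "q_act n A (tens_scl c u) = tens_scl c (q_act n A u)"
  "q_act n A (sum f I) = (\<Sum>i\<in>I. q_act n A (f i))"
  by (auto intro!: poly_mapping_eqI
      simp: lookup_q_act lookup_add lookup_minus lookup_tens_scl lookup_sum quad_op_linear)

lemma zop2_even: "zop2 (2*j) u = tens_scl \<i> (q_mul j u)"
  by (rule poly_mapping_eqI)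
    (simp add: lookup_zop2 lookup_tens_scl q_mul_def lookup_tens_op_id zop_even e_op_def)

lemma zop2_odd: "1 \<le> j \<Longrightarrow> zop2 (2*j - 1) u = tens_scl \<i> (q_pd j u)"
  by (rule poly_mapping_eqI)
    (simp add: lookup_zop2 lookup_tens_scl q_pd_def lookup_tens_op_id zop_odd f_op_def del: One_nat_def)

lemma x_pd_zop2: "x_pd k (zop2 l u) = zop2 l (x_pd k u)"
  by (rule poly_mapping_eqI) (simp add: lookup_zop2 lookup_x_pd zop_linear)

lemma x_pd_q_act: "x_pd k (q_act n A u) = q_act n A (x_pd k u)"
  by (rule poly_mapping_eqI) (simp add: lookup_q_act lookup_x_pd quad_op_linear)

lemma lookup_x_mul: "Poly_Mapping.lookup (x_mul k u) m =
    (if Poly_Mapping.lookup m k = 0 then 0 else Poly_Mapping.lookup u (m - unit_exp k))"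
  by (rule poly_mapping_eqI) (use cf_x_mul[of k u m] in \<open>auto simp: cf_def\<close>)

lemma x_mul_zop2: "x_mul k (zop2 l u) = zop2 l (x_mul k u)"
  by (rule poly_mapping_eqI) (simp add: lookup_zop2 lookup_x_mul zop_linear)

lemma x_mul_q_act: "x_mul k (q_act n A u) = q_act n A (x_mul k u)"
  by (rule poly_mapping_eqI) (simp add: lookup_q_act lookup_x_mul quad_op_linear)

lemma tens_op_poly_act: "tens_op (poly_act n A) id u = x_act n A u"
proof (rule poly_mapping_eqI)
  fix m
  have "poly_act n A p = - (\<Sum>k\<in>idx n. \<Sum>l\<in>idx n. scl (of_real (ent A k l)) (var l * pd k p))" for p
    by (simp add: poly_act_def idx_def ent_def scl_def sum_distrib_right mult.assoc)
  then have "Poly_Mapping.lookup (tens_op (poly_act n A) id u) m =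
      - (\<Sum>k\<in>idx n. \<Sum>l\<in>idx n. scl (of_real (ent A k l))
          (Poly_Mapping.lookup (tens_op (\<lambda>p. var l * pd k p) id u) m))"
    unfolding lookup_tens_op
    by (simp add: lookup_sum scl_sum scl_add sum_negf sum.swap[of _ "idx n" "Poly_Mapping.keys u"])
  also have "\<dots> = Poly_Mapping.lookup (x_act n A u) m"
    unfolding lookup_tens_op_var_pd
    by (simp add: x_act_def lookup_sum lookup_tens_scl lookup_x_mul x_pd_def)
  finally show "Poly_Mapping.lookup (tens_op (poly_act n A) id u) m = Poly_Mapping.lookup (x_act n A u) m" .
qed

lemma tens_act_eq: "A \<in> sp n \<Longrightarrow> tens_act n A u = x_act n A u + q_act n A u"
  by (simp add: tens_act_def tens_op_poly_act ssw_eq q_act_def)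

lemma x_act_linear [simp]:
  "x_act n A 0 = 0" "x_act n A (u + w) = x_act n A u + x_act n A w"
  "x_act n A (tens_scl c u) = tens_scl c (x_act n A u)"
  "x_act n A (sum f I) = (\<Sum>i\<in>I. x_act n A (f i))"
proof -
  show *: "x_act n A 0 = 0" "x_act n A (u + w) = x_act n A u + x_act n A w" for u w
    by (simp_all add: x_act_def sum.distrib)
  show "x_act n A (tens_scl c u) = tens_scl c (x_act n A u)"
    by (simp add: x_act_def mult.commute)
  show "x_act n A (sum f I) = (\<Sum>i\<in>I. x_act n A (f i))"
    by (induction I rule: infinite_finite_induct) (simp_all add: *)
qed

lemma tens_scl_add_left: "tens_scl (c + d) u = tens_scl c u + tens_scl d u"
  and tens_scl_diff_left: "tens_scl (c - d) u = tens_scl c u - tens_scl d u"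
  and tens_scl_minus_left: "tens_scl (- c) u = - tens_scl c u"
  and tens_scl_sum_left: "tens_scl (sum g I) u = (\<Sum>i\<in>I. tens_scl (g i) u)"
  by (auto intro!: cf_eqI simp: algebra_simps sum_distrib_right)

lemma x_act_x_mul:
  assumes "r \<in> idx n"
  shows "x_act n A (x_mul r u) = x_mul r (x_act n A u) -
    (\<Sum>l\<in>idx n. tens_scl (of_real (ent A r l)) (x_mul l u))"
proof -
  have "x_act n A (x_mul r u) - x_mul r (x_act n A u) =
      - (\<Sum>k\<in>idx n. \<Sum>l\<in>idx n. tens_scl (of_real (ent A k l)) (x_mul l (if k = r then u else 0)))"
    by (simp add: x_act_def x_pd_x_mul ops_commute(1)[of r] sum_negf flip: sum_subtractf)
  also have "\<dots> = - (\<Sum>l\<in>idx n. tens_scl (of_real (ent A r l)) (x_mul l u))"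
    by (subst sum_single_index[of _ r]) (use assms in auto)
  finally show ?thesis by (simp add: algebra_simps)
qed

lemma x_act_x_pd:
  assumes "r \<in> idx n"
  shows "x_act n A (x_pd r u) = x_pd r (x_act n A u) +
    (\<Sum>k\<in>idx n. tens_scl (of_real (ent A k r)) (x_pd k u))"
proof -
  have "x_act n A (x_pd r u) - x_pd r (x_act n A u) =
      (\<Sum>k\<in>idx n. \<Sum>l\<in>idx n. tens_scl (of_real (ent A k l)) (if r = l then x_pd k u else 0))"
    by (simp add: x_act_def x_pd_x_mul ops_commute(2)[of r] sum.distrib)
  also have "\<dots> = (\<Sum>k\<in>idx n. tens_scl (of_real (ent A k r)) (x_pd k u))"
    by (intro sum.cong refl, subst sum_single_index[of _ r]) (use assms in auto)
  finally show ?thesis by (simp add: algebra_simps)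
qed

lemma x_act_commutator:
  assumes A: "A \<in> sp n" and B: "B \<in> sp n"
  shows "x_act n (A * B - B * A) u = x_act n A (x_act n B u) - x_act n B (x_act n A u)"
proof -
  let ?b = "\<lambda>k l. complex_of_real (ent B k l)" and ?a = "\<lambda>k l. complex_of_real (ent A k l)"
  have c: "A * B \<in> carrier_mat (2*n) (2*n)" "B * A \<in> carrier_mat (2*n) (2*n)"
    using A B sp_mult_carrier by blast+
  have m: "x_act n A (- w) = - x_act n A w" for w
    using x_act_linear(3)[of n A "- 1" w] by simp
  have "x_act n A (x_act n B u) - x_act n B (x_act n A u) =
      (\<Sum>k\<in>idx n. \<Sum>l\<in>idx n. \<Sum>j\<in>idx n. tens_scl (?b k l * ?a l j) (x_mul j (x_pd k u))) -
      (\<Sum>k\<in>idx n. \<Sum>l\<in>idx n. \<Sum>j\<in>idx n. tens_scl (?a j k * ?b k l) (x_mul l (x_pd j u)))"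
    unfolding x_act_def[of n B]
    by (simp add: m x_act_x_mul x_act_x_pd sum_subtractf sum.distrib mult.commute)
  also have "(\<Sum>k\<in>idx n. \<Sum>l\<in>idx n. \<Sum>j\<in>idx n. tens_scl (?b k l * ?a l j) (x_mul j (x_pd k u))) =
      (\<Sum>k\<in>idx n. \<Sum>j\<in>idx n. \<Sum>l\<in>idx n. tens_scl (?b k l * ?a l j) (x_mul j (x_pd k u)))"
    by (intro sum.cong refl sum.swap)
  also have "(\<Sum>k\<in>idx n. \<Sum>l\<in>idx n. \<Sum>j\<in>idx n. tens_scl (?a j k * ?b k l) (x_mul l (x_pd j u))) =
      (\<Sum>j\<in>idx n. \<Sum>l\<in>idx n. \<Sum>k\<in>idx n. tens_scl (?a j k * ?b k l) (x_mul l (x_pd j u)))"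
    by (subst sum.swap, subst (2) sum.swap, subst sum.swap) simp
  also have "(\<Sum>k\<in>idx n. \<Sum>j\<in>idx n. \<Sum>l\<in>idx n. tens_scl (?b k l * ?a l j) (x_mul j (x_pd k u))) -
      (\<Sum>j\<in>idx n. \<Sum>l\<in>idx n. \<Sum>k\<in>idx n. tens_scl (?a j k * ?b k l) (x_mul l (x_pd j u))) =
      x_act n (A * B - B * A) u"
    by (simp add: x_act_def ent_linear[OF c] ent_mult[of _ n] sp_carrier A B
        tens_scl_diff_left tens_scl_sum_left sum_subtractf)
  finally show ?thesis by simp
qed

lemma x_act_zop2: "x_act n A (zop2 k u) = zop2 k (x_act n A u)"
  by (simp add: x_act_def x_pd_zop2 x_mul_zop2)

lemma x_act_q_act: "x_act n A (q_act n B u) = q_act n B (x_act n A u)"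
proof -
  have "q_act n B (- w) = - q_act n B w" for w
    using q_act_linear(3)[of n B "- 1" w] by simp
  then show ?thesis by (simp add: x_act_def x_pd_q_act x_mul_q_act)
qed

lemma q_act_zop2:
  assumes "A \<in> sp n" "r \<in> idx n"
  shows "q_act n A (zop2 r u) = zop2 r (q_act n A u) + (\<Sum>k\<in>idx n. tens_scl (of_real (ent A k r)) (zop2 k u))"
proof (rule poly_mapping_eqI)
  fix m show "Poly_Mapping.lookup (q_act n A (zop2 r u)) m = Poly_Mapping.lookup
      (zop2 r (q_act n A u) + (\<Sum>k\<in>idx n. tens_scl (of_real (ent A k r)) (zop2 k u))) m"
    using quad_op_commute_zop[OF assms, of "Poly_Mapping.lookup u m"]
    by (simp add: lookup_q_act lookup_zop2 lookup_add lookup_sum lookup_tens_scl algebra_simps)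
qed

lemma tens_act_linear:
  assumes "A \<in> sp n" "B \<in> sp n"
  shows "tens_act n A (u + w) = tens_act n A u + tens_act n A w"
    "tens_act n A (tens_scl c u) = tens_scl c (tens_act n A u)"
    "tens_act n (A + B) u = tens_act n A u + tens_act n B u"
    "tens_act n (r \<cdot>\<^sub>m A) u = tens_scl (of_real r) (tens_act n A u)"
    "tens_act n (A * B - B * A) u = tens_act n A (tens_act n B u) - tens_act n B (tens_act n A u)"
proof -
  have q: "q_act n (A + B) u = q_act n A u + q_act n B u"
    "q_act n (r \<cdot>\<^sub>m A) u = tens_scl (of_real r) (q_act n A u)"
    "q_act n (A * B - B * A) u = q_act n A (q_act n B u) - q_act n B (q_act n A u)"
    using assms by (auto intro!: poly_mapping_eqI simp: lookup_q_act lookup_add lookup_minus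
        lookup_tens_scl quad_op_mat_linear quad_op_commutator)
  have x: "x_act n (A + B) u = x_act n A u + x_act n B u"
    "x_act n (r \<cdot>\<^sub>m A) u = tens_scl (of_real r) (x_act n A u)"
    using assms
    by (simp_all add: x_act_def ent_linear[of _ n] ent_smult[of _ n] sp_carrier tens_scl_add_left sum.distrib)
  note sp = assms sp_add[OF assms] sp_smult[OF assms(1)] sp_commutator[OF assms]
  show "tens_act n A (u + w) = tens_act n A u + tens_act n A w"
    "tens_act n A (tens_scl c u) = tens_scl c (tens_act n A u)"
    "tens_act n (A + B) u = tens_act n A u + tens_act n B u"
    "tens_act n (r \<cdot>\<^sub>m A) u = tens_scl (of_real r) (tens_act n A u)"
    "tens_act n (A * B - B * A) u = tens_act n A (tens_act n B u) - tens_act n B (tens_act n A u)"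
    using assms by (simp_all add: tens_act_eq sp q x x_act_commutator x_act_q_act)
qed

lemma symp_dirac_eq:
  "symp_dirac n u = (\<Sum>k\<in>idx n. tens_scl (of_real (sg k)) (x_pd k (zop2 (partner k) u)))"
proof -
  have *: "tens_op (pd k) (zop l) u = x_pd k (zop2 l u)" for k l
    by (rule poly_mapping_eqI) (simp add: lookup_tens_op_pd lookup_x_pd lookup_zop2 zop_linear)
  show ?thesis
    unfolding symp_dirac_def sum_pairs
    by (intro sum.cong refl) (simp add: * flip: zop_even zop_odd[simplified])
qed

lemma symp_dirac_linear [simp]:
  "symp_dirac n 0 = 0" "symp_dirac n (u + w) = symp_dirac n u + symp_dirac n w"
  "symp_dirac n (tens_scl c u) = tens_scl c (symp_dirac n u)"
  by (simp_all add: symp_dirac_eq sum.distrib mult.commute)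

text \<open>Partial derivatives and the operators z_k transform under A in the same way, and D
  contracts them with \<open>omega\<close>. The two correction sums carry the coefficients
  \<open>quad_coeff A\<close> with opposite signs and exchanged indices, so symmetry cancels
  them.\<close>

lemma symp_dirac_tens_act:
  assumes A: "A \<in> sp n"
  shows "symp_dirac n (tens_act n A u) = tens_act n A (symp_dirac n u)"
proof -
  let ?a = "\<lambda>k l. complex_of_real (ent A k l)" and ?s = "\<lambda>k. complex_of_real (sg k)"
  have "tens_act n A (symp_dirac n u) - symp_dirac n (tens_act n A u) =
      (\<Sum>k\<in>idx n. \<Sum>i\<in>idx n. tens_scl (?s k * ?a i k) (x_pd i (zop2 (partner k) u))) +
      (\<Sum>k\<in>idx n. \<Sum>i\<in>idx n. tens_scl (?s k * ?a i (partner k)) (x_pd k (zop2 i u)))"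
    by (simp add: tens_act_eq[OF A] symp_dirac_eq x_act_x_pd x_act_zop2 q_act_zop2[OF A]
        x_pd_zop2 x_pd_q_act[symmetric] sum.distrib algebra_simps)
  also have "(\<Sum>k\<in>idx n. \<Sum>i\<in>idx n. tens_scl (?s k * ?a i k) (x_pd i (zop2 (partner k) u))) =
      (\<Sum>k\<in>idx n. \<Sum>i\<in>idx n. tens_scl (?s (partner k) * ?a i (partner k)) (x_pd i (zop2 k u)))"
    by (subst sum_partner[symmetric]) simp
  also have "\<dots> = (\<Sum>i\<in>idx n. \<Sum>k\<in>idx n. tens_scl (of_real (quad_coeff A i k)) (x_pd i (zop2 k u)))"
    by (subst sum.swap) (simp add: quad_coeff_def)
  also have "(\<Sum>k\<in>idx n. \<Sum>i\<in>idx n. tens_scl (?s k * ?a i (partner k)) (x_pd k (zop2 i u))) =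
      (\<Sum>k\<in>idx n. \<Sum>i\<in>idx n. tens_scl (- of_real (quad_coeff A i k)) (x_pd k (zop2 i u)))"
    by (simp add: quad_coeff_def)
  also have "\<dots> = - (\<Sum>i\<in>idx n. \<Sum>k\<in>idx n. tens_scl (of_real (quad_coeff A i k)) (x_pd i (zop2 k u)))"
    by (simp add: tens_scl_minus_left sum_negf quad_coeff_sym[OF A])
  finally show ?thesis by simp
qed

section \<open>Root vectors\<close>

text \<open>The map \<open>u \<mapsto> \<omega>(z\<^sub>a, u) z\<^sub>b + \<omega>(z\<^sub>b, u) z\<^sub>a\<close>. These matrices realise the isomorphism of
  the symmetric square of \<open>V\<close> with the symplectic Lie algebra; those with \<open>partner a \<noteq> b\<close> are
  root vectors.\<close>
definition sym_mat :: "nat \<Rightarrow> nat \<Rightarrow> nat \<Rightarrow> real mat" where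
  "sym_mat n a b = mat_of n (\<lambda>k l. (if k = b then omega a l else 0) + (if k = a then omega b l else 0))"

lemma sym_mat_commute: "sym_mat n a b = sym_mat n b a"
  unfolding sym_mat_def by (simp add: add.commute)

lemma sym_mat_carrier [simp]: "sym_mat n a b \<in> carrier_mat (2*n) (2*n)"
  by (simp add: sym_mat_def)

lemma ent_sym_mat: "k \<in> idx n \<Longrightarrow> l \<in> idx n \<Longrightarrow>
    ent (sym_mat n a b) k l = (if k = b then omega a l else 0) + (if k = a then omega b l else 0)"
  by (simp add: sym_mat_def)

text \<open>Boolean variables in place of equations between indices keep the simplifier from looping.\<close>
lemma nested_if:
  "(if P then if Q then 1 else 0 else 0) + (if R then if S then 1 else 0 else 0) =
    (if P \<and> Q then 1 else 0) + (if R \<and> S then 1 else (0 :: real))"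
  by simp

lemma distrib_if:
  "c * ((if P then if Q then s else 0 else 0) + (if R then if S then s else 0 else 0)) =
    (if Q \<and> P then c * s else 0) + (if R \<and> S then c * s else (0 :: real))"
  by (simp add: distrib_left)

lemma scl_if:
  "scl (of_real ((if P then 1 else 0) + (if Q then 1 else 0))) p = (if P then p else 0) + (if Q then p else 0)"
  by (simp add: scl_2)

lemma tens_scl_if:
  "tens_scl (of_real ((if P then if Q then c else 0 else 0) + (if R then if S then d else 0 else 0))) u =
    (if P \<and> Q then tens_scl (of_real c) u else 0) + (if R \<and> S then tens_scl (of_real d) u else 0)"
  by (simp add: tens_scl_add_left)

lemma quad_coeff_sym_mat:
  assumes "a \<in> idx n" "b \<in> idx n" "k \<in> idx n" "l \<in> idx n"
  shows "quad_coeff (sym_mat n a b) k l =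
    (if k = b \<and> l = a then 1 else 0) + (if k = a \<and> l = b then 1 else 0)"
proof -
  have "omega c (partner l) = (if l = c then - sg l else 0)" if "c \<in> idx n" for c
  proof -
    have "partner l = partner c \<longleftrightarrow> l = c"
      using partner_partner[OF that] partner_partner[OF assms(4)] by metis
    then show ?thesis by (simp add: omega_def)
  qed
  then have 1: "- sg l * omega c (partner l) = (if l = c then 1 else 0)" if "c \<in> idx n" for c
    using that by simp
  have "quad_coeff (sym_mat n a b) k l =
      (if k = b then - sg l * omega a (partner l) else 0) +
      (if k = a then - sg l * omega b (partner l) else 0)"
    unfolding quad_coeff_def ent_sym_mat[OF assms(3) partner_in[OF assms(4)]]
    by (simp add: distrib_left)
  also have "\<dots> = (if k = b \<and> l = a then 1 else 0) + (if k = a \<and> l = b then 1 else 0)"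
    unfolding 1[OF assms(1)] 1[OF assms(2)] by (rule nested_if)
  finally show ?thesis .
qed

lemma sym_mat_sp [simp]:
  assumes "a \<in> idx n" "b \<in> idx n"
  shows "sym_mat n a b \<in> sp n"
proof (rule spI)
  fix k l assume kl: "k \<in> idx n" "l \<in> idx n"
  have "quad_coeff (sym_mat n a b) k (partner l) = quad_coeff (sym_mat n a b) (partner l) k"
    unfolding quad_coeff_sym_mat[OF assms kl(1) partner_in[OF kl(2)]]
      quad_coeff_sym_mat[OF assms partner_in[OF kl(2)] kl(1)] by (simp only: conj_commute add.commute)
  then have "sg l * ent (sym_mat n a b) k l = - sg k * ent (sym_mat n a b) (partner l) (partner k)"
    using kl by (simp add: quad_coeff_def)
  then have "sg l * (sg l * ent (sym_mat n a b) k l) =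
      sg l * (- sg k * ent (sym_mat n a b) (partner l) (partner k))" by simp
  then show "ent (sym_mat n a b) k l = - sg k * sg l * ent (sym_mat n a b) (partner l) (partner k)"
    by (simp add: ac_simps)
qed simp

lemma sum_delta2:
  assumes "a \<in> idx n" "b \<in> idx n"
  shows "(\<Sum>k\<in>idx n. \<Sum>l\<in>idx n. if k = a \<and> l = b then g k l else 0) = (g a b :: 'a::comm_monoid_add)"
proof -
  have "(\<Sum>k\<in>idx n. \<Sum>l\<in>idx n. if k = a \<and> l = b then g k l else 0) =
      (\<Sum>l\<in>idx n. if l = b then g a l else 0)"
    using assms by (subst sum_single_index[of _ a]) auto
  then show ?thesis using assms by simp
qed

lemma scl_half: "scl (1/2) (p + p) = p"
  by (simp flip: scl_2)

lemma quad_op_sym_mat: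
  assumes "a \<in> idx n" "b \<in> idx n"
  shows "quad_op n (sym_mat n a b) p = scl (1/2) (zop a (zop b p) + zop b (zop a p))"
proof -
  have "quad_op n (sym_mat n a b) p = scl (1/2) ((\<Sum>k\<in>idx n. \<Sum>l\<in>idx n.
      if k = b \<and> l = a then zop k (zop l p) else 0) +
      (\<Sum>k\<in>idx n. \<Sum>l\<in>idx n. if k = a \<and> l = b then zop k (zop l p) else 0))"
    unfolding quad_op_def sum.distrib[symmetric] using assms
    by (intro arg_cong[where f = "scl _"] sum.cong refl) (simp only: quad_coeff_sym_mat scl_if)
  then show ?thesis using assms by (simp add: sum_delta2 add.commute)
qed

lemma x_act_sym_mat:
  assumes a: "a \<in> idx n" and b: "b \<in> idx n"
  shows "x_act n (sym_mat n a b) u = tens_scl (of_real (sg a)) (x_mul (partner a) (x_pd b u)) +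
    tens_scl (of_real (sg b)) (x_mul (partner b) (x_pd a u))"
proof -
  have "x_act n (sym_mat n a b) u = - ((\<Sum>k\<in>idx n. \<Sum>l\<in>idx n.
      if k = b \<and> l = partner a then tens_scl (of_real (- sg a)) (x_mul l (x_pd k u)) else 0) +
      (\<Sum>k\<in>idx n. \<Sum>l\<in>idx n.
      if k = a \<and> l = partner b then tens_scl (of_real (- sg b)) (x_mul l (x_pd k u)) else 0))"
    unfolding x_act_def sum.distrib[symmetric]
    by (intro arg_cong[where f = uminus] sum.cong refl)
      (simp only: ent_sym_mat omega_def tens_scl_if)
  then show ?thesis
    using a b by (simp add: sum_delta2 partner_in tens_scl_minus_left)
qed

lemma tens_act_sym_mat:
  assumes "a \<in> idx n" "b \<in> idx n"
  shows "tens_act n (sym_mat n a b) u = tens_scl (of_real (sg a)) (x_mul (partner a) (x_pd b u)) +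
    tens_scl (of_real (sg b)) (x_mul (partner b) (x_pd a u)) +
    tens_scl (1/2) (zop2 a (zop2 b u) + zop2 b (zop2 a u))"
proof -
  have "q_act n (sym_mat n a b) u = tens_scl (1/2) (zop2 a (zop2 b u) + zop2 b (zop2 a u))"
    by (rule poly_mapping_eqI)
      (simp add: lookup_q_act quad_op_sym_mat[OF assms] lookup_tens_scl lookup_add lookup_zop2 scl_add(1))
  then show ?thesis
    using assms by (simp add: tens_act_eq x_act_sym_mat)
qed

lemma idx_intros [simp]:
  "i \<in> {1..n} \<Longrightarrow> 2*i \<in> idx n" "i \<in> {1..n} \<Longrightarrow> 2*i - 1 \<in> idx n"
  "Suc 0 \<le> i \<Longrightarrow> i \<le> n \<Longrightarrow> 2*i \<in> idx n" "Suc 0 \<le> i \<Longrightarrow> i \<le> n \<Longrightarrow> 2*i - Suc 0 \<in> idx n"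
  by (auto simp: idx_def)

lemma cartan_eq:
  assumes i: "i \<in> {1..n}"
  shows "cartan n i = sym_mat n (2*i) (2*i - 1)"
proof -
  have "(\<lambda>p. scl (1/2) (e_op i (f_op i p) + f_op i (e_op i p))) =
      quad_op n (sym_mat n (2*i) (2*i - 1))"
    using i zop_odd[of i]
    by (simp add: fun_eq_iff quad_op_sym_mat[OF idx_intros(1)[OF i] idx_intros(2)[OF i]] zop_even
        del: One_nat_def)
  then show ?thesis
    using i unfolding cartan_def by (simp only: sp_of_quad_op sym_mat_sp idx_intros)
qed

text \<open>The factor -1 is the square of the imaginary unit contained in \<open>e_op\<close> and
  \<open>f_op\<close>.\<close>

lemma simple_root_vec_eq:
  assumes i: "i \<in> {1..n}"
  shows "simple_root_vec n i =
    (- 1) \<cdot>\<^sub>m (if i < n then sym_mat n (2*(i+1)) (2*i - 1) else sym_mat n (2*n - 1) (2*n - 1))"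
proof -
  have m: "quad_op n ((- 1) \<cdot>\<^sub>m A) p = - quad_op n A p" if "A \<in> sp n" for A p
    using quad_op_mat_linear(2)[OF that that, of "- 1" p] by (simp add: scl_add(5))
  have pdi: "scl \<i> (scl \<i> p) = - p" for p
    by (simp add: scl_add(5))
  show ?thesis
  proof (cases "i < n")
    case True
    have idx: "2*(i+1) \<in> idx n" "2*i - 1 \<in> idx n"
      using i True idx_intros(1)[of "i+1" n] idx_intros(2)[of i n] by auto
    have "quad_op n (sym_mat n (2*(i+1)) (2*i - 1)) p = - (var (i+1) * pd i p)" for p
    proof -
      have z: "zop (2*(i+1)) = e_op (i+1)" "zop (2*i - 1) = f_op i"
        using i by (simp_all only: zop_even zop_odd atLeastAtMost_iff)
      have "e_op (i+1) (f_op i p) = - (var (i+1) * pd i p)"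
        "f_op i (e_op (i+1) p) = - (var (i+1) * pd i p)"
        by (simp_all add: e_op_def f_op_def var_mult_scl pd_linear pd_var_mult scl_add(5))
      then show ?thesis
        unfolding quad_op_sym_mat[OF idx] z by (simp only: scl_half)
    qed
    then have "(\<lambda>p. var (i+1) * pd i p) = quad_op n ((- 1) \<cdot>\<^sub>m sym_mat n (2*(i+1)) (2*i - 1))"
      using m idx by (simp add: fun_eq_iff del: add_Suc_right)
    then show ?thesis
      using True idx unfolding simple_root_vec_def
      by (simp only: if_True sp_of_quad_op sym_mat_sp sp_smult)
  next
    case False
    have n: "n \<in> {1..n}" "i = n" using i False by auto
    have "quad_op n (sym_mat n (2*n - 1) (2*n - 1)) p = - pd n (pd n p)" for p
    proof -
      have z: "zop (2*n - 1) = f_op n"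
        using n by (simp_all only: zop_odd atLeastAtMost_iff)
      have "f_op n (f_op n p) = - pd n (pd n p)"
        by (simp add: f_op_def pd_linear scl_add(5))
      then show ?thesis
        unfolding quad_op_sym_mat[OF idx_intros(2)[OF n(1)] idx_intros(2)[OF n(1)]] z
        by (simp only: scl_half)
    qed
    then have "(\<lambda>p. pd n (pd n p)) = quad_op n ((- 1) \<cdot>\<^sub>m sym_mat n (2*n - 1) (2*n - 1))"
      using m idx_intros(2)[OF n(1)] by (simp add: fun_eq_iff)
    then show ?thesis
      using False n idx_intros(2)[OF n(1)] unfolding simple_root_vec_def
      by (simp only: if_False sp_of_quad_op sym_mat_sp sp_smult)
  qed
qed

text \<open>The rule for the commutator of z_a z_b with z_c z_d in the Weyl algebra, read off on
  matrices. It shows how root vectors generate one another.\<close>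

lemma sym_mat_commutator:
  assumes "a \<in> idx n" "b \<in> idx n" "c \<in> idx n" "d \<in> idx n" "k \<in> idx n" "l \<in> idx n"
  shows "ent (sym_mat n a b * sym_mat n c d - sym_mat n c d * sym_mat n a b) k l =
    omega a c * ent (sym_mat n b d) k l + omega b c * ent (sym_mat n a d) k l +
    omega a d * ent (sym_mat n b c) k l + omega b d * ent (sym_mat n a c) k l"
proof -
  have om: "omega x y = - omega y x" if "x \<in> idx n" "y \<in> idx n" for x y
  proof -
    have "x = partner y \<longleftrightarrow> y = partner x"
      using partner_partner[OF that(1)] partner_partner[OF that(2)] by metis
    then show ?thesis using sg_partner[OF that(1)] by (simp add: omega_def)
  qed
  define \<delta> :: "nat \<Rightarrow> real" where "\<delta> x = (if k = x then 1 else 0)" for x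
  have e: "ent (sym_mat n x y) k l = \<delta> y * omega x l + \<delta> x * omega y l" for x y
    using assms(5,6) by (simp add: ent_sym_mat \<delta>_def)
  have m: "ent (sym_mat n a b * sym_mat n c d) k l =
      \<delta> b * (omega a c * omega d l + omega a d * omega c l) +
      \<delta> a * (omega b c * omega d l + omega b d * omega c l)"
    if abcd: "a \<in> idx n" "b \<in> idx n" "c \<in> idx n" "d \<in> idx n" for a b c d
  proof -
    have "ent (sym_mat n a b * sym_mat n c d) k l =
      (\<Sum>m\<in>idx n. if m = d then (\<delta> b * omega a m + \<delta> a * omega b m) * omega c l else 0) +
      (\<Sum>m\<in>idx n. if m = c then (\<delta> b * omega a m + \<delta> a * omega b m) * omega d l else 0)"
      unfolding sum.distrib[symmetric] ent_mult[OF sym_mat_carrier sym_mat_carrier assms(5,6)]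
      using assms(5,6)
      by (intro sum.cong refl) (simp add: ent_sym_mat \<delta>_def distrib_left)
    then show ?thesis
      using abcd by (simp add: algebra_simps)
  qed
  have "ent (sym_mat n a b * sym_mat n c d - sym_mat n c d * sym_mat n a b) k l =
      ent (sym_mat n a b * sym_mat n c d) k l - ent (sym_mat n c d * sym_mat n a b) k l"
    by (rule ent_linear[of _ n]) (use assms sp_mult_carrier sym_mat_sp in blast)+
  then show ?thesis
    unfolding m[OF assms(1-4)] m[OF assms(3,4,1,2)] e
      om[OF assms(3,1)] om[OF assms(3,2)] om[OF assms(4,1)] om[OF assms(4,2)]
    by (simp add: algebra_simps)
qed

text \<open>Every \<open>A\<close> in the Lie algebra equals \<open>\<Sum> quad_coeff A a b / 2 * sym_mat a b\<close>. A closure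
  principle is stated instead, since matrices of variable size have no sums over sets.\<close>
lemma sp_span:
  assumes A: "A \<in> sp n"
    and add: "\<And>B C. B \<in> S \<Longrightarrow> C \<in> S \<Longrightarrow> B + C \<in> S" and smult: "\<And>r B. B \<in> S \<Longrightarrow> r \<cdot>\<^sub>m B \<in> S"
    and sub: "S \<subseteq> carrier_mat (2*n) (2*n)" and zero: "0\<^sub>m (2*n) (2*n) \<in> S"
    and gen: "\<And>a b. a \<in> idx n \<Longrightarrow> b \<in> idx n \<Longrightarrow> quad_coeff A a b \<noteq> 0 \<Longrightarrow> sym_mat n a b \<in> S"
  shows "A \<in> S"
proof -
  \<comment> \<open>Partial sums over sets of index pairs, formed entrywise, so that one pair at a
    time can be added inside \<open>S\<close>.\<close>
  let ?T = "\<lambda>X. mat_of n (\<lambda>k l. \<Sum>(a, b)\<in>X. quad_coeff A a b / 2 * ent (sym_mat n a b) k l)"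
  have "?T X \<in> S" if "finite X" "X \<subseteq> idx n \<times> idx n" for X
    using that
  proof (induction X rule: finite_induct)
    case empty
    have "?T {} = 0\<^sub>m (2*n) (2*n)" by (rule eq_matI) (auto simp: mat_of_def)
    then show ?case by (simp only: zero)
  next
    case (insert x X)
    obtain a b where x: "x = (a, b)" by (cases x)
    have ab: "a \<in> idx n" "b \<in> idx n" using insert.prems x by auto
    have T: "?T X \<in> S" using insert by auto
    show ?case
    \<comment> \<open>Pairs with coefficient zero are skipped, since \<open>gen\<close> supplies
      generators for nonzero coefficients only. This lets the principle be applied to diagonal
      matrices with Cartan generators alone.\<close>
    proof (cases "quad_coeff A a b = 0")
      case True
      then show ?thesis using T insert.hyps x by simp
    next
      case False
      have "?T (insert x X) = ((quad_coeff A a b / 2) \<cdot>\<^sub>m sym_mat n a b) + ?T X"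
      proof (rule ent_eqI[of _ n])
        fix k l assume kl: "k \<in> idx n" "l \<in> idx n"
        show "ent (?T (insert x X)) k l = ent (((quad_coeff A a b / 2) \<cdot>\<^sub>m sym_mat n a b) + ?T X) k l"
          unfolding ent_linear(1)[OF smult_carrier_mat[OF sym_mat_carrier] mat_of_carrier kl]
            ent_smult[OF sym_mat_carrier kl] ent_mat_of[OF kl]
          using insert.hyps by (simp add: x)
      qed simp_all
      then show ?thesis by (simp only: add[OF smult[OF gen[OF ab False]] T])
    qed
  qed
  then have "?T (idx n \<times> idx n) \<in> S" by simp
  moreover have "?T (idx n \<times> idx n) = A"
  proof (rule ent_eqI[OF _ sp_carrier[OF A]])
    fix k l assume kl: "k \<in> idx n" "l \<in> idx n"
    have om: "omega a l = (if a = partner l then sg l else 0)" if "a \<in> idx n" for a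
    proof -
      have "l = partner a \<longleftrightarrow> a = partner l"
        using partner_partner[OF that] partner_partner[OF kl(2)] by metis
      then show ?thesis using sg_partner[OF kl(2)] by (simp add: omega_def)
    qed
    have "ent (?T (idx n \<times> idx n)) k l =
        (\<Sum>a\<in>idx n. \<Sum>b\<in>idx n. (if a = partner l \<and> b = k then quad_coeff A a b / 2 * sg l else 0)) +
        (\<Sum>a\<in>idx n. \<Sum>b\<in>idx n. (if a = k \<and> b = partner l then quad_coeff A a b / 2 * sg l else 0))"
      unfolding sum.cartesian_product sum.distrib[symmetric] ent_mat_of[OF kl]
    proof (intro sum.cong refl, clarify)
      fix a b assume "a \<in> idx n" "b \<in> idx n"
      then show "quad_coeff A a b / 2 * ent (sym_mat n a b) k l =
          (if a = partner l \<and> b = k then quad_coeff A a b / 2 * sg l else 0) +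
          (if a = k \<and> b = partner l then quad_coeff A a b / 2 * sg l else 0)"
        by (simp only: ent_sym_mat[OF kl] om distrib_if eq_commute[of k])
    qed
    also have "\<dots> = quad_coeff A k (partner l) * sg l"
      using kl by (simp add: sum_delta2 quad_coeff_sym[OF A, of "partner l" k])
    also have "\<dots> = ent A k l"
      using kl by (simp add: quad_coeff_def)
    finally show "ent (?T (idx n \<times> idx n)) k l = ent A k l" .
  qed simp
  ultimately show ?thesis by simp
qed

section \<open>Uniqueness of simple highest weight modules\<close>

text \<open>The eigenvalues of \<open>height_mat\<close>, an element of the Cartan subalgebra on which the simple
  roots \<open>\<epsilon>\<^sub>i - \<epsilon>\<^sub>i\<^sub>+\<^sub>1\<close> and \<open>2\<epsilon>\<^sub>n\<close> are positive.\<close>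
definition height :: "nat \<Rightarrow> nat \<Rightarrow> int" where
  "height n k = (if odd k then int n + 1 - int (Suc k div 2) else int (k div 2) - int n - 1)"

lemma height_eqs [simp]:
  "height n (2*j) = int j - int n - 1" "1 \<le> j \<Longrightarrow> height n (2*j - Suc 0) = int n + 1 - int j"
  by (auto simp: height_def)

lemma height_partner: "k \<in> idx n \<Longrightarrow> height n (partner k) = - height n k"
  by (erule idx_cases) auto

text \<open>The element \<open>height_mat\<close> is regular: no root vanishes on it, so height zero
  singles out the Cartan subalgebra.\<close>

lemma height_add_eq_0:
  assumes "a \<in> idx n" "b \<in> idx n" "height n a + height n b = 0"
  shows "b = partner a"
  using assms(1)
proof (cases rule: idx_cases)
  case (even i)
  note i = this
  from assms(2) show ?thesis by (cases rule: idx_cases) (use i assms(3) in auto)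
next
  case (odd i)
  note i = this
  from assms(2) show ?thesis by (cases rule: idx_cases) (use i assms(3) in auto)
qed

definition height_mat :: "nat \<Rightarrow> real mat" where
  "height_mat n = mat_of n (\<lambda>k l. if k = l then of_int (height n k) else 0)"

lemma height_mat_sp [simp]: "height_mat n \<in> sp n"
proof (rule spI)
  fix k l assume kl: "k \<in> idx n" "l \<in> idx n"
  have "partner l = partner k \<longleftrightarrow> k = l"
    using partner_partner[OF kl(1)] partner_partner[OF kl(2)] by metis
  then show "ent (height_mat n) k l = - sg k * sg l * ent (height_mat n) (partner l) (partner k)"
    using kl by (auto simp: height_mat_def height_partner)
qed (simp add: height_mat_def)

lemma height_mat_commutator:
  assumes "a \<in> idx n" "b \<in> idx n"
  shows "height_mat n * sym_mat n a b - sym_mat n a b * height_mat n =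
    of_int (height n a + height n b) \<cdot>\<^sub>m sym_mat n a b"
proof (rule ent_eqI)
  note c = sp_carrier[OF height_mat_sp] sym_mat_carrier
  show "height_mat n * sym_mat n a b - sym_mat n a b * height_mat n \<in> carrier_mat (2*n) (2*n)"
    using sp_commutator[OF height_mat_sp sym_mat_sp[OF assms]] sp_carrier by blast
  show "of_int (height n a + height n b) \<cdot>\<^sub>m sym_mat n a b \<in> carrier_mat (2*n) (2*n)"
    by simp
  fix k l assume kl: "k \<in> idx n" "l \<in> idx n"
  have 1: "ent (height_mat n * sym_mat n a b) k l = of_int (height n k) * ent (sym_mat n a b) k l"
    unfolding ent_mult[OF c kl]
    by (subst sum_single_index[of _ k]) (use kl in \<open>auto simp: height_mat_def\<close>)
  have 2: "ent (sym_mat n a b * height_mat n) k l = of_int (height n l) * ent (sym_mat n a b) k l"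
    unfolding ent_mult[OF c(2,1) kl]
    by (subst sum_single_index[of _ l]) (use kl in \<open>auto simp: height_mat_def\<close>)
  have "ent (height_mat n * sym_mat n a b - sym_mat n a b * height_mat n) k l =
      of_int (height n k - height n l) * ent (sym_mat n a b) k l"
    unfolding ent_linear(2)[OF sp_mult_carrier[OF height_mat_sp sym_mat_sp[OF assms]]
        sp_mult_carrier[OF sym_mat_sp[OF assms] height_mat_sp] kl] 1 2
    by (simp add: left_diff_distrib)
  also have "\<dots> = of_int (height n a + height n b) * ent (sym_mat n a b) k l"
  proof -
    have "partner b = partner a \<longleftrightarrow> b = a"
      using assms partner_partner by metis
    then show ?thesis
      using kl assms by (auto simp: ent_sym_mat omega_def height_partner)
  qed
  also have "\<dots> = ent (of_int (height n a + height n b) \<cdot>\<^sub>m sym_mat n a b) k l"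
    using kl by (simp add: ent_smult[of _ n])
  finally show "ent (height_mat n * sym_mat n a b - sym_mat n a b * height_mat n) k l =
      ent (of_int (height n a + height n b) \<cdot>\<^sub>m sym_mat n a b) k l" .
qed

section \<open>Calculation in an abstract module and the annihilator of a highest weight
  vector\<close>

locale sp_mod =
  fixes n :: nat and M :: "'v::ab_group_add sp_rep"
  assumes sp_module: "sp_module n M"
begin

lemma carr_closed:
  "0 \<in> carr M" "u \<in> carr M \<Longrightarrow> v \<in> carr M \<Longrightarrow> u + v \<in> carr M"
  "v \<in> carr M \<Longrightarrow> smul M c v \<in> carr M" "A \<in> sp n \<Longrightarrow> v \<in> carr M \<Longrightarrow> act M A v \<in> carr M"
  by (insert sp_module, unfold sp_module_def, simp_all)

lemmas sp_module_rules = sp_module[unfolded sp_module_def]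

lemma smul_rules:
  "u \<in> carr M \<Longrightarrow> v \<in> carr M \<Longrightarrow> smul M c (u + v) = smul M c u + smul M c v"
  "v \<in> carr M \<Longrightarrow> smul M (c + d) v = smul M c v + smul M d v"
  "v \<in> carr M \<Longrightarrow> smul M (c * d) v = smul M c (smul M d v)"
  "v \<in> carr M \<Longrightarrow> smul M 1 v = v"
  by (metis sp_module_rules)+

lemma act_rules:
  assumes "A \<in> sp n"
  shows "u \<in> carr M \<Longrightarrow> v \<in> carr M \<Longrightarrow> act M A (u + v) = act M A u + act M A v"
    "v \<in> carr M \<Longrightarrow> act M A (smul M c v) = smul M c (act M A v)"
    "B \<in> sp n \<Longrightarrow> v \<in> carr M \<Longrightarrow> act M (A + B) v = act M A v + act M B v"
    "v \<in> carr M \<Longrightarrow> act M (r \<cdot>\<^sub>m A) v = smul M (of_real r) (act M A v)"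
    "B \<in> sp n \<Longrightarrow> v \<in> carr M \<Longrightarrow> act M (A * B - B * A) v = act M A (act M B v) - act M B (act M A v)"
  by (metis assms sp_module_rules)+

lemma smul_0_left [simp]: "v \<in> carr M \<Longrightarrow> smul M 0 v = 0"
  using smul_rules(2)[of v 0 0] by simp

lemma smul_0_right [simp]: "smul M c 0 = 0"
  using smul_rules(1)[of 0 0 c] carr_closed(1) by simp

lemma act_0 [simp]: "A \<in> sp n \<Longrightarrow> act M A 0 = 0"
  using act_rules(1)[of A 0 0] carr_closed(1) by simp

lemma smul_minus_one: "v \<in> carr M \<Longrightarrow> smul M (- 1) v = - v"
  using smul_rules(2)[of v "- 1" 1] by (simp add: smul_rules(4) eq_neg_iff_add_eq_0)

lemma carr_minus: "u \<in> carr M \<Longrightarrow> v \<in> carr M \<Longrightarrow> u - v \<in> carr M"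
  using smul_minus_one[of v] carr_closed(2)[of u "smul M (- 1) v"] carr_closed(3)[of v "- 1"] by simp

lemma smul_eq_0: "v \<in> carr M \<Longrightarrow> smul M c v = 0 \<Longrightarrow> c \<noteq> 0 \<Longrightarrow> v = 0"
  using smul_rules(3)[of v "inverse c" c] by (simp add: smul_rules(4))

lemma act_swap:
  "A \<in> sp n \<Longrightarrow> B \<in> sp n \<Longrightarrow> v \<in> carr M \<Longrightarrow>
    act M A (act M B v) = act M B (act M A v) + act M (A * B - B * A) v"
  by (simp add: act_rules(5))

lemma act_zero_mat: "v \<in> carr M \<Longrightarrow> act M (0\<^sub>m (2*n) (2*n)) v = 0"
proof -
  assume v: "v \<in> carr M"
  have "0 \<cdot>\<^sub>m height_mat n = 0\<^sub>m (2*n) (2*n)"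
    using sp_carrier[OF height_mat_sp, of n] by auto
  then show ?thesis
    using act_rules(4)[OF height_mat_sp v, of 0] carr_closed(4)[OF height_mat_sp v] by simp
qed

lemma zero_mat_sp: "0\<^sub>m (2*n) (2*n) \<in> sp n"
proof -
  have "0 \<cdot>\<^sub>m height_mat n = 0\<^sub>m (2*n) (2*n)"
    using sp_carrier[OF height_mat_sp, of n] by auto
  then show ?thesis using sp_smult[OF height_mat_sp, of 0 n] by simp
qed

lemma act_span:
  assumes A: "A \<in> sp n" and v: "v \<in> carr M"
    and add: "\<And>u w. u \<in> U \<Longrightarrow> w \<in> U \<Longrightarrow> u + w \<in> U" and smul: "\<And>c u. u \<in> U \<Longrightarrow> smul M c u \<in> U"
    and zero: "0 \<in> U"
    and gen: "\<And>a b. a \<in> idx n \<Longrightarrow> b \<in> idx n \<Longrightarrow> quad_coeff A a b \<noteq> 0 \<Longrightarrow>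
      act M (sym_mat n a b) v \<in> U"
  shows "act M A v \<in> U"
proof -
  have "A \<in> {B \<in> sp n. act M B v \<in> U}"
  proof (rule sp_span[OF A])
    fix B C assume "B \<in> {B \<in> sp n. act M B v \<in> U}" "C \<in> {B \<in> sp n. act M B v \<in> U}"
    then show "B + C \<in> {B \<in> sp n. act M B v \<in> U}"
      using v by (auto simp: act_rules(3) sp_add add)
  next
    fix r B assume "B \<in> {B \<in> sp n. act M B v \<in> U}"
    then show "r \<cdot>\<^sub>m B \<in> {B \<in> sp n. act M B v \<in> U}"
      using v by (auto simp: act_rules(4) sp_smult smul)
  next
    show "0\<^sub>m (2*n) (2*n) \<in> {B \<in> sp n. act M B v \<in> U}"
      using zero zero_mat_sp v by (simp add: act_zero_mat)
  qed (use gen sp_carrier in auto)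
  then show ?thesis by simp
qed

text \<open>The elements annihilating v are closed under commutators, and simple root vectors
  generate all positive ones: e_i f_j with j < i by raising i from j + 1, then f_j f_n from
  [e_n f_j, f_n f_n], and f_i f_j from [e_n f_i, f_n f_j].\<close>

lemma highest_weight_vector_kill:
  assumes v: "highest_weight_vector n \<mu> M v" and ab: "a \<in> idx n" "b \<in> idx n"
    and pos: "height n a + height n b > 0"
  shows "act M (sym_mat n a b) v = 0"
proof -
  have vc: "v \<in> carr M" using v by (simp add: highest_weight_vector_def)
  let ?K = "\<lambda>A. A \<in> sp n \<and> act M A v = 0"
  have sm: "?K (r \<cdot>\<^sub>m A)" if "?K A" for r A
    using that vc by (simp add: sp_smult act_rules(4))
  have comm: "?K (A * B - B * A)" if "?K A" "?K B" for A B
    using that vc by (simp add: sp_commutator act_rules(5))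
  have mat: "(- 1) \<cdot>\<^sub>m ((- 1) \<cdot>\<^sub>m sym_mat n a b) = sym_mat n a b" for a b
    by (rule eq_matI) auto
  have root: "?K (if i < n then sym_mat n (2*(i+1)) (2*i - 1) else sym_mat n (2*n - 1) (2*n - 1))"
    if i: "i \<in> {1..n}" for i
  proof -
    let ?A = "if i < n then sym_mat n (2*(i+1)) (2*i - 1) else sym_mat n (2*n - 1) (2*n - 1)"
    have A: "?A \<in> sp n"
      using i idx_intros(1)[of "i+1" n] idx_intros(2)[of i n] idx_intros(2)[of n n] by auto
    have "act M ((- 1) \<cdot>\<^sub>m ?A) v = 0"
    proof -
      have "act M (simple_root_vec n i) v = 0"
        using v i by (simp add: highest_weight_vector_def)
      then show ?thesis unfolding simple_root_vec_eq[OF i] .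
    qed
    then have "?K ((- 1) \<cdot>\<^sub>m ?A)" using A sp_smult by blast
    from sm[OF this, of "- 1"] show ?thesis by (simp add: mat split: if_splits)
  qed
  have ef: "?K (sym_mat n (2*i) (2*j - 1))" if "j \<in> {1..n}" "Suc j \<le> i" "i \<le> n" for i j
    using that(2,3)
  proof (induction i rule: dec_induct)
    case base
    then show ?case using root[OF that(1)] by simp
  next
    case (step i)
    have i: "i \<in> {1..n}" "i < n" using step by auto
    let ?X = "sym_mat n (2*i) (2*j - 1)" and ?Y = "sym_mat n (2*(i+1)) (2*i - 1)"
    have idx: "2*i \<in> idx n" "2*j - 1 \<in> idx n" "2*(i+1) \<in> idx n" "2*i - 1 \<in> idx n"
      using i that(1) idx_intros(1)[of "i+1" n] by auto
    have "?X * ?Y - ?Y * ?X = sym_mat n (2*Suc i) (2*j - 1)"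
    proof (rule ent_eqI[OF _ sym_mat_carrier])
      show "?X * ?Y - ?Y * ?X \<in> carrier_mat (2*n) (2*n)"
        using sp_commutator sym_mat_sp idx sp_carrier by blast
      fix k l assume kl: "k \<in> idx n" "l \<in> idx n"
      show "ent (?X * ?Y - ?Y * ?X) k l = ent (sym_mat n (2*Suc i) (2*j - 1)) k l"
        unfolding sym_mat_commutator[OF idx kl]
        using i that(1) step omega_eqs[of i "i+1"] omega_eqs[of j "i+1"] omega_eqs[of i i] omega_eqs[of j i]
          sym_mat_commute[of n "2*j - 1" "2*(i+1)"]
        by (simp del: One_nat_def)
    qed
    then show ?case using comm[of ?X ?Y] step root[OF i(1)] i by simp
  qed
  have n1: "n \<in> {1..n}"
    using ab by (auto simp: idx_def)
  note idxn = idx_intros(1)[OF n1] idx_intros(2)[OF n1] n1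
  have ffn: "?K (sym_mat n (2*j - 1) (2*n - 1))" if j: "j \<in> {1..n}" "j < n" for j
  proof -
    let ?X = "sym_mat n (2*n) (2*j - 1)" and ?Y = "sym_mat n (2*n - 1) (2*n - 1)"
    \<comment> \<open>The factor 2 appears because e_n pairs with both copies of f_n.\<close>
    have "?X * ?Y - ?Y * ?X = 2 \<cdot>\<^sub>m sym_mat n (2*j - 1) (2*n - 1)"
    proof (rule ent_eqI)
      show "?X * ?Y - ?Y * ?X \<in> carrier_mat (2*n) (2*n)"
        using sp_commutator[OF sym_mat_sp sym_mat_sp] idxn j idx_intros(2) sp_carrier by blast
      fix k l assume kl: "k \<in> idx n" "l \<in> idx n"
      show "ent (?X * ?Y - ?Y * ?X) k l = ent (2 \<cdot>\<^sub>m sym_mat n (2*j - 1) (2*n - 1)) k l"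
        unfolding sym_mat_commutator[OF idxn(1) idx_intros(2)[OF j(1)] idxn(2) idxn(2) kl] ent_smult[OF sym_mat_carrier kl]
        using j idxn omega_eqs[of n n] omega_eqs[of j n]
        by (simp del: One_nat_def)
    qed simp
    then have "?K (2 \<cdot>\<^sub>m sym_mat n (2*j - 1) (2*n - 1))"
      using comm[of ?X ?Y] ef[OF j(1) Suc_leI[OF j(2)]] root[OF idxn(3)] by simp
    moreover have "(1/2) \<cdot>\<^sub>m (2 \<cdot>\<^sub>m sym_mat n (2*j - 1) (2*n - 1)) = sym_mat n (2*j - 1) (2*n - 1)"
      by (rule eq_matI) auto
    ultimately show ?thesis using sm[of "2 \<cdot>\<^sub>m _" "1/2"] by metis
  qed
  have ff: "?K (sym_mat n (2*i - 1) (2*j - 1))" if ij: "i \<in> {1..n}" "j \<in> {1..n}" for i j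
  proof -
    consider "i = n" "j = n" | "i < n" "j = n" | "i = n" "j < n" | "i < n" "j < n"
      using ij by force
    then show ?thesis
    proof cases
      case 1
      then show ?thesis using root[OF idxn(3)] by simp
    next
      case 2
      then show ?thesis using ffn[OF ij(1)] by simp
    next
      case 3
      then show ?thesis using ffn[OF ij(2)] sym_mat_commute by metis
    next
      case 4
      let ?X = "sym_mat n (2*n) (2*i - 1)" and ?Y = "sym_mat n (2*n - 1) (2*j - 1)"
      have idx: "2*n \<in> idx n" "2*i - 1 \<in> idx n" "2*n - 1 \<in> idx n" "2*j - 1 \<in> idx n"
        using ij idxn idx_intros(2) by blast+
      have "?X * ?Y - ?Y * ?X = sym_mat n (2*i - 1) (2*j - 1)"
      proof (rule ent_eqI[OF _ sym_mat_carrier])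
        show "?X * ?Y - ?Y * ?X \<in> carrier_mat (2*n) (2*n)"
          using sp_commutator[OF sym_mat_sp sym_mat_sp] idx sp_carrier by blast
        fix k l assume kl: "k \<in> idx n" "l \<in> idx n"
        show "ent (?X * ?Y - ?Y * ?X) k l = ent (sym_mat n (2*i - 1) (2*j - 1)) k l"
          unfolding sym_mat_commutator[OF idx kl]
          using 4 ij idxn omega_eqs[of n n] omega_eqs[of i n] omega_eqs[of n j] omega_eqs[of i j]
          by (simp del: One_nat_def)
      qed
      moreover have "?K ?Y" using ffn[OF ij(2) 4(2)] sym_mat_commute by metis
      ultimately show ?thesis using comm[of ?X ?Y] ef[OF ij(1) Suc_leI[OF 4(1)]] by simp
    qed
  qed
  from ab(1) have "?K (sym_mat n a b)"
  proof (cases rule: idx_cases)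
    case (even i)
    note i = this
    from ab(2) show ?thesis
    proof (cases rule: idx_cases)
      case (even j)
      then show ?thesis using pos i by auto
    next
      case (odd j)
      then show ?thesis using pos i ef[of j i] by auto
    qed
  next
    case (odd i)
    note i = this
    from ab(2) show ?thesis
    proof (cases rule: idx_cases)
      case (even j)
      then show ?thesis using pos i ef[of i j] sym_mat_commute[of n a b] by auto
    next
      case (odd j)
      then show ?thesis using i ff by blast
    qed
  qed
  then show ?thesis by blast
qed

lemma highest_weight_vector_cartan:
  assumes v: "highest_weight_vector n \<mu> M v" and a: "a \<in> idx n"
  shows "\<exists>c. act M (sym_mat n a (partner a)) v = smul M c v"
proof -
  have c: "act M (sym_mat n (2*i) (2*i - 1)) v = smul M (\<mu> i) v" if "i \<in> {1..n}" for i
    using v that unfolding highest_weight_vector_def cartan_eq[OF that, symmetric] by blast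
  from a show ?thesis
  proof (cases rule: idx_cases)
    case (even i)
    then have "partner a = 2*i - 1" by simp
    then show ?thesis using c[OF even(1)] even(2) by metis
  next
    case (odd i)
    then have "partner a = 2*i" by simp
    then show ?thesis using c[OF odd(1)] odd(2) sym_mat_commute by metis
  qed
qed

end

text \<open>The image of v under the algebra generated by the negative root vectors, given by
  closure rules so that induction over its elements is available.\<close>

inductive_set lowering_span :: "nat \<Rightarrow> 'v::ab_group_add sp_rep \<Rightarrow> 'v \<Rightarrow> 'v set"
  for n :: nat and M :: "'v sp_rep" and v :: 'v where
  base: "v \<in> lowering_span n M v"
| zero: "0 \<in> lowering_span n M v"
| add: "u \<in> lowering_span n M v \<Longrightarrow> w \<in> lowering_span n M v \<Longrightarrow> u + w \<in> lowering_span n M v"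
| smul: "u \<in> lowering_span n M v \<Longrightarrow> smul M c u \<in> lowering_span n M v"
| lower: "u \<in> lowering_span n M v \<Longrightarrow> a \<in> idx n \<Longrightarrow> b \<in> idx n \<Longrightarrow> height n a + height n b < 0 \<Longrightarrow>
    act M (sym_mat n a b) u \<in> lowering_span n M v"

text \<open>A single element \<open>height_mat\<close> takes the place of the whole weight lattice:
  being below v means having eigenvalues smaller than \<open>ev\<close> by positive
  integers.\<close>

inductive_set strictly_below :: "nat \<Rightarrow> 'v::ab_group_add sp_rep \<Rightarrow> complex \<Rightarrow> 'v set"
  for n :: nat and M :: "'v sp_rep" and ev :: complex where
  zero: "0 \<in> strictly_below n M ev"
| add: "u \<in> strictly_below n M ev \<Longrightarrow> w \<in> carr M \<Longrightarrow>
    act M (height_mat n) w = smul M (ev - of_nat (Suc k)) w \<Longrightarrow> u + w \<in> strictly_below n M ev"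

context sp_mod
begin

text \<open>The induction hypothesis speaks about all of \<open>sp n\<close> at once. In A Y u = Y A
  u + [A, Y] u it then covers both terms, since [A, Y] lies in \<open>sp n\<close> again. The base
  case splits the generators into positive, Cartan and negative ones.\<close>

lemma lowering_span_submodule:
  assumes v: "highest_weight_vector n \<mu> M v"
  shows "sp_submodule n M (lowering_span n M v)"
proof -
  let ?U = "lowering_span n M v"
  have vc: "v \<in> carr M" using v by (simp add: highest_weight_vector_def)
  have sub: "w \<in> carr M" if "w \<in> ?U" for w
    using that by induction (auto intro: carr_closed vc sym_mat_sp)
  have "\<forall>A\<in>sp n. act M A w \<in> ?U" if "w \<in> ?U" for w
    using that
  proof induction
    case base
    have "act M (sym_mat n a b) v \<in> ?U" if ab: "a \<in> idx n" "b \<in> idx n" for a b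
    proof (cases "b = partner a")
      case True
      then show ?thesis
        using highest_weight_vector_cartan[OF v ab(1)]
        by (auto intro!: lowering_span.smul lowering_span.base)
    next
      case False
      show ?thesis
      proof (cases "height n a + height n b = 0")
        case True
        then have "b = partner a" by (rule height_add_eq_0[OF ab])
        then show ?thesis using False by simp
      next
        case False
        then consider "height n a + height n b > 0" | "height n a + height n b < 0" by linarith
        then show ?thesis
          by cases (use highest_weight_vector_kill[OF v ab] ab in \<open>auto intro: lowering_span.intros\<close>)
      qed
    qed
    then have "act M A v \<in> ?U" if "A \<in> sp n" for A
      using act_span[OF that vc, of ?U] lowering_span.add lowering_span.smul lowering_span.zero by blast
    then show ?case by blast
  next
    case zero
    then show ?case by (auto intro: lowering_span.intros)
  next
    case (add u w)
    then show ?case by (auto simp: act_rules(1) sub intro: lowering_span.intros)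
  next
    case (smul u c)
    then show ?case by (auto simp: act_rules(2) sub intro: lowering_span.intros)
  next
    case (lower u a b)
    show ?case
    proof
      fix A assume A: "A \<in> sp n"
      have "act M A (act M (sym_mat n a b) u) = act M (sym_mat n a b) (act M A u) +
          act M (A * sym_mat n a b - sym_mat n a b * A) u"
        using A lower by (intro act_swap) (auto intro: sub)
      moreover have "act M A u \<in> ?U" "act M (A * sym_mat n a b - sym_mat n a b * A) u \<in> ?U"
        using lower A sp_commutator[OF A sym_mat_sp] by auto
      ultimately show "act M A (act M (sym_mat n a b) u) \<in> ?U"
        using lower by (auto intro: lowering_span.intros)
    qed
  qed
  then show ?thesis
    using sub by (auto simp: sp_submodule_def intro: lowering_span.intros)
qed

lemma strictly_below_carr: "w \<in> strictly_below n M ev \<Longrightarrow> w \<in> carr M"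
  by (induction rule: strictly_below.induct) (auto intro: carr_closed)

lemma strictly_below_add:
  assumes u: "u \<in> strictly_below n M ev" and w: "w \<in> strictly_below n M ev"
  shows "u + w \<in> strictly_below n M ev"
  using w
proof (induction rule: strictly_below.induct)
  case (add w x k)
  then show ?case using strictly_below.add[of "u + w" n M ev x k] by (simp add: add.assoc)
qed (use u in simp)

lemma strictly_below_smul: "w \<in> strictly_below n M ev \<Longrightarrow> smul M c w \<in> strictly_below n M ev"
proof (induction rule: strictly_below.induct)
  case (add w x k)
  have "act M (height_mat n) (smul M c x) = smul M (ev - of_nat (Suc k)) (smul M c x)"
    using add.hyps
    by (simp only: act_rules(2)[OF height_mat_sp] smul_rules(3)[symmetric] mult.commute)
  then have "smul M c w + smul M c x \<in> strictly_below n M ev"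
    using add by (intro strictly_below.add carr_closed)
  then show ?case using add.hyps by (simp add: smul_rules(1) strictly_below_carr)
qed (simp add: strictly_below.zero)

lemma height_mat_lower:
  assumes ab: "a \<in> idx n" "b \<in> idx n" and w: "w \<in> carr M" "act M (height_mat n) w = smul M c w"
  shows "act M (height_mat n) (act M (sym_mat n a b) w) =
    smul M (c + of_int (height n a + height n b)) (act M (sym_mat n a b) w)"
proof -
  note Y = sym_mat_sp[OF ab]
  have "act M (height_mat n) (act M (sym_mat n a b) w) = act M (sym_mat n a b) (smul M c w) +
      act M (of_int (height n a + height n b) \<cdot>\<^sub>m sym_mat n a b) w"
    unfolding act_swap[OF height_mat_sp Y w(1)] height_mat_commutator[OF ab] w(2) ..
  then show ?thesis
    by (simp only: act_rules(2,4)[OF Y w(1)] smul_rules(2)[OF carr_closed(4)[OF Y w(1)]] of_real_of_int_eq)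
qed

lemma strictly_below_lower:
  assumes w: "w \<in> strictly_below n M ev" and ab: "a \<in> idx n" "b \<in> idx n" "height n a + height n b < 0"
  shows "act M (sym_mat n a b) w \<in> strictly_below n M ev"
  using w
proof (induction rule: strictly_below.induct)
  case zero
  then show ?case using ab by (simp add: strictly_below.zero)
next
  case (add u x k)
  note Y = sym_mat_sp[OF ab(1,2)]
  obtain d where d: "height n a + height n b = - int d" 
    using ab(3) by (intro that[of "nat (- (height n a + height n b))"]) simp
  have "act M (height_mat n) (act M (sym_mat n a b) x) =
      smul M (ev - of_nat (Suc (k + d))) (act M (sym_mat n a b) x)"
    using height_mat_lower[OF ab(1,2) add.hyps(2,3)] d by (simp add: algebra_simps)
  then have "act M (sym_mat n a b) u + act M (sym_mat n a b) x \<in> strictly_below n M ev"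
    using add Y by (intro strictly_below.add carr_closed)
  then show ?case using add.hyps Y by (simp add: act_rules(1) strictly_below_carr)
qed

text \<open>Together with \<open>strictly_below_not_eigen\<close> this makes the top eigenspace of
  the generated submodule the line through v.\<close>

lemma lowering_span_decomp:
  assumes v: "highest_weight_vector n \<mu> M v" and lam: "act M (height_mat n) v = smul M ev v"
    and w: "w \<in> lowering_span n M v"
  shows "\<exists>c. \<exists>x\<in>strictly_below n M ev. w = smul M c v + x"
  using w
proof induction
  have vc: "v \<in> carr M" using v by (simp add: highest_weight_vector_def)
  note sb = strictly_below.zero[of n M ev]
  {
    case base
    then show ?case using sb vc by (auto intro!: exI[of _ 1] bexI[of _ 0] simp: smul_rules(4))
  next
    case zero
    then show ?case using sb vc by (auto intro!: exI[of _ 0] bexI[of _ 0])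
  next
    case (add u w)
    then obtain c x d y where *: "x \<in> strictly_below n M ev" "y \<in> strictly_below n M ev"
      "u = smul M c v + x" "w = smul M d v + y" by blast
    then have "u + w = smul M (c + d) v + (x + y)"
      using vc by (simp add: smul_rules(2) algebra_simps)
    then show ?case using strictly_below_add[OF *(1,2)] by blast
  next
    case (smul u c)
    then obtain d x where *: "x \<in> strictly_below n M ev" "u = smul M d v + x" by blast
    then have "smul M c u = smul M (c * d) v + smul M c x"
      using vc by (simp add: smul_rules(1,3) carr_closed strictly_below_carr)
    then show ?case using strictly_below_smul[OF *(1)] by blast
  next
    case (lower u a b)
    then obtain c x where *: "x \<in> strictly_below n M ev" "u = smul M c v + x" by blast
    note Y = sym_mat_sp[OF lower.hyps(2,3)]
    obtain d where d: "height n a + height n b = - int (Suc d)"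
      using lower.hyps(4) by (intro that[of "nat (- (height n a + height n b) - 1)"]) simp
    have "act M (height_mat n) (act M (sym_mat n a b) v) =
        smul M (ev - of_nat (Suc d)) (act M (sym_mat n a b) v)"
    proof -
      have *: "ev + of_int (height n a + height n b) = ev - of_nat (Suc d)"
        unfolding d by simp
      show ?thesis
        using height_mat_lower[OF lower.hyps(2,3) vc lam] unfolding * .
    qed
    then have "0 + act M (sym_mat n a b) v \<in> strictly_below n M ev"
      using Y vc by (intro strictly_below.add[OF sb] carr_closed)
    then have "smul M c (act M (sym_mat n a b) v) + act M (sym_mat n a b) x \<in> strictly_below n M ev"
      using strictly_below_lower[OF *(1) lower.hyps(2,3,4)]
      by (auto intro: strictly_below_add strictly_below_smul)
    then have "act M (sym_mat n a b) u \<in> strictly_below n M ev"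
      using Y vc * by (simp add: act_rules(1,2) carr_closed strictly_below_carr)
    then show ?case using vc by (auto intro!: exI[of _ 0])
  }
qed

text \<open>The product of \<open>height_mat\<close> minus (ev - j) over j = 1, ..., k. It kills
  eigenvectors for ev - 1, ..., ev - k and multiplies those for \<open>ev\<close> by k!.\<close>

primrec shift_prod :: "complex \<Rightarrow> nat \<Rightarrow> 'v \<Rightarrow> 'v" where
  "shift_prod ev 0 w = w"
| "shift_prod ev (Suc k) w = act M (height_mat n) (shift_prod ev k w) +
     smul M (of_nat (Suc k) - ev) (shift_prod ev k w)"

lemma shift_prod_carr: "w \<in> carr M \<Longrightarrow> shift_prod ev k w \<in> carr M"
  by (induction k) (auto intro: carr_closed height_mat_sp simp del: of_nat_Suc)

lemma shift_prod_add: "u \<in> carr M \<Longrightarrow> w \<in> carr M \<Longrightarrow>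
    shift_prod ev k (u + w) = shift_prod ev k u + shift_prod ev k w"
  by (induction k) (simp_all add: act_rules(1) smul_rules(1) shift_prod_carr)

lemma shift_prod_eigen:
  assumes "w \<in> carr M" "act M (height_mat n) w = smul M c w"
  shows "shift_prod ev k w = smul M (\<Prod>j<k. c + of_nat (Suc j) - ev) w"
proof (induction k)
  case 0
  then show ?case using assms by (simp add: smul_rules(4))
next
  case (Suc k)
  let ?p = "\<Prod>j<k. c + of_nat (Suc j) - ev"
  have "shift_prod ev (Suc k) w = smul M (?p * c) w + smul M ((of_nat (Suc k) - ev) * ?p) w"
    using assms Suc by (simp only: shift_prod.simps act_rules(2)[OF height_mat_sp] smul_rules(3))
  also have "\<dots> = smul M (?p * c + (of_nat (Suc k) - ev) * ?p) w"
    by (rule smul_rules(2)[OF assms(1), symmetric])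
  also have "?p * c + (of_nat (Suc k) - ev) * ?p = ?p * (c + of_nat (Suc k) - ev)"
    by (simp only: algebra_simps)
  finally show ?case by (simp only: prod.lessThan_Suc)
qed

lemma shift_prod_mono: "w \<in> carr M \<Longrightarrow> shift_prod ev k w = 0 \<Longrightarrow> k \<le> k' \<Longrightarrow> shift_prod ev k' w = 0"
proof -
  assume "w \<in> carr M" "shift_prod ev k w = 0" and le: "k \<le> k'"
  from le show "shift_prod ev k' w = 0"
    by (induction rule: dec_induct) (simp_all add: \<open>shift_prod ev k w = 0\<close>)
qed

text \<open>A long enough \<open>shift_prod\<close> annihilates w as a finite sum of eigenvectors
  below \<open>ev\<close>, yet multiplies it by a factorial as an eigenvector for \<open>ev\<close>
  itself.\<close>

lemma strictly_below_not_eigen: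
  assumes w: "w \<in> strictly_below n M ev" and e: "act M (height_mat n) w = smul M ev w"
  shows "w = 0"
proof -
  have "\<exists>k. shift_prod ev k w = 0" using w
  proof (induction rule: strictly_below.induct)
    case zero
    then show ?case by (auto intro: exI[of _ 0])
  next
    case (add u x k)
    then obtain j where j: "shift_prod ev j u = 0" by blast
    have "(\<Prod>i<Suc k + j. (ev - of_nat (Suc k)) + of_nat (Suc i) - ev) = 0"
      by (intro prod_zero) (auto intro!: bexI[of _ k])
    then have "shift_prod ev (Suc k + j) x = 0"
      using shift_prod_eigen[OF add.hyps(2,3), of ev "Suc k + j"] add.hyps(2) by (simp only: smul_0_left)
    moreover have "shift_prod ev (Suc k + j) u = 0"
      using shift_prod_mono[OF strictly_below_carr[OF add.hyps(1)] j] by simp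
    ultimately show ?case
      using add.hyps by (intro exI[of _ "Suc k + j"]) (simp add: shift_prod_add strictly_below_carr del: shift_prod.simps)
  qed
  then obtain k where k: "shift_prod ev k w = 0" by blast
  have wc: "w \<in> carr M" using w by (rule strictly_below_carr)
  have "smul M (\<Prod>j<k. of_nat (Suc j)) w = 0"
    using shift_prod_eigen[OF wc e, of ev k] k by simp
  moreover have "(\<Prod>j<k. complex_of_nat (Suc j)) \<noteq> 0"
    by (simp del: of_nat_Suc)
  ultimately show ?thesis using smul_eq_0[OF wc] by blast
qed

lemma highest_weight_vector_height:
  assumes v: "highest_weight_vector n \<mu> M v"
  shows "\<exists>ev. act M (height_mat n) v = smul M ev v"
proof -
  have vc: "v \<in> carr M" using v by (simp add: highest_weight_vector_def)
  have "act M (height_mat n) v \<in> range (\<lambda>c. smul M c v)"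
  proof (rule act_span[OF height_mat_sp vc])
    fix u w assume "u \<in> range (\<lambda>c. smul M c v)" "w \<in> range (\<lambda>c. smul M c v)"
    then obtain c d where "u = smul M c v" "w = smul M d v" by blast
    then have "u + w = smul M (c + d) v" by (simp only: smul_rules(2)[OF vc])
    then show "u + w \<in> range (\<lambda>c. smul M c v)" by blast
  next
    fix c u assume "u \<in> range (\<lambda>c. smul M c v)"
    then obtain d where "u = smul M d v" by blast
    then have "smul M c u = smul M (c * d) v" by (simp only: smul_rules(3)[OF vc])
    then show "smul M c u \<in> range (\<lambda>c. smul M c v)" by blast
  next
    show "0 \<in> range (\<lambda>c. smul M c v)"
      using smul_0_left[OF vc] by (metis rangeI)
  next
    \<comment> \<open>The matrix is diagonal, so a nonzero coefficient forces \<open>b\<close> to be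
      the partner of \<open>a\<close>, and the generator lies in the Cartan subalgebra.\<close>
    fix a b assume ab: "a \<in> idx n" "b \<in> idx n" "quad_coeff (height_mat n) a b \<noteq> 0"
    have "a = partner b"
    proof (rule ccontr)
      assume "a \<noteq> partner b"
      then show False
        using ab by (simp add: quad_coeff_def height_mat_def)
    qed
    then have "b = partner a" using partner_partner[OF ab(2)] by simp
    then show "act M (sym_mat n a b) v \<in> range (\<lambda>c. smul M c v)"
      using highest_weight_vector_cartan[OF v ab(1)] by auto
  qed
  then show ?thesis by auto
qed

end

section \<open>Pairs of highest weight modules and the graph of an isomorphism\<close>

lemma sp_moduleI:
  assumes "0 \<in> carr M"
    "\<And>u v. u \<in> carr M \<Longrightarrow> v \<in> carr M \<Longrightarrow> u + v \<in> carr M"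
    "\<And>c v. v \<in> carr M \<Longrightarrow> smul M c v \<in> carr M"
    "\<And>c u v. u \<in> carr M \<Longrightarrow> v \<in> carr M \<Longrightarrow> smul M c (u + v) = smul M c u + smul M c v"
    "\<And>c d v. v \<in> carr M \<Longrightarrow> smul M (c + d) v = smul M c v + smul M d v"
    "\<And>c d v. v \<in> carr M \<Longrightarrow> smul M (c * d) v = smul M c (smul M d v)"
    "\<And>v. v \<in> carr M \<Longrightarrow> smul M 1 v = v"
    "\<And>A v. A \<in> sp n \<Longrightarrow> v \<in> carr M \<Longrightarrow> act M A v \<in> carr M"
    "\<And>A u v. A \<in> sp n \<Longrightarrow> u \<in> carr M \<Longrightarrow> v \<in> carr M \<Longrightarrow> act M A (u + v) = act M A u + act M A v"
    "\<And>A c v. A \<in> sp n \<Longrightarrow> v \<in> carr M \<Longrightarrow> act M A (smul M c v) = smul M c (act M A v)"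
    "\<And>A B v. A \<in> sp n \<Longrightarrow> B \<in> sp n \<Longrightarrow> v \<in> carr M \<Longrightarrow> act M (A + B) v = act M A v + act M B v"
    "\<And>A r v. A \<in> sp n \<Longrightarrow> v \<in> carr M \<Longrightarrow> act M (r \<cdot>\<^sub>m A) v = smul M (of_real r) (act M A v)"
    "\<And>A B v. A \<in> sp n \<Longrightarrow> B \<in> sp n \<Longrightarrow> v \<in> carr M \<Longrightarrow>
      act M (A * B - B * A) v = act M A (act M B v) - act M B (act M A v)"
  shows "sp_module n M"
  unfolding sp_module_def by (intro conjI ballI allI assms)

lemma dsum2_simps [simp]:
  "carr (dsum2 M N) = carr M \<times> carr N"
  "smul (dsum2 M N) c (u, v) = (smul M c u, smul N c v)"
  "act (dsum2 M N) A (u, v) = (act M A u, act N A v)"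
  by (simp_all add: dsum2_def)

lemma dsum2_sp_module:
  assumes "sp_module n M" "sp_module n N"
  shows "sp_module n (dsum2 M N)"
proof -
  interpret M: sp_mod n M by unfold_locales (rule assms)
  interpret N: sp_mod n N by unfold_locales (rule assms)
  show ?thesis
    by (rule sp_moduleI)
      (auto simp: dsum2_def zero_prod_def M.carr_closed N.carr_closed M.smul_rules N.smul_rules
        M.act_rules N.act_rules)
qed

lemma dsum2_highest_weight_vector:
  assumes "highest_weight_vector n \<mu> M v" "highest_weight_vector n \<mu> N w"
  shows "highest_weight_vector n \<mu> (dsum2 M N) (v, w)"
  using assms by (auto simp: highest_weight_vector_def dsum2_def zero_prod_def)

text \<open>The vectors (v, 0), (0, w) and (v, w) share one eigenvalue of \<open>height_mat\<close>,
  but the submodule generated by (v, w) meets this eigenspace only in the multiples of (v,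
  w).\<close>

lemma highest_weight_vector_not_split:
  assumes M: "sp_module n M" and N: "sp_module n N"
    and v: "highest_weight_vector n \<mu> M v" and w: "highest_weight_vector n \<mu> N w"
  shows "(v, 0) \<notin> lowering_span n (dsum2 M N) (v, w)"
    "(0, w) \<notin> lowering_span n (dsum2 M N) (v, w)"
proof -
  let ?P = "dsum2 M N"
  interpret M: sp_mod n M by unfold_locales (rule M)
  interpret N: sp_mod n N by unfold_locales (rule N)
  interpret P: sp_mod n ?P by unfold_locales (rule dsum2_sp_module[OF M N])
  note hw = dsum2_highest_weight_vector[OF v w]
  have vw: "v \<in> carr M" "w \<in> carr N" "v \<noteq> 0" "w \<noteq> 0"
    using v w by (auto simp: highest_weight_vector_def)
  obtain ev where lam: "act ?P (height_mat n) (v, w) = smul ?P ev (v, w)"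
    using P.highest_weight_vector_height[OF hw] by blast
  then have lam': "act M (height_mat n) v = smul M ev v" "act N (height_mat n) w = smul N ev w"
    by (auto simp: dsum2_def)
  have eigen: "act ?P (height_mat n) (smul M c v, smul N d w) = smul ?P ev (smul M c v, smul N d w)" for c d
    using vw lam' M.smul_rules(3)[of v c ev] M.smul_rules(3)[of v ev c]
      N.smul_rules(3)[of w d ev] N.smul_rules(3)[of w ev d]
    by (simp add: dsum2_def M.act_rules(2) N.act_rules(2) mult.commute)
  have key: "\<exists>c. a = c \<and> b = c" if h: "(smul M a v, smul N b w) \<in> lowering_span n ?P (v, w)" for a b
  proof -
    obtain c x where x: "x \<in> strictly_below n ?P ev" "(smul M a v, smul N b w) = smul ?P c (v, w) + x"
      using P.lowering_span_decomp[OF hw lam h] by blast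
    \<comment> \<open>The remainder \<open>x\<close> is both strictly below \<open>ev\<close> and an
      eigenvector for \<open>ev\<close>, hence zero; this forces both coefficients to equal
      c.\<close>
    have "x = (smul M (a - c) v, smul N (b - c) w)"
      using x(2) vw M.smul_rules(2)[of v "a - c" c] N.smul_rules(2)[of w "b - c" c]
      by (cases x) (simp add: dsum2_def)
    moreover from this have "x = 0"
      using P.strictly_below_not_eigen[OF x(1)] eigen by simp
    ultimately have "smul M (a - c) v = 0" "smul N (b - c) w = 0"
      by (auto simp: zero_prod_def)
    then have "a - c = 0" "b - c = 0"
      using M.smul_eq_0[OF vw(1)] N.smul_eq_0[OF vw(2)] vw by blast+
    then show ?thesis by simp
  qed
  show "(v, 0) \<notin> lowering_span n ?P (v, w)"
    using key[of 1 0] vw by (auto simp: M.smul_rules(4))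
  show "(0, w) \<notin> lowering_span n ?P (v, w)"
    using key[of 0 1] vw by (auto simp: N.smul_rules(4))
qed

lemma simple_module_submodule:
  assumes "simple_module n M" "sp_submodule n M W" "v \<in> carr M" "v \<notin> W"
  shows "W = {0}"
  using assms unfolding simple_module_def by blast

text \<open>The submodule of \<open>M \<oplus> N\<close> generated by a pair of highest weight vectors is the graph of an
  isomorphism, because it does not contain either of the two components of the pair.\<close>
theorem simple_highest_weight_module_unique:
  assumes M: "simple_module n M" "highest_weight_module n \<mu> M"
    and N: "simple_module n N" "highest_weight_module n \<mu> N"
  shows "sp_iso n M N"
proof -
  have mod: "sp_module n M" "sp_module n N"
    using M N by (auto simp: simple_module_def)
  let ?P = "dsum2 M N"
  interpret M: sp_mod n M by unfold_locales (rule mod)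
  interpret N: sp_mod n N by unfold_locales (rule mod)
  interpret P: sp_mod n ?P by unfold_locales (rule dsum2_sp_module[OF mod])
  obtain v where v: "highest_weight_vector n \<mu> M v"
    "\<And>W. sp_submodule n M W \<Longrightarrow> v \<in> W \<Longrightarrow> W = carr M"
    using M(2) unfolding highest_weight_module_def by blast
  obtain w where w: "highest_weight_vector n \<mu> N w"
    "\<And>W. sp_submodule n N W \<Longrightarrow> w \<in> W \<Longrightarrow> W = carr N"
    using N(2) unfolding highest_weight_module_def by blast
  have vw: "v \<in> carr M" "w \<in> carr N"
    using v(1) w(1) by (auto simp: highest_weight_vector_def)
  define G where "G = lowering_span n ?P (v, w)"
  have GP: "sp_submodule n ?P G"
    unfolding G_def by (rule P.lowering_span_submodule[OF dsum2_highest_weight_vector[OF v(1) w(1)]])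
  have G: "x \<in> carr M \<and> y \<in> carr N" "(0, 0) \<in> G"
    "(smul M c x, smul N c y) \<in> G" "A \<in> sp n \<Longrightarrow> (act M A x, act N A y) \<in> G"
    if "(x, y) \<in> G" for x y c A
    using GP that unfolding sp_submodule_def by (auto simp: dsum2_def zero_prod_def)
  have Gadd: "(x + x', y + y') \<in> G" if "(x, y) \<in> G" "(x', y') \<in> G" for x y x' y'
  proof -
    have "(x, y) + (x', y') \<in> G" using GP that unfolding sp_submodule_def by blast
    then show ?thesis by simp
  qed
  have vwG: "(v, w) \<in> G" by (simp add: G_def lowering_span.base)
  have nG: "(v, 0) \<notin> G" "(0, w) \<notin> G"
    using highest_weight_vector_not_split[OF mod v(1) w(1)] by (simp_all add: G_def)
  \<comment> \<open>The projection of G is a submodule containing the generator v, so every element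
    of M has a partner in N.\<close>
  have "{x. \<exists>y. (x, y) \<in> G} = carr M"
  proof (rule v(2))
    show "sp_submodule n M {x. \<exists>y. (x, y) \<in> G}"
      unfolding sp_submodule_def mem_Collect_eq using G(1,3,4) G(2)[OF vwG] Gadd by blast
  qed (use vwG in auto)
  then have ex1: "\<exists>y. (x, y) \<in> G" if "x \<in> carr M" for x using that by blast
  have "{y. \<exists>x. (x, y) \<in> G} = carr N"
  proof (rule w(2))
    show "sp_submodule n N {y. \<exists>x. (x, y) \<in> G}"
      unfolding sp_submodule_def mem_Collect_eq using G(1,3,4) G(2)[OF vwG] Gadd by blast
  qed (use vwG in auto)
  then have ex2: "\<exists>x. (x, y) \<in> G" if "y \<in> carr N" for y using that by blast
  \<comment> \<open>The fibre of G over 0 is a submodule of N that misses w; simplicity makes it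
    zero, so G is single-valued.\<close>
  have k1: "y = 0" if "(0, y) \<in> G" for y
  proof -
    have "sp_submodule n N {y. (0, y) \<in> G}"
      unfolding sp_submodule_def
      using G(1) G(2)[OF vwG] G(3,4)[of 0] Gadd[of 0 _ 0] by auto
    then have "{y. (0, y) \<in> G} = {0}"
      using simple_module_submodule[OF N(1) _ vw(2)] nG by blast
    then show ?thesis using that by blast
  qed
  have k2: "x = 0" if "(x, 0) \<in> G" for x
  proof -
    have "sp_submodule n M {x. (x, 0) \<in> G}"
      unfolding sp_submodule_def
      using G(1) G(2)[OF vwG] G(3,4)[of _ 0] Gadd[of _ 0 _ 0] by auto
    then have "{x. (x, 0) \<in> G} = {0}"
      using simple_module_submodule[OF M(1) _ vw(1)] nG by blast
    then show ?thesis using that by blast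
  qed
  have diff: "(x - x', y - y') \<in> G" if "(x, y) \<in> G" "(x', y') \<in> G" for x x' y y'
  proof -
    have "(x + smul M (- 1) x', y + smul N (- 1) y') \<in> G"
      using that by (intro Gadd G(3))
    then show ?thesis using G(1)[OF that(2)] by (simp add: M.smul_minus_one N.smul_minus_one)
  qed
  have fun1: "y = y'" if "(x, y) \<in> G" "(x, y') \<in> G" for x y y'
    using k1[of "y - y'"] diff[OF that] by simp
  have fun2: "x = x'" if "(x, y) \<in> G" "(x', y) \<in> G" for x x' y
    using k2[of "x - x'"] diff[OF that] by simp
  define \<phi> where "\<phi> x = (THE y. (x, y) \<in> G)" for x
  have \<phi>: "\<phi> x = y" if "(x, y) \<in> G" for x y
    unfolding \<phi>_def using that fun1 by blast
  have \<phi>G: "(x, \<phi> x) \<in> G" if "x \<in> carr M" for x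
    using ex1[OF that] \<phi> by blast
  have "bij_betw \<phi> (carr M) (carr N)"
  proof (rule bij_betwI')
    show "\<phi> x = \<phi> y \<longleftrightarrow> x = y" if "x \<in> carr M" "y \<in> carr M" for x y
      using \<phi>G[OF that(1)] \<phi>G[OF that(2)] fun2 by metis
    show "\<phi> x \<in> carr N" if "x \<in> carr M" for x using \<phi>G[OF that] G(1) by blast
    show "\<exists>x\<in>carr M. y = \<phi> x" if "y \<in> carr N" for y
      using ex2[OF that] \<phi> G(1) by metis
  qed
  moreover have "\<phi> (x + y) = \<phi> x + \<phi> y" if "x \<in> carr M" "y \<in> carr M" for x y
    using that by (intro \<phi> Gadd \<phi>G)
  moreover have "\<phi> (smul M c x) = smul N c (\<phi> x)" if "x \<in> carr M" for c x
    using that by (intro \<phi> G(3) \<phi>G)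
  moreover have "\<phi> (act M A x) = act N A (\<phi> x)" if "x \<in> carr M" "A \<in> sp n" for A x
    using that by (intro \<phi> G(4) \<phi>G)
  ultimately show ?thesis
    unfolding sp_iso_def using mod by blast
qed

text \<open>The choice made in \<open>L\<close> is meaningful only if some witness exists on its
  carrier type. Addition is fixed by that type, so \<phi> has to be additive; scalar multiplication
  and action are record fields and are transported along the inverse of \<phi>.\<close>

lemma sp_iso_L:
  fixes M :: "'v::ab_group_add sp_rep" and \<phi> :: "'v \<Rightarrow> nat \<Rightarrow>\<^sub>0 complex"
  assumes M: "simple_module n M" "highest_weight_module n \<mu> M"
    and inj: "inj_on \<phi> (carr M)"
    and add: "\<And>u v. u \<in> carr M \<Longrightarrow> v \<in> carr M \<Longrightarrow> \<phi> (u + v) = \<phi> u + \<phi> v"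
  shows "sp_iso n M (L n \<mu>)"
proof -
  have mod: "sp_module n M" using M by (simp add: simple_module_def)
  interpret M: sp_mod n M by unfold_locales (rule mod)
  let ?\<psi> = "inv_into (carr M) \<phi>"
  define N where "N = \<lparr>carr = \<phi> ` carr M, smul = \<lambda>c w. \<phi> (smul M c (?\<psi> w)),
    act = \<lambda>A w. \<phi> (act M A (?\<psi> w))\<rparr>"
  have \<psi>[simp]: "?\<psi> (\<phi> v) = v" if "v \<in> carr M" for v
    using inv_into_f_f[OF inj that] .
  have \<phi>0: "\<phi> 0 = 0" using add[of 0 0] M.carr_closed(1) by simp
  have diff: "\<phi> (u - v) = \<phi> u - \<phi> v" if "u \<in> carr M" "v \<in> carr M" for u v
    using add[of "u - v" v] that by (simp add: M.carr_minus)
  have add': "\<phi> u + \<phi> v = \<phi> (u + v)" if "u \<in> carr M" "v \<in> carr M" for u v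
    using add that by simp
  have N: "sp_module n N"
  proof (rule sp_moduleI)
    show "0 \<in> carr N"
      using \<phi>0 M.carr_closed(1) by (auto simp: N_def intro: image_eqI[of _ _ 0])
  qed (auto simp: N_def add' M.carr_closed M.smul_rules M.act_rules M.carr_minus diff[symmetric])
  have sub: "sp_submodule n M {v \<in> carr M. \<phi> v \<in> W}" if W: "sp_submodule n N W" for W
  proof -
    have W': "W \<subseteq> \<phi> ` carr M" "0 \<in> W" "\<And>u v. u \<in> W \<Longrightarrow> v \<in> W \<Longrightarrow> u + v \<in> W"
      "\<And>c v. v \<in> W \<Longrightarrow> \<phi> (smul M c (?\<psi> v)) \<in> W" "\<And>A v. A \<in> sp n \<Longrightarrow> v \<in> W \<Longrightarrow> \<phi> (act M A (?\<psi> v)) \<in> W"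
      using W by (auto simp: sp_submodule_def N_def)
    show ?thesis
      unfolding sp_submodule_def
    proof (intro conjI ballI allI)
      show "smul M c v \<in> {v \<in> carr M. \<phi> v \<in> W}" if "v \<in> {v \<in> carr M. \<phi> v \<in> W}" for c v
        using that W'(4)[of "\<phi> v" c] by (simp add: M.carr_closed)
      show "act M A v \<in> {v \<in> carr M. \<phi> v \<in> W}" if "A \<in> sp n" "v \<in> {v \<in> carr M. \<phi> v \<in> W}" for A v
        using that W'(5)[of A "\<phi> v"] by (simp add: M.carr_closed)
    qed (use W'(2,3) in \<open>auto simp: M.carr_closed \<phi>0 add\<close>)
  qed
  have img: "W = \<phi> ` {v \<in> carr M. \<phi> v \<in> W}" if "sp_submodule n N W" for W
    using that by (auto simp: sp_submodule_def N_def)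
  have simpleN: "simple_module n N"
    unfolding simple_module_def
  proof (intro conjI allI impI N)
    show "carr N \<noteq> {0}"
    proof
      assume "carr N = {0}"
      then have "v = 0" if "v \<in> carr M" for v
        using that inj_onD[OF inj, of v 0] M.carr_closed(1) \<phi>0 by (auto simp: N_def)
      then show False using M(1) M.carr_closed(1) by (auto simp: simple_module_def)
    qed
    fix W assume W: "sp_submodule n N W"
    then have "{v \<in> carr M. \<phi> v \<in> W} = {0} \<or> {v \<in> carr M. \<phi> v \<in> W} = carr M"
      using M(1) sub unfolding simple_module_def by blast
    then show "W = {0} \<or> W = carr N"
      using img[OF W] \<phi>0 by (auto simp: N_def)
  qed
  obtain v where v: "highest_weight_vector n \<mu> M v"
    "\<And>W. sp_submodule n M W \<Longrightarrow> v \<in> W \<Longrightarrow> W = carr M"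
    using M(2) unfolding highest_weight_module_def by blast
  have vc: "v \<in> carr M" "v \<noteq> 0" using v(1) by (auto simp: highest_weight_vector_def)
  have hwN: "highest_weight_module n \<mu> N"
    unfolding highest_weight_module_def
  proof (intro conjI exI[of _ "\<phi> v"] allI impI N)
    show "highest_weight_vector n \<mu> N (\<phi> v)"
      using v(1) inj_onD[OF inj, of v 0] M.carr_closed(1) \<phi>0
      by (auto simp: highest_weight_vector_def N_def)
    fix W assume W: "sp_submodule n N W \<and> \<phi> v \<in> W"
    then have "{v \<in> carr M. \<phi> v \<in> W} = carr M"
      using v(2)[OF sub] vc by blast
    then show "W = carr N" using img[OF conjunct1[OF W]] by (simp add: N_def)
  qed
  have "simple_module n (L n \<mu>) \<and> highest_weight_module n \<mu> (L n \<mu>)"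
    unfolding L_def by (rule someI[of _ N]) (use simpleN hwN in blast)
  then show ?thesis
    using simple_highest_weight_module_unique[OF M] by blast
qed

section \<open>Direct sums\<close>

lemma lookup_mapp_0: "f k 0 = 0 \<Longrightarrow> Poly_Mapping.lookup (Poly_Mapping.mapp f p) k = f k (Poly_Mapping.lookup p k)"
  by (auto simp: lookup_mapp when_def in_keys_iff)

lemma dsum_lookup:
  assumes "\<And>l. sp_module n (M l)"
  shows "u \<in> carr (dsum M) \<longleftrightarrow> (\<forall>l. Poly_Mapping.lookup u l \<in> carr (M l))"
    "Poly_Mapping.lookup (smul (dsum M) c u) l = smul (M l) c (Poly_Mapping.lookup u l)"
    "A \<in> sp n \<Longrightarrow> Poly_Mapping.lookup (act (dsum M) A u) l = act (M l) A (Poly_Mapping.lookup u l)"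
proof -
  have l: "sp_mod n (M l)" for l by unfold_locales (rule assms)
  show "u \<in> carr (dsum M) \<longleftrightarrow> (\<forall>l. Poly_Mapping.lookup u l \<in> carr (M l))"
    "Poly_Mapping.lookup (smul (dsum M) c u) l = smul (M l) c (Poly_Mapping.lookup u l)"
    "A \<in> sp n \<Longrightarrow> Poly_Mapping.lookup (act (dsum M) A u) l = act (M l) A (Poly_Mapping.lookup u l)"
    by (simp_all add: dsum_def lookup_mapp_0 sp_mod.smul_0_right[OF l] sp_mod.act_0[OF l])
qed

lemma dsum_sp_module:
  assumes "\<And>l. sp_module n (M l)"
  shows "sp_module n (dsum M)"
proof -
  have l: "sp_mod n (M l)" for l by unfold_locales (rule assms)
  note r = sp_mod.carr_closed[OF l] sp_mod.smul_rules[OF l] sp_mod.act_rules[OF l]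
  note d = dsum_lookup[of n M, OF assms]
  show ?thesis
    by (rule sp_moduleI; (intro poly_mapping_eqI)?)
      (simp_all add: d r lookup_add lookup_minus sp_add sp_smult sp_commutator)
qed

text \<open>\<open>A\<close> and \<open>B\<close> receive the even and the odd degrees. Finiteness
  of the set of nonzero projections makes the coordinates a finitely supported sequence;
  \<open>\<pi>_inj\<close> gives injectivity, and \<open>\<pi>_id\<close> lets a preimage be
  assembled as a finite sum.\<close>

lemma sp_iso_dsum:
  fixes K :: "'v::ab_group_add sp_rep" and Kc :: "nat \<Rightarrow> 'v set"
    and A B :: "nat \<Rightarrow> 'w::ab_group_add sp_rep" and \<pi> :: "nat \<Rightarrow> 'v \<Rightarrow> 'v"
  assumes K: "sp_module n K"
    and A: "\<And>l. sp_iso n \<lparr>carr = Kc (2*l), smul = smul K, act = act K\<rparr> (A l)"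
    and B: "\<And>l. sp_iso n \<lparr>carr = Kc (2*l+1), smul = smul K, act = act K\<rparr> (B l)"
    and sub: "\<And>l. Kc l \<subseteq> carr K"
    and \<pi>: "\<And>l u. u \<in> carr K \<Longrightarrow> \<pi> l u \<in> Kc l"
    and \<pi>_add: "\<And>l u v. u \<in> carr K \<Longrightarrow> v \<in> carr K \<Longrightarrow> \<pi> l (u + v) = \<pi> l u + \<pi> l v"
    and \<pi>_smul: "\<And>l c u. u \<in> carr K \<Longrightarrow> \<pi> l (smul K c u) = smul K c (\<pi> l u)"
    and \<pi>_act: "\<And>l X u. X \<in> sp n \<Longrightarrow> u \<in> carr K \<Longrightarrow> \<pi> l (act K X u) = act K X (\<pi> l u)"
    and \<pi>_fin: "\<And>u. u \<in> carr K \<Longrightarrow> finite {l. \<pi> l u \<noteq> 0}"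
    and \<pi>_inj: "\<And>u v. u \<in> carr K \<Longrightarrow> v \<in> carr K \<Longrightarrow> (\<And>l. \<pi> l u = \<pi> l v) \<Longrightarrow> u = v"
    and \<pi>_id: "\<And>l l' u. u \<in> Kc l \<Longrightarrow> \<pi> l' u = (if l = l' then u else 0)"
  shows "sp_iso n K (dsum (\<lambda>l. dsum2 (A l) (B l)))"
proof -
  interpret K: sp_mod n K by unfold_locales (rule K)
  have mod: "sp_module n (A l)" "sp_module n (B l)" for l
    using A B by (auto simp: sp_iso_def)
  obtain \<alpha> where \<alpha>: "\<And>l. bij_betw (\<alpha> l) (Kc (2*l)) (carr (A l))"
    "\<And>l u v. u \<in> Kc (2*l) \<Longrightarrow> v \<in> Kc (2*l) \<Longrightarrow> \<alpha> l (u + v) = \<alpha> l u + \<alpha> l v"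
    "\<And>l c u. u \<in> Kc (2*l) \<Longrightarrow> \<alpha> l (smul K c u) = smul (A l) c (\<alpha> l u)"
    "\<And>l X u. X \<in> sp n \<Longrightarrow> u \<in> Kc (2*l) \<Longrightarrow> \<alpha> l (act K X u) = act (A l) X (\<alpha> l u)"
    using A unfolding sp_iso_def by simp metis
  obtain \<beta> where \<beta>: "\<And>l. bij_betw (\<beta> l) (Kc (2*l+1)) (carr (B l))"
    "\<And>l u v. u \<in> Kc (2*l+1) \<Longrightarrow> v \<in> Kc (2*l+1) \<Longrightarrow> \<beta> l (u + v) = \<beta> l u + \<beta> l v"
    "\<And>l c u. u \<in> Kc (2*l+1) \<Longrightarrow> \<beta> l (smul K c u) = smul (B l) c (\<beta> l u)"
    "\<And>l X u. X \<in> sp n \<Longrightarrow> u \<in> Kc (2*l+1) \<Longrightarrow> \<beta> l (act K X u) = act (B l) X (\<beta> l u)"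
    using B unfolding sp_iso_def by simp metis
  have Kc0: "0 \<in> Kc l" for l
    using \<pi>[OF K.carr_closed(1), of l] \<pi>_add[OF K.carr_closed(1) K.carr_closed(1), of l] by simp
  have \<alpha>0: "\<alpha> l 0 = 0" and \<beta>0: "\<beta> l 0 = 0" for l
    using \<alpha>(2)[OF Kc0 Kc0, of l] \<beta>(2)[OF Kc0 Kc0, of l] by simp_all
  define f where "f u l = (\<alpha> l (\<pi> (2*l) u), \<beta> l (\<pi> (2*l+1) u))" for u l
  define \<Psi> where "\<Psi> u = Abs_poly_mapping (f u)" for u
  have lookup: "Poly_Mapping.lookup (\<Psi> u) l = f u l" if u: "u \<in> carr K" for u l
  proof -
    \<comment> \<open>The degrees 2 l and 2 l + 1 share the index l, hence the halving map.\<close>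
    have "{l. f u l \<noteq> 0} \<subseteq> (\<lambda>l. l div 2) ` {l. \<pi> l u \<noteq> 0}"
    proof
      fix l assume "l \<in> {l. f u l \<noteq> 0}"
      then have "\<pi> (2*l) u \<noteq> 0 \<or> \<pi> (2*l+1) u \<noteq> 0"
        by (auto simp: f_def \<alpha>0 \<beta>0 zero_prod_def)
      then show "l \<in> (\<lambda>l. l div 2) ` {l. \<pi> l u \<noteq> 0}"
        by (auto intro: image_eqI[of _ _ "2*l"] image_eqI[of _ _ "2*l+1"])
    qed
    then have "finite {l. f u l \<noteq> 0}"
      using \<pi>_fin[OF u] finite_surj by blast
    then show ?thesis by (simp add: \<Psi>_def)
  qed
  let ?S = "dsum (\<lambda>l. dsum2 (A l) (B l))"
  have S: "sp_module n ?S"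
    by (intro dsum_sp_module dsum2_sp_module mod)
  note d = dsum_lookup[of n "\<lambda>l. dsum2 (A l) (B l)", OF dsum2_sp_module[OF mod]]
  have f_in: "f u l \<in> carr (A l) \<times> carr (B l)" if "u \<in> carr K" for u l
    using \<pi>[OF that] \<alpha>(1)[of l] \<beta>(1)[of l] unfolding f_def bij_betw_def by blast
  have inj: "u = v" if uv: "u \<in> carr K" "v \<in> carr K" and eq: "\<Psi> u = \<Psi> v" for u v
  proof (rule \<pi>_inj[OF uv])
    fix l
    have f: "f u k = f v k" for k using lookup[OF uv(1), of k] lookup[OF uv(2), of k] eq by simp
    show "\<pi> l u = \<pi> l v"
    proof (cases "even l")
      case True
      then obtain k where k: "l = 2*k" by (elim evenE)
      then have "\<alpha> k (\<pi> l u) = \<alpha> k (\<pi> l v)" using f[of k] by (simp add: f_def)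
      then show ?thesis
        using \<pi>[OF uv(1), of l] \<pi>[OF uv(2), of l] \<alpha>(1)[of k] k by (auto simp: bij_betw_def dest: inj_onD)
    next
      case False
      then obtain k where k: "l = 2*k+1" by (elim oddE)
      then have "\<beta> k (\<pi> l u) = \<beta> k (\<pi> l v)" using f[of k] by (simp add: f_def)
      then show ?thesis
        using \<pi>[OF uv(1), of l] \<pi>[OF uv(2), of l] \<beta>(1)[of k] k by (auto simp: bij_betw_def dest: inj_onD)
    qed
  qed
  have sum_in: "sum g F \<in> carr K" if "\<And>l. g l \<in> carr K" for g :: "nat \<Rightarrow> 'v" and F
    by (induction F rule: infinite_finite_induct) (auto simp: K.carr_closed that)
  have \<pi>_sum: "\<pi> k (sum g F) = (\<Sum>l\<in>F. \<pi> k (g l))" if "\<And>l. g l \<in> carr K" for g :: "nat \<Rightarrow> 'v" and F k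
  proof -
    have "\<pi> k 0 = 0" using \<pi>_id[OF Kc0[of "Suc k"], of k] by simp
    then show ?thesis
      by (induction F rule: infinite_finite_induct) (auto simp: \<pi>_add sum_in that)
  qed
  have surj: "\<exists>u\<in>carr K. \<Psi> u = s" if s: "s \<in> carr ?S" for s
  proof -
    define a where "a l = inv_into (Kc (2*l)) (\<alpha> l) (fst (Poly_Mapping.lookup s l))" for l
    define b where "b l = inv_into (Kc (2*l+1)) (\<beta> l) (snd (Poly_Mapping.lookup s l))" for l
    have sc: "fst (Poly_Mapping.lookup s l) \<in> carr (A l)" "snd (Poly_Mapping.lookup s l) \<in> carr (B l)" for l
      using s by (auto simp: d mem_Times_iff)
    have a: "a l \<in> Kc (2*l)" "\<alpha> l (a l) = fst (Poly_Mapping.lookup s l)" for l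
      using \<alpha>(1)[of l] sc(1)[of l] unfolding a_def bij_betw_def
      by (auto intro: inv_into_into f_inv_into_f)
    have b: "b l \<in> Kc (2*l+1)" "\<beta> l (b l) = snd (Poly_Mapping.lookup s l)" for l
      using \<beta>(1)[of l] sc(2)[of l] unfolding b_def bij_betw_def
      by (auto intro: inv_into_into f_inv_into_f)
    have z: "a l = 0" "b l = 0" if "l \<notin> Poly_Mapping.keys s" for l
    proof -
      have "Poly_Mapping.lookup s l = 0" using that by (simp add: in_keys_iff)
      then have "\<alpha> l (a l) = \<alpha> l 0" "\<beta> l (b l) = \<beta> l 0"
        by (simp_all add: a b \<alpha>0 \<beta>0)
      then show "a l = 0" "b l = 0"
        using \<alpha>(1)[of l] \<beta>(1)[of l] a(1) b(1) Kc0 by (auto simp: bij_betw_def dest: inj_onD)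
    qed
    have ab: "a l \<in> carr K" "b l \<in> carr K" "a l + b l \<in> carr K" for l
      using a(1) b(1) sub K.carr_closed(2) by blast+
    define u where "u = (\<Sum>l\<in>Poly_Mapping.keys s. a l + b l)"
    have u: "u \<in> carr K" unfolding u_def by (rule sum_in) (rule ab)
    have "f u k = Poly_Mapping.lookup s k" for k
    proof -
      have "\<pi> (2*k) u = (\<Sum>l\<in>Poly_Mapping.keys s. if l = k then a l else 0)"
        unfolding u_def \<pi>_sum[OF ab(3)]
        by (rule sum.cong) (auto simp: \<pi>_add ab \<pi>_id[OF a(1)] \<pi>_id[OF b(1)], presburger+)
      moreover have "\<pi> (2*k+1) u = (\<Sum>l\<in>Poly_Mapping.keys s. if l = k then b l else 0)"
        unfolding u_def \<pi>_sum[OF ab(3)]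
        by (rule sum.cong) (auto simp: \<pi>_add ab \<pi>_id[OF a(1)] \<pi>_id[OF b(1)], presburger+)
      ultimately have "\<pi> (2*k) u = a k" "\<pi> (2*k+1) u = b k"
        using z[of k] by auto
      then show ?thesis by (simp add: f_def a b)
    qed
    then have "\<Psi> u = s" using lookup[OF u] by (intro poly_mapping_eqI) simp
    then show ?thesis using u by blast
  qed
  have "bij_betw \<Psi> (carr K) (carr ?S)"
  proof (rule bij_betwI')
    show "\<Psi> u = \<Psi> v \<longleftrightarrow> u = v" if "u \<in> carr K" "v \<in> carr K" for u v using inj that by blast
    show "\<Psi> u \<in> carr ?S" if "u \<in> carr K" for u
      using f_in[OF that] by (simp add: d lookup[OF that])
    show "\<exists>u\<in>carr K. s = \<Psi> u" if "s \<in> carr ?S" for s using surj[OF that] by blast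
  qed
  moreover have "\<Psi> (u + v) = \<Psi> u + \<Psi> v" if "u \<in> carr K" "v \<in> carr K" for u v
    using that
    by (intro poly_mapping_eqI) (simp add: lookup_add lookup K.carr_closed f_def \<pi>_add \<alpha>(2) \<beta>(2)[simplified] \<pi>)
  moreover have "\<Psi> (smul K c u) = smul ?S c (\<Psi> u)" if "u \<in> carr K" for c u
    using that
    by (intro poly_mapping_eqI) (simp add: lookup K.carr_closed f_def \<pi>_smul \<alpha>(3) \<beta>(3)[simplified] \<pi>
        d)
  moreover have "\<Psi> (act K X u) = act ?S X (\<Psi> u)" if "X \<in> sp n" "u \<in> carr K" for X u
    using that
    by (intro poly_mapping_eqI) (simp add: lookup K.carr_closed f_def \<pi>_act \<alpha>(4) \<beta>(4)[simplified] \<pi>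
        d)
  ultimately show ?thesis
    unfolding sp_iso_def using K S by blast
qed

section \<open>Supports and homogeneous components\<close>

definition supported :: "((nat \<Rightarrow>\<^sub>0 nat) \<Rightarrow> (nat \<Rightarrow>\<^sub>0 nat) \<Rightarrow> bool) \<Rightarrow> cpoly2 \<Rightarrow> bool" where
  "supported P u \<longleftrightarrow> (\<forall>m r. cf u m r \<noteq> 0 \<longrightarrow> P m r)"

definition restr :: "((nat \<Rightarrow>\<^sub>0 nat) \<Rightarrow> (nat \<Rightarrow>\<^sub>0 nat) \<Rightarrow> bool) \<Rightarrow> cpoly2 \<Rightarrow> cpoly2" where
  "restr P u = Poly_Mapping.mapp (\<lambda>m. Poly_Mapping.mapp (\<lambda>r c. if P m r then c else 0)) u"

lemma cf_restr: "cf (restr P u) m r = (if P m r then cf u m r else 0)"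
  unfolding cf_def restr_def
  by (subst lookup_mapp_0) (auto intro!: poly_mapping_eqI simp: lookup_mapp_0)

text \<open>Support conditions become fixed-point equations, so closure under an operator follows as
  soon as the operator commutes with \<open>restr P\<close>.\<close>

lemma supported_restr: "supported P u \<longleftrightarrow> restr P u = u"
proof
  show "restr P u = u" if "supported P u"
    by (rule cf_eqI) (use that in \<open>auto simp: supported_def cf_restr\<close>)
  show "supported P u" if "restr P u = u"
    unfolding supported_def by (metis that cf_restr)
qed

lemma restr_linear [simp]:
  "restr P 0 = 0" "restr P (u + w) = restr P u + restr P w" "restr P (u - w) = restr P u - restr P w"
  "restr P (- u) = - restr P u" "restr P (tens_scl c u) = tens_scl c (restr P u)"
  "restr P (sum f I) = (\<Sum>i\<in>I. restr P (f i))"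
  by (auto intro!: cf_eqI simp: cf_restr)

lemma supported_restr_self: "supported P (restr P u)"
  by (auto simp: supported_def cf_restr)

lemma supported_mono: "supported P u \<Longrightarrow> (\<And>m r. P m r \<Longrightarrow> Q m r) \<Longrightarrow> supported Q u"
  by (auto simp: supported_def)

lemma supported_linear:
  "supported P 0" "supported P u \<Longrightarrow> supported P w \<Longrightarrow> supported P (u + w)"
  "supported P u \<Longrightarrow> supported P w \<Longrightarrow> supported P (u - w)"
  "supported P u \<Longrightarrow> supported P (tens_scl c u)"
  by (auto simp: supported_restr)

lemma restr_x_mul: "(\<And>m r. Q (m + unit_exp k) r \<longleftrightarrow> P m r) \<Longrightarrow> restr Q (x_mul k u) = x_mul k (restr P u)"
proof (rule cf_eqI)
  fix m r assume *: "\<And>m r. Q (m + unit_exp k) r \<longleftrightarrow> P m r"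
  show "cf (restr Q (x_mul k u)) m r = cf (x_mul k (restr P u)) m r"
  proof (cases "Poly_Mapping.lookup m k = 0")
    case False
    then show ?thesis
      using *[of "m - unit_exp k" r] unfolding unit_exp_diff_add[OF False]
      by (simp add: cf_restr cf_x_mul)
  qed (simp add: cf_restr cf_x_mul)
qed

lemma restr_x_pd: "(\<And>m r. P (m + unit_exp k) r \<longleftrightarrow> Q m r) \<Longrightarrow> restr Q (x_pd k u) = x_pd k (restr P u)"
  by (rule cf_eqI) (simp add: cf_restr cf_x_pd)

lemma restr_q_mul: "(\<And>m r. Q m (r + unit_exp k) \<longleftrightarrow> P m r) \<Longrightarrow> restr Q (q_mul k u) = q_mul k (restr P u)"
proof (rule cf_eqI)
  fix m r assume *: "\<And>m r. Q m (r + unit_exp k) \<longleftrightarrow> P m r"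
  show "cf (restr Q (q_mul k u)) m r = cf (q_mul k (restr P u)) m r"
  proof (cases "Poly_Mapping.lookup r k = 0")
    case False
    then show ?thesis
      using *[of m "r - unit_exp k"] unfolding unit_exp_diff_add[OF False]
      by (simp add: cf_restr cf_q_mul)
  qed (simp add: cf_restr cf_q_mul)
qed

lemma restr_q_pd: "(\<And>m r. P m (r + unit_exp k) \<longleftrightarrow> Q m r) \<Longrightarrow> restr Q (q_pd k u) = q_pd k (restr P u)"
  by (rule cf_eqI) (simp add: cf_restr cf_q_pd)

lemma x_mul_eq_0: "x_mul k u = 0 \<longleftrightarrow> u = 0"
proof
  assume "x_mul k u = 0"
  then have "cf (x_mul k u) (m + unit_exp k) r = 0" for m r by simp
  then show "u = 0"
    by (intro cf_eqI) (simp add: cf_x_mul lookup_add lookup_unit_exp)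
qed simp

lemma tens_scl_eq_0: "tens_scl c u = 0 \<longleftrightarrow> c = 0 \<or> u = 0"
proof
  assume "tens_scl c u = 0"
  then have "tens_scl (inverse c) (tens_scl c u) = 0" by simp
  then show "c = 0 \<or> u = 0" by (cases "c = 0") auto
qed auto

lemma cf_x_mul_x_pd: "cf (x_mul k (x_pd k u)) m r = of_nat (Poly_Mapping.lookup m k) * cf u m r"
  by (auto simp: cf_ops lookup_minus lookup_unit_exp unit_exp_diff_add of_nat_diff)

lemma cf_q_mul_q_pd: "cf (q_mul k (q_pd k u)) m r = of_nat (Poly_Mapping.lookup r k) * cf u m r"
  by (auto simp: cf_ops lookup_minus lookup_unit_exp unit_exp_diff_add of_nat_diff)

lemma x_pd_eq_0: "x_pd k u = 0 \<Longrightarrow> Poly_Mapping.lookup m k \<noteq> 0 \<Longrightarrow> cf u m r = 0"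
  using cf_x_mul_x_pd[of k u m r] by simp

lemma q_pd_eq_0: "q_pd k u = 0 \<Longrightarrow> Poly_Mapping.lookup r k \<noteq> 0 \<Longrightarrow> cf u m r = 0"
  using cf_q_mul_q_pd[of k u m r] by simp

text \<open>Sufficient for the projection to commute with the action, which exchanges one x-variable
  for another and applies two of the operators q_i, d/dq_j. Invariance under adding two units also
  lets one q-index be exchanged for another.\<close>

definition inv_pred :: "nat \<Rightarrow> ((nat \<Rightarrow>\<^sub>0 nat) \<Rightarrow> (nat \<Rightarrow>\<^sub>0 nat) \<Rightarrow> bool) \<Rightarrow> bool" where
  "inv_pred n P \<longleftrightarrow>
     (\<forall>k\<in>idx n. \<forall>l\<in>idx n. \<forall>m r. P (m + unit_exp k) r \<longleftrightarrow> P (m + unit_exp l) r) \<and>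
     (\<forall>i\<in>{1..n}. \<forall>j\<in>{1..n}. \<forall>m r. P m (r + unit_exp i + unit_exp j) \<longleftrightarrow> P m r)"

text \<open>A single z_k need not preserve P but leads to the predicate shifted by one q-unit. Up to
  equivalence the shift does not depend on the index of the unit, so index 1 serves for all.\<close>

lemma restr_zop2_zop2:
  assumes P: "inv_pred n P" and kl: "k \<in> idx n" "l \<in> idx n"
  shows "restr P (zop2 k (zop2 l u)) = zop2 k (zop2 l (restr P u))"
proof -
  have P1: "P m (r + unit_exp i + unit_exp j) \<longleftrightarrow> P m r" if "i \<in> {1..n}" "j \<in> {1..n}" for m r i j
    using P that unfolding inv_pred_def by blast
  have P2: "P m (r + unit_exp i) \<longleftrightarrow> P m (r + unit_exp j)" if "i \<in> {1..n}" "j \<in> {1..n}" for m r i j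
    using P1[OF that(1) that(1), of m "r + unit_exp j"] P1[OF that(1) that(2), of m "r + unit_exp i"]
    by (simp add: ac_simps)
  have outer: "restr P (zop2 k w) = zop2 k (restr (\<lambda>m r. P m (r + unit_exp i)) w)"
    if "k \<in> idx n" "i \<in> {1..n}" for k i w
    using that(1)
  proof (cases rule: idx_cases)
    case (even j)
    have "restr P (q_mul j w) = q_mul j (restr (\<lambda>m r. P m (r + unit_exp i)) w)"
      by (rule restr_q_mul) (rule P2[OF even(1) that(2)])
    then show ?thesis using even by (simp add: zop2_even)
  next
    case (odd j)
    have "restr P (q_pd j w) = q_pd j (restr (\<lambda>m r. P m (r + unit_exp i)) w)"
      by (rule restr_q_pd) (rule P1[OF odd(1) that(2)])
    then show ?thesis using odd zop2_odd[of j] by (simp del: One_nat_def)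
  qed
  have inner: "restr (\<lambda>m r. P m (r + unit_exp i)) (zop2 l w) = zop2 l (restr P w)"
    if "l \<in> idx n" "i \<in> {1..n}" for l i w
    using that(1)
  proof (cases rule: idx_cases)
    case (even j)
    have "restr (\<lambda>m r. P m (r + unit_exp i)) (q_mul j w) = q_mul j (restr P w)"
      by (rule restr_q_mul) (rule P1[OF even(1) that(2)])
    then show ?thesis using even by (simp add: zop2_even)
  next
    case (odd j)
    have "restr (\<lambda>m r. P m (r + unit_exp i)) (q_pd j w) = q_pd j (restr P w)"
      by (rule restr_q_pd) (rule P2[OF odd(1) that(2)])
    then show ?thesis using odd zop2_odd[of j] by (simp del: One_nat_def)
  qed
  have 1: "1 \<in> {1..n}" using kl by (auto simp: idx_def)
  show ?thesis unfolding outer[OF kl(1) 1] inner[OF kl(2) 1] ..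
qed

lemma q_act_zop2_sum:
  "q_act n A u = tens_scl (1/2) (\<Sum>k\<in>idx n. \<Sum>l\<in>idx n.
     tens_scl (of_real (quad_coeff A k l)) (zop2 k (zop2 l u)))"
  by (rule poly_mapping_eqI)
    (simp add: lookup_q_act quad_op_def lookup_tens_scl lookup_sum lookup_zop2 scl_sum)

lemma restr_tens_act:
  assumes P: "inv_pred n P" and A: "A \<in> sp n"
  shows "restr P (tens_act n A u) = tens_act n A (restr P u)"
proof -
  have P1: "P (m + unit_exp k) r \<longleftrightarrow> P (m + unit_exp l) r" if "k \<in> idx n" "l \<in> idx n" for m r k l
    using P that unfolding inv_pred_def by blast
  have "restr P (x_mul l (x_pd k u)) = x_mul l (x_pd k (restr P u))" if "k \<in> idx n" "l \<in> idx n" for k l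
  proof -
    have "restr P (x_mul l (x_pd k u)) = x_mul l (restr (\<lambda>m r. P (m + unit_exp l) r) (x_pd k u))"
      by (rule restr_x_mul) simp
    also have "restr (\<lambda>m r. P (m + unit_exp l) r) (x_pd k u) = x_pd k (restr P u)"
      by (rule restr_x_pd) (rule P1[OF that])
    finally show ?thesis .
  qed
  then show ?thesis
    by (simp add: tens_act_eq[OF A] x_act_def q_act_zop2_sum restr_zop2_zop2[OF P])
qed

section \<open>Degrees in the two kinds of coordinates and in q, and the projections they
  define\<close>

definition deg_x :: "nat \<Rightarrow> (nat \<Rightarrow>\<^sub>0 nat) \<Rightarrow> nat" where
  "deg_x n m = (\<Sum>k\<in>idx n. Poly_Mapping.lookup m k)"

definition deg_f :: "nat \<Rightarrow> (nat \<Rightarrow>\<^sub>0 nat) \<Rightarrow> nat" where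
  "deg_f n m = (\<Sum>j=1..n. Poly_Mapping.lookup m (2*j - 1))"

definition deg_e :: "nat \<Rightarrow> (nat \<Rightarrow>\<^sub>0 nat) \<Rightarrow> nat" where
  "deg_e n m = (\<Sum>j=1..n. Poly_Mapping.lookup m (2*j))"

definition deg_q :: "nat \<Rightarrow> (nat \<Rightarrow>\<^sub>0 nat) \<Rightarrow> nat" where
  "deg_q n r = (\<Sum>j=1..n. Poly_Mapping.lookup r j)"

lemma deg_x_split: "deg_x n m = deg_f n m + deg_e n m"
  unfolding deg_x_def deg_f_def deg_e_def sum_pairs by (simp add: sum.distrib)

lemma deg_unit_exp:
  "k \<in> idx n \<Longrightarrow> deg_x n (m + unit_exp k) = Suc (deg_x n m)"
  "j \<in> {1..n} \<Longrightarrow> deg_q n (m + unit_exp j) = Suc (deg_q n m)"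
  "j \<in> {1..n} \<Longrightarrow> deg_f n (m + unit_exp (2*j - 1)) = Suc (deg_f n m)"
  "deg_f n (m + unit_exp (2*j)) = deg_f n m"
  "j \<in> {1..n} \<Longrightarrow> deg_e n (m + unit_exp (2*j)) = Suc (deg_e n m)"
  "1 \<le> j \<Longrightarrow> deg_e n (m + unit_exp (2*j - 1)) = deg_e n m"
proof -
  show "k \<in> idx n \<Longrightarrow> deg_x n (m + unit_exp k) = Suc (deg_x n m)"
    by (simp add: deg_x_def lookup_add lookup_unit_exp sum.distrib)
  show "j \<in> {1..n} \<Longrightarrow> deg_q n (m + unit_exp j) = Suc (deg_q n m)"
    by (simp add: deg_q_def lookup_add lookup_unit_exp sum.distrib)
  have 1: "2*j - 1 = 2*i - 1 \<longleftrightarrow> i = j" if "j \<in> {1..n}" "i \<in> {1..n}" for i using that by auto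
  have 2: "2*j \<noteq> 2*i - 1" if "i \<in> {1..n}" for i
  proof -
    have "1 \<le> i" using that by simp
    then show ?thesis by presburger
  qed
  have 3: "2*j - 1 \<noteq> 2*i" if "1 \<le> j" for i using that by presburger
  show "j \<in> {1..n} \<Longrightarrow> deg_f n (m + unit_exp (2*j - 1)) = Suc (deg_f n m)"
    by (simp only: deg_f_def lookup_add lookup_unit_exp sum.distrib 1 cong: sum.cong) simp
  show "deg_f n (m + unit_exp (2*j)) = deg_f n m"
    by (simp only: deg_f_def lookup_add lookup_unit_exp sum.distrib 2 if_False cong: sum.cong) simp
  show "j \<in> {1..n} \<Longrightarrow> deg_e n (m + unit_exp (2*j)) = Suc (deg_e n m)"
    by (simp add: deg_e_def lookup_add lookup_unit_exp sum.distrib)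
  show "1 \<le> j \<Longrightarrow> deg_e n (m + unit_exp (2*j - 1)) = deg_e n m"
    by (simp only: deg_e_def lookup_add lookup_unit_exp sum.distrib 3 if_False) simp
qed

definition in_range :: "nat \<Rightarrow> nat \<Rightarrow> (nat \<Rightarrow>\<^sub>0 nat) \<Rightarrow> (nat \<Rightarrow>\<^sub>0 nat) \<Rightarrow> bool" where
  "in_range n e m r \<longleftrightarrow> Poly_Mapping.keys m \<subseteq> idx n \<and> Poly_Mapping.keys r \<subseteq> {1..n} \<and> deg_q n r mod 2 = e"

lemma keys_add_unit_exp: "Poly_Mapping.keys (m + unit_exp k) = insert k (Poly_Mapping.keys m)"
  by (auto simp: in_keys_iff lookup_add lookup_unit_exp split: if_splits)

lemma inv_pred_in_range: "inv_pred n (in_range n e)"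
  unfolding inv_pred_def
proof (intro conjI ballI allI)
  fix k l m r assume "k \<in> idx n" "l \<in> idx n"
  then show "in_range n e (m + unit_exp k) r \<longleftrightarrow> in_range n e (m + unit_exp l) r"
    by (simp add: in_range_def keys_add_unit_exp)
next
  fix i j m r assume "i \<in> {1..n}" "j \<in> {1..n}"
  then show "in_range n e m (r + unit_exp i + unit_exp j) \<longleftrightarrow> in_range n e m r"
    by (simp add: in_range_def keys_add_unit_exp deg_unit_exp)
qed

lemma inv_pred_deg_x: "inv_pred n (\<lambda>m r. deg_x n m = l)"
  by (simp add: inv_pred_def deg_unit_exp)

text \<open>Two predicates are used because D lowers the degree in x by one; they ignore the
  exponents in q, whose parity D reverses.\<close>

lemma restr_symp_dirac:
  assumes "\<And>m k. k \<in> idx n \<Longrightarrow> P (m + unit_exp k) \<longleftrightarrow> Q m"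
  shows "restr (\<lambda>m r. Q m) (symp_dirac n u) = symp_dirac n (restr (\<lambda>m r. P m) u)"
proof -
  have z: "restr (\<lambda>m r. P m) (zop2 k u) = zop2 k (restr (\<lambda>m r. P m) u)" if "k \<in> idx n" for k
    using that
  proof (cases rule: idx_cases)
    case (even i)
    then show ?thesis by (simp add: zop2_even restr_q_mul[where P = "\<lambda>m r. P m"])
  next
    case (odd i)
    then show ?thesis
      using zop2_odd[of i] by (simp add: restr_q_pd[where P = "\<lambda>m r. P m"] del: One_nat_def)
  qed
  show ?thesis
    unfolding symp_dirac_eq restr_linear
    by (intro sum.cong refl arg_cong[where f = "tens_scl _"])
      (simp add: restr_x_pd[where P = "\<lambda>m r. P m"] assms z)
qed

lemma symp_dirac_q:
  "symp_dirac n u = tens_scl \<i> ((\<Sum>j=1..n. x_pd (2*j - 1) (q_mul j u)) - (\<Sum>j=1..n. x_pd (2*j) (q_pd j u)))"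
proof -
  have "symp_dirac n u = (\<Sum>j=1..n. tens_scl \<i> (x_pd (2*j - 1) (q_mul j u)) - tens_scl \<i> (x_pd (2*j) (q_pd j u)))"
    unfolding symp_dirac_eq sum_pairs
    by (intro sum.cong refl) (simp add: zop2_even zop2_odd[simplified] tens_scl_minus_left)
  then show ?thesis by (simp add: sum_subtractf)
qed

lemma tens_act_ff:
  assumes "i \<in> {1..n}" "j \<in> {1..n}"
  shows "tens_act n (sym_mat n (2*i - 1) (2*j - 1)) u =
    x_mul (2*i) (x_pd (2*j - 1) u) + x_mul (2*j) (x_pd (2*i - 1) u) - q_pd i (q_pd j u)"
proof -
  have "zop2 (2*i - 1) w = tens_scl \<i> (q_pd i w)" "zop2 (2*j - 1) w = tens_scl \<i> (q_pd j w)" for w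
    using assms zop2_odd[of i] zop2_odd[of j] by auto
  then have "tens_act n (sym_mat n (2*i - 1) (2*j - 1)) u =
      x_mul (2*i) (x_pd (2*j - 1) u) + x_mul (2*j) (x_pd (2*i - 1) u) +
      tens_scl (1/2) (tens_scl (- 1) (q_pd i (q_pd j u)) + tens_scl (- 1) (q_pd i (q_pd j u)))"
    using assms unfolding tens_act_sym_mat[OF idx_intros(2)[OF assms(1)] idx_intros(2)[OF assms(2)]]
    by (simp add: ops_commute(4)[of j i])
  also have "tens_scl (1/2) (tens_scl (- 1) w + tens_scl (- 1) w) = - w" for w
    by (rule cf_eqI) (simp only: cf_linear, simp)
  finally show ?thesis by simp
qed

text \<open>The term u/2 for i = j comes from symmetrising q_i d/dq_i; it is the shift by one half
  in all weights.\<close>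

lemma tens_act_ef:
  assumes "i \<in> {1..n}" "j \<in> {1..n}"
  shows "tens_act n (sym_mat n (2*i) (2*j - 1)) u =
    x_mul (2*j) (x_pd (2*i) u) - x_mul (2*i - 1) (x_pd (2*j - 1) u) -
    q_mul i (q_pd j u) - (if i = j then tens_scl (1/2) u else 0)"
proof -
  have "zop2 (2*j - 1) w = tens_scl \<i> (q_pd j w)" for w
    using assms zop2_odd[of j] by auto
  then have "tens_act n (sym_mat n (2*i) (2*j - 1)) u =
      x_mul (2*j) (x_pd (2*i) u) - x_mul (2*i - 1) (x_pd (2*j - 1) u) +
      tens_scl (1/2) (tens_scl (- 1) (q_mul i (q_pd j u)) + tens_scl (- 1) (q_pd j (q_mul i u)))"
    using assms unfolding tens_act_sym_mat[OF idx_intros(1)[OF assms(1)] idx_intros(2)[OF assms(2)]]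
    by (simp add: zop2_even)
  also have "tens_scl (1/2) (tens_scl (- 1) (q_mul i (q_pd j u)) + tens_scl (- 1) (q_pd j (q_mul i u))) =
      - q_mul i (q_pd j u) - (if i = j then tens_scl (1/2) u else 0)"
    by (rule cf_eqI, cases "i = j") (simp_all only: q_pd_q_mul cf_linear if_True if_False, simp_all)
  finally show ?thesis by simp
qed

section \<open>Singular vectors in the kernel\<close>

definition beta :: "nat \<Rightarrow> cpoly2 \<Rightarrow> cpoly2" where
  "beta n w = (\<Sum>i=1..n. x_mul (2*i) (q_mul i w))"

definition Delta :: "nat \<Rightarrow> cpoly2 \<Rightarrow> cpoly2" where
  "Delta n w = (\<Sum>i=1..n. x_pd (2*i) (q_pd i w))"

definition homog :: "nat \<Rightarrow> nat \<Rightarrow> nat \<Rightarrow> cpoly2 \<Rightarrow> bool" where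
  "homog n b d = supported (\<lambda>m r. deg_e n m = b \<and> deg_q n r = d)"

lemma euler_q: "supported (\<lambda>m r. deg_q n r = d) w \<Longrightarrow> (\<Sum>j=1..n. q_mul j (q_pd j w)) = tens_scl (of_nat d) w"
proof (rule cf_eqI)
  fix m r assume w: "supported (\<lambda>m r. deg_q n r = d) w"
  show "cf (\<Sum>j=1..n. q_mul j (q_pd j w)) m r = cf (tens_scl (of_nat d) w) m r"
  proof (cases "cf w m r = 0")
    case False
    then have "d = deg_q n r" using w by (auto simp: supported_def)
    then show ?thesis
      by (simp add: deg_q_def cf_x_mul_x_pd cf_q_mul_q_pd flip: sum_distrib_right)
  qed (simp add: cf_x_mul_x_pd cf_q_mul_q_pd)
qed

lemma euler_e: "supported (\<lambda>m r. deg_e n m = d) w \<Longrightarrow>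
    (\<Sum>j=1..n. x_mul (2*j) (x_pd (2*j) w)) = tens_scl (of_nat d) w"
proof (rule cf_eqI)
  fix m r assume w: "supported (\<lambda>m r. deg_e n m = d) w"
  show "cf (\<Sum>j=1..n. x_mul (2*j) (x_pd (2*j) w)) m r = cf (tens_scl (of_nat d) w) m r"
  proof (cases "cf w m r = 0")
    case False
    then have "d = deg_e n m" using w by (auto simp: supported_def)
    then show ?thesis
      by (simp add: deg_e_def cf_x_mul_x_pd cf_q_mul_q_pd flip: sum_distrib_right)
  qed (simp add: cf_x_mul_x_pd cf_q_mul_q_pd)
qed

lemma euler_f: "supported (\<lambda>m r. deg_f n m = d) w \<Longrightarrow>
    (\<Sum>j=1..n. x_mul (2*j - 1) (x_pd (2*j - 1) w)) = tens_scl (of_nat d) w"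
proof (rule cf_eqI)
  fix m r assume w: "supported (\<lambda>m r. deg_f n m = d) w"
  show "cf (\<Sum>j=1..n. x_mul (2*j - 1) (x_pd (2*j - 1) w)) m r = cf (tens_scl (of_nat d) w) m r"
  proof (cases "cf w m r = 0")
    case False
    then have "d = deg_f n m" using w by (auto simp: supported_def)
    then show ?thesis
      by (simp add: deg_f_def cf_x_mul_x_pd cf_q_mul_q_pd flip: sum_distrib_right)
  qed (simp add: cf_x_mul_x_pd cf_q_mul_q_pd)
qed

text \<open>The commutator of Delta and beta is n plus the Euler operators in the b_j and the q_j,
  which is a scalar in fixed bidegree.\<close>

lemma Delta_beta:
  assumes "homog n b d w"
  shows "Delta n (beta n w) = beta n (Delta n w) + tens_scl (of_nat (n + b + d)) w"
proof -
  have "Delta n (beta n w) = (\<Sum>i=1..n. \<Sum>j=1..n. x_mul (2*j) (q_mul j (x_pd (2*i) (q_pd i w))) +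
      (if i = j then q_mul j (q_pd i w) else 0) + (if i = j then x_mul (2*j) (x_pd (2*i) w) else 0) +
      (if i = j then w else 0))"
    unfolding Delta_def beta_def q_pd_linear x_pd_linear
    by (intro sum.cong refl)
      (auto simp: x_pd_x_mul q_pd_q_mul ops_commute(5-8))
  also have "\<dots> = (\<Sum>i=1..n. \<Sum>j=1..n. x_mul (2*j) (q_mul j (x_pd (2*i) (q_pd i w)))) +
      (\<Sum>i=1..n. q_mul i (q_pd i w)) + (\<Sum>i=1..n. x_mul (2*i) (x_pd (2*i) w)) + (\<Sum>i=1..n. w)"
    by (simp add: sum.distrib)
  also have "(\<Sum>i=1..n. \<Sum>j=1..n. x_mul (2*j) (q_mul j (x_pd (2*i) (q_pd i w)))) = beta n (Delta n w)"
    unfolding Delta_def beta_def by (subst sum.swap) simp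
  also have "(\<Sum>i=1..n. q_mul i (q_pd i w)) = tens_scl (of_nat d) w"
    using assms unfolding homog_def by (intro euler_q) (erule supported_mono, simp)
  also have "(\<Sum>i=1..n. x_mul (2*i) (x_pd (2*i) w)) = tens_scl (of_nat b) w"
    using assms unfolding homog_def by (intro euler_e) (erule supported_mono, simp)
  also have "(\<Sum>i=1..n. w) = tens_scl (of_nat n) w"
    by (rule cf_eqI) (simp only: cf_linear, simp)
  finally show ?thesis by (simp add: tens_scl_add_left algebra_simps)
qed

lemma Delta_homog:
  assumes w: "homog n b d w"
  shows "b = 0 \<or> d = 0 \<Longrightarrow> Delta n w = 0"
    "b = Suc b' \<Longrightarrow> d = Suc d' \<Longrightarrow> homog n b' d' (Delta n w)"
proof -
  have c: "cf w (m + unit_exp (2*i)) (r + unit_exp i) = 0"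
    if "i \<in> {1..n}" "\<not> (b = Suc (deg_e n m) \<and> d = Suc (deg_q n r))" for i m r
    using w that unfolding homog_def supported_def by (metis deg_unit_exp(2,5))
  have D: "cf (Delta n w) m r = 0" if "\<not> (b = Suc (deg_e n m) \<and> d = Suc (deg_q n r))" for m r
    using c[OF _ that] by (simp add: Delta_def cf_ops)
  show "Delta n w = 0" if "b = 0 \<or> d = 0"
    by (rule cf_eqI) (use D that in auto)
  show "homog n b' d' (Delta n w)" if "b = Suc b'" "d = Suc d'"
    unfolding homog_def supported_def
  proof (intro allI impI)
    fix m r assume "cf (Delta n w) m r \<noteq> 0"
    then have "b = Suc (deg_e n m) \<and> d = Suc (deg_q n r)" using D by blast
    then show "deg_e n m = b' \<and> deg_q n r = d'" using that by simp
  qed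
qed

text \<open>By \<open>Delta_beta\<close>, Delta w is again an eigenvector with negative eigenvalue,
  and its degree b is smaller by one. At b = 0 the operator Delta vanishes. So Delta w = 0 by
  induction, and then t w = 0.\<close>

lemma beta_Delta_negative:
  assumes "homog n b d w" "beta n (Delta n w) = tens_scl (of_real t) w" "t < 0"
  shows "w = 0"
  using assms
proof (induction b arbitrary: d w t)
  case 0
  then have "tens_scl (of_real t) w = 0"
    using Delta_homog(1)[OF 0(1)] by (simp add: beta_def)
  then show ?case using 0 by (simp add: tens_scl_eq_0)
next
  case (Suc b)
  have "Delta n w = 0"
  proof (cases d)
    case 0
    then show ?thesis using Delta_homog(1)[OF Suc.prems(1)] by simp
  next
    case (Suc d')
    have h: "homog n b d' (Delta n w)"
      using Delta_homog(2)[OF Suc.prems(1)] Suc by simp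
    have "beta n (Delta n (Delta n w)) = Delta n (beta n (Delta n w)) - tens_scl (of_nat (n + b + d')) (Delta n w)"
      using Delta_beta[OF h] by simp
    also have "Delta n (beta n (Delta n w)) = tens_scl (of_real t) (Delta n w)"
      unfolding Suc.prems(2) by (simp add: Delta_def)
    finally have "beta n (Delta n (Delta n w)) = tens_scl (of_real (t - real (n + b + d'))) (Delta n w)"
      by (simp add: tens_scl_diff_left)
    then show ?thesis using Suc.IH[OF h, of "t - real (n + b + d')"] Suc.prems(3) by simp
  qed
  then have "tens_scl (of_real t) w = 0"
    using Suc.prems(2) by (simp add: beta_def)
  then show ?case using Suc.prems by (simp add: tens_scl_eq_0)
qed

text \<open>The bound says exactly that Delta w, of bidegree (b - 1, d - 1), would have a negative
  eigenvalue. Hence Delta w = 0 and t w = 0.\<close>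

lemma beta_Delta_small:
  assumes w: "homog n b d w" "beta n (Delta n w) = tens_scl (of_real t) w" and t: "t \<noteq> 0"
    "b > 0 \<Longrightarrow> t < real n + real b + real d - 2"
  shows "w = 0"
proof -
  have "Delta n w = 0"
  proof (cases "b = 0 \<or> d = 0")
    case True
    then show ?thesis using Delta_homog(1)[OF w(1)] by simp
  next
    case False
    then obtain b' d' where bd: "b = Suc b'" "d = Suc d'" by (metis not0_implies_Suc)
    have h: "homog n b' d' (Delta n w)"
      using Delta_homog(2)[OF w(1) bd] .
    have "beta n (Delta n (Delta n w)) = Delta n (beta n (Delta n w)) - tens_scl (of_nat (n + b' + d')) (Delta n w)"
      using Delta_beta[OF h] by simp
    also have "Delta n (beta n (Delta n w)) = tens_scl (of_real t) (Delta n w)"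
      unfolding w(2) by (simp add: Delta_def)
    finally have "beta n (Delta n (Delta n w)) = tens_scl (of_real (t - real (n + b' + d'))) (Delta n w)"
      by (simp add: tens_scl_diff_left)
    then show ?thesis using beta_Delta_negative[OF h, of "t - real (n + b' + d')"] t(2) bd by simp
  qed
  then have "tens_scl (of_real t) w = 0"
    using w(2) by (simp add: beta_def)
  then show ?thesis using t by (simp add: tens_scl_eq_0)
qed

section \<open>The kernel and the equations for its singular vectors\<close>

definition spinor_ker :: "nat \<Rightarrow> nat \<Rightarrow> cpoly2 set" where
  "spinor_ker n e = {u. supported (in_range n e) u \<and> symp_dirac n u = 0}"

definition spinor_ker_deg :: "nat \<Rightarrow> nat \<Rightarrow> nat \<Rightarrow> cpoly2 set" where
  "spinor_ker_deg n e l = {u \<in> spinor_ker n e. supported (\<lambda>m r. deg_x n m = l) u}"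

definition singular :: "nat \<Rightarrow> cpoly2 \<Rightarrow> bool" where
  "singular n u \<longleftrightarrow> (\<forall>a\<in>idx n. \<forall>b\<in>idx n. height n a + height n b > 0 \<longrightarrow> tens_act n (sym_mat n a b) u = 0)"

lemma singular_ff:
  assumes "singular n u" "i \<in> {1..n}" "j \<in> {1..n}"
  shows "x_mul (2*i) (x_pd (2*j - 1) u) + x_mul (2*j) (x_pd (2*i - 1) u) = q_pd i (q_pd j u)"
proof -
  have "height n (2*i - 1) + height n (2*j - 1) > 0" using assms by auto
  then have "tens_act n (sym_mat n (2*i - 1) (2*j - 1)) u = 0"
    using assms idx_intros(2) unfolding singular_def by blast
  then show ?thesis unfolding tens_act_ff[OF assms(2,3)] by simp
qed

lemma singular_ef:
  assumes "singular n u" "i \<in> {1..n}" "j \<in> {1..n}" "j < i"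
  shows "x_mul (2*j) (x_pd (2*i) u) = x_mul (2*i - 1) (x_pd (2*j - 1) u) + q_mul i (q_pd j u)"
proof -
  have "height n (2*i) + height n (2*j - 1) > 0" using assms by auto
  then have "tens_act n (sym_mat n (2*i) (2*j - 1)) u = 0"
    using assms idx_intros(1,2) unfolding singular_def by blast
  then show ?thesis unfolding tens_act_ef[OF assms(2,3)] using assms(4) by (simp add: algebra_simps)
qed

lemma symp_dirac_eq_0:
  "symp_dirac n u = 0 \<longleftrightarrow> (\<Sum>j=1..n. x_pd (2*j - 1) (q_mul j u)) = (\<Sum>j=1..n. x_pd (2*j) (q_pd j u))"
  unfolding symp_dirac_q tens_scl_eq_0 by simp

abbreviation component :: "nat \<Rightarrow> nat \<Rightarrow> nat \<Rightarrow> cpoly2 \<Rightarrow> cpoly2" where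
  "component n k d \<equiv> restr (\<lambda>m r. deg_f n m = k \<and> deg_q n r = d)"

lemma comp_ops:
  assumes "i \<in> {1..n}"
  shows "component n k d (x_mul (2*i) u) = x_mul (2*i) (component n k d u)"
    "component n k d (x_pd (2*i) u) = x_pd (2*i) (component n k d u)"
    "component n k d (x_pd (2*i - 1) u) = x_pd (2*i - 1) (component n (Suc k) d u)"
    "component n k (Suc d) (q_mul i u) = q_mul i (component n k d u)"
    "component n k d (q_pd i u) = q_pd i (component n k (Suc d) u)"
proof -
  show "component n k d (x_mul (2*i) u) = x_mul (2*i) (component n k d u)"
    by (rule restr_x_mul) (simp add: deg_unit_exp)
  show "component n k d (x_pd (2*i) u) = x_pd (2*i) (component n k d u)"
    by (rule restr_x_pd) (simp add: deg_unit_exp)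
  show "component n k d (x_pd (2*i - 1) u) = x_pd (2*i - 1) (component n (Suc k) d u)"
    by (rule restr_x_pd) (simp only: deg_unit_exp(3)[OF assms] nat.inject)
  show "component n k (Suc d) (q_mul i u) = q_mul i (component n k d u)"
    by (rule restr_q_mul) (simp only: deg_unit_exp(2)[OF assms] nat.inject)
  show "component n k d (q_pd i u) = q_pd i (component n k (Suc d) u)"
    by (rule restr_q_pd) (simp only: deg_unit_exp(2)[OF assms] nat.inject)
qed

text \<open>The relation \<open>singular_ff\<close> is not homogeneous: one side lowers the degree
  in the a_j by one, the other the degree in q by two. Projecting it ties the component (k + 1, d)
  to the component (k, d + 2).\<close>

lemma comp_ff:
  assumes "singular n u" "i \<in> {1..n}" "j \<in> {1..n}"
  shows "x_mul (2*i) (x_pd (2*j - 1) (component n (Suc k) d u)) + x_mul (2*j) (x_pd (2*i - 1) (component n (Suc k) d u)) =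
    q_pd i (q_pd j (component n k (Suc (Suc d)) u))"
proof -
  have "component n k d (x_mul (2*i) (x_pd (2*j - 1) u) + x_mul (2*j) (x_pd (2*i - 1) u)) =
      component n k d (q_pd i (q_pd j u))"
    by (simp only: singular_ff[OF assms])
  then show ?thesis
    by (simp only: restr_linear comp_ops[OF assms(2)] comp_ops[OF assms(3)])
qed

lemma comp_dirac:
  assumes "symp_dirac n u = 0"
  shows "(\<Sum>j=1..n. q_mul j (x_pd (2*j - 1) (component n (Suc k) d u))) = Delta n (component n k (Suc (Suc d)) u)"
proof -
  have "component n k (Suc d) (\<Sum>j=1..n. x_pd (2*j - 1) (q_mul j u)) = component n k (Suc d) (\<Sum>j=1..n. x_pd (2*j) (q_pd j u))"
    using assms unfolding symp_dirac_eq_0 by (simp only:)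
  then have "(\<Sum>j=1..n. x_pd (2*j - 1) (q_mul j (component n (Suc k) d u))) =
      (\<Sum>j=1..n. x_pd (2*j) (q_pd j (component n k (Suc (Suc d)) u)))"
    unfolding restr_linear by (simp only: comp_ops cong: sum.cong)
  then show ?thesis unfolding Delta_def ops_commute(6) .
qed

text \<open>Euler's identity is applied twice; after the first derivative the q-degree is d + 1,
  hence the two different factors.\<close>

lemma comp_q_pd_q_pd:
  "(\<Sum>i=1..n. \<Sum>j=1..n. q_mul i (q_mul j (q_pd i (q_pd j (component n k (Suc (Suc d)) u))))) =
    tens_scl (of_nat (Suc (Suc d) * Suc d)) (component n k (Suc (Suc d)) u)"
proof -
  let ?w = "component n k (Suc (Suc d)) u"
  have sup: "supported (\<lambda>m r. deg_q n r = d) (component n k d u)" for d u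
    by (rule supported_mono[OF supported_restr_self]) simp
  have inner: "(\<Sum>j=1..n. q_mul j (q_pd i (q_pd j ?w))) = tens_scl (of_nat (Suc d)) (q_pd i ?w)"
    if i: "i \<in> {1..n}" for i
  proof -
    have "(\<Sum>j=1..n. q_mul j (q_pd j (q_pd i ?w))) = tens_scl (of_nat (Suc d)) (q_pd i ?w)"
      unfolding comp_ops(5)[OF i, symmetric] by (rule euler_q) (rule sup)
    then show ?thesis by (simp only: ops_commute(4)[of i])
  qed
  have "(\<Sum>i=1..n. \<Sum>j=1..n. q_mul i (q_mul j (q_pd i (q_pd j ?w)))) =
      (\<Sum>i=1..n. q_mul i (\<Sum>j=1..n. q_mul j (q_pd i (q_pd j ?w))))"
    by simp
  also have "\<dots> = (\<Sum>i=1..n. q_mul i (tens_scl (of_nat (Suc d)) (q_pd i ?w)))"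
    by (intro sum.cong refl) (simp only: inner)
  also have "\<dots> = tens_scl (of_nat (Suc d)) (\<Sum>i=1..n. q_mul i (q_pd i ?w))"
    by simp
  also have "(\<Sum>i=1..n. q_mul i (q_pd i ?w)) = tens_scl (of_nat (Suc (Suc d))) ?w"
    by (rule euler_q) (rule sup)
  finally show ?thesis by (simp only: tens_scl_linear of_nat_mult mult.commute)
qed

text \<open>Multiply \<open>comp_ff\<close> by q_i q_j and sum. Each term on the left gives beta
  applied to the sum of the q_j dv/da_j, which equals Delta w by \<open>comp_dirac\<close>; the
  right side is the double Euler factor times w.\<close>

lemma comp_beta_Delta:
  assumes u: "singular n u" "symp_dirac n u = 0"
  shows "beta n (Delta n (component n k (Suc (Suc d)) u)) =
    tens_scl (of_real (real (Suc (Suc d) * Suc d) / 2)) (component n k (Suc (Suc d)) u)"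
proof -
  let ?v = "component n (Suc k) d u" and ?w = "component n k (Suc (Suc d)) u"
  have b: "beta n (Delta n ?w) = (\<Sum>i=1..n. \<Sum>j=1..n. q_mul i (q_mul j (x_mul (2*i) (x_pd (2*j - 1) ?v))))"
    unfolding comp_dirac[OF u(2), symmetric] beta_def
    by (simp add: ops_commute(5))
  have "tens_scl (of_nat (Suc (Suc d) * Suc d)) ?w =
      (\<Sum>i=1..n. \<Sum>j=1..n. q_mul i (q_mul j (x_mul (2*i) (x_pd (2*j - 1) ?v) + x_mul (2*j) (x_pd (2*i - 1) ?v))))"
    unfolding comp_q_pd_q_pd[symmetric] using comp_ff[OF u(1)] by simp
  also have "\<dots> = beta n (Delta n ?w) + (\<Sum>i=1..n. \<Sum>j=1..n. q_mul j (q_mul i (x_mul (2*j) (x_pd (2*i - 1) ?v))))"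
    unfolding b sum.distrib[symmetric] q_mul_linear by (simp only: ops_commute(3))
  also have "(\<Sum>i=1..n. \<Sum>j=1..n. q_mul j (q_mul i (x_mul (2*j) (x_pd (2*i - 1) ?v)))) = beta n (Delta n ?w)"
    unfolding b by (rule sum.swap)
  finally have "tens_scl (1/2) (tens_scl (of_nat (Suc (Suc d) * Suc d)) ?w) =
      tens_scl (1/2) (beta n (Delta n ?w) + beta n (Delta n ?w))" by simp
  also have "\<dots> = beta n (Delta n ?w)"
    by (rule cf_eqI) (simp only: cf_linear, simp)
  finally show ?thesis by simp
qed

text \<open>Descending induction on the degree \<open>k\<close> in the odd-numbered variables: if all components
  of larger degree vanish, the components of \<open>q\<close>-degree 2 and 3 just below are eigenvectors
  of \<open>beta \<circ> Delta\<close> with an eigenvalue that this operator does not have.\<close>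
lemma singular_comp_0:
  assumes n: "n \<ge> 2" and u: "u \<in> spinor_ker_deg n e l" "singular n u"
  shows "1 \<le> k \<Longrightarrow> component n k d u = 0" "component n 0 (Suc (Suc d)) u = 0"
proof -
  have D: "symp_dirac n u = 0" and l: "\<And>m r. cf u m r \<noteq> 0 \<Longrightarrow> deg_x n m = l"
    using u(1) by (auto simp: spinor_ker_deg_def spinor_ker_def supported_def)
  have big: "component n k d u = 0" if "k > l" for k d
  proof (rule cf_eqI)
    fix m r
    show "cf (component n k d u) m r = cf 0 m r"
      using l[of m r] that deg_x_split[of n m] by (auto simp: cf_restr)
  qed
  \<comment> \<open>If the left side of \<open>comp_ff\<close> vanishes, so do all second
    q-derivatives of this component, and the double Euler factor is nonzero.\<close>
  have high: "component n k (Suc (Suc d)) u = 0" if "component n (Suc k) d u = 0" for k d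
  proof -
    have "q_pd i (q_pd j (component n k (Suc (Suc d)) u)) = 0" if "i \<in> {1..n}" "j \<in> {1..n}" for i j
      using comp_ff[OF u(2) that, of k d] \<open>component n (Suc k) d u = 0\<close> by simp
    then have "tens_scl (of_nat (Suc (Suc d) * Suc d)) (component n k (Suc (Suc d)) u) = 0"
      unfolding comp_q_pd_q_pd[symmetric] by simp
    then show ?thesis by (simp add: tens_scl_eq_0 del: of_nat_Suc of_nat_mult mult_Suc mult_Suc_right)
  qed
  have step: "component n (Suc k) d u = 0" if kl: "Suc k \<le> l" and above: "\<And>d. component n (Suc (Suc k)) d u = 0" for k d
  proof (cases "d < 2")
    case False
    then obtain d' where "d = Suc (Suc d')" by (metis Suc_1 Suc_diff_Suc le_add_diff_inverse not_less add_Suc plus_1_eq_Suc numeral_2_eq_2)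
    then show ?thesis using high[of "Suc k" d'] above by simp
  next
    case True
    let ?v = "component n (Suc k) d u" and ?w = "component n k (Suc (Suc d)) u"
    have "homog n (l - k) (Suc (Suc d)) ?w"
      unfolding homog_def supported_def
    proof (intro allI impI)
      fix m r assume "cf ?w m r \<noteq> 0"
      then show "deg_e n m = l - k \<and> deg_q n r = Suc (Suc d)"
        using l[of m r] deg_x_split[of n m] by (auto simp: cf_restr split: if_splits)
    qed
    then have w: "?w = 0"
    proof (rule beta_Delta_small[OF _ comp_beta_Delta[OF u(2) D]])
      \<comment> \<open>The bounds to check are 1 < n + (l - k) for d = 0 and 3 < n + (l - k) + 1
        for d = 1; here l - k \<ge> 1.\<close>
      have "real n + real (l - k) \<ge> 3" using n kl by simp
      moreover have "d = 0 \<or> d = 1" using True by auto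
      ultimately show "real (Suc (Suc d) * Suc d) / 2 < real n + real (l - k) + real (Suc (Suc d)) - 2"
        by auto
      show "real (Suc (Suc d) * Suc d) / 2 \<noteq> 0" by (simp only: divide_eq_0_iff of_nat_eq_0_iff) simp
    qed
    have "x_pd (2*i - 1) ?v = 0" if i: "i \<in> {1..n}" for i
    proof -
      \<comment> \<open>For i = j the two terms of \<open>comp_ff\<close> coincide, so w = 0 leaves
        2 b_i dv/da_i = 0.\<close>
      have "x_mul (2*i) (x_pd (2*i - 1) ?v) + x_mul (2*i) (x_pd (2*i - 1) ?v) = 0"
        unfolding comp_ff[OF u(2) i i] w by simp
      then have "x_mul (2*i) (x_pd (2*i - 1) ?v + x_pd (2*i - 1) ?v) = 0" by (simp only: x_mul_linear)
      then have "x_pd (2*i - 1) ?v + x_pd (2*i - 1) ?v = 0" by (simp only: x_mul_eq_0)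
      then have "cf (x_pd (2*i - 1) ?v + x_pd (2*i - 1) ?v) m r = 0" for m r by (simp only: cf_linear(1))
      then show ?thesis by (intro cf_eqI) (simp only: cf_linear, simp)
    qed
    then have "(\<Sum>i=1..n. x_mul (2*i - 1) (x_pd (2*i - 1) ?v)) = 0" by simp
    moreover have "(\<Sum>i=1..n. x_mul (2*i - 1) (x_pd (2*i - 1) ?v)) = tens_scl (of_nat (Suc k)) ?v"
      by (rule euler_f) (rule supported_mono[OF supported_restr_self], simp)
    ultimately show ?thesis by (simp add: tens_scl_eq_0 del: of_nat_Suc)
  qed
  have main: "\<forall>d. component n k d u = 0" if "1 \<le> k" "k \<le> Suc l" for k
    using that(2,1)
  proof (induction rule: inc_induct)
    case base
    then show ?case using big by simp
  next
    case (step j)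
    then obtain j' where "j = Suc j'" by (cases j) auto
    then show ?case using step \<open>\<And>k d. Suc k \<le> l \<Longrightarrow> (\<And>d. component n (Suc (Suc k)) d u = 0) \<Longrightarrow> component n (Suc k) d u = 0\<close>[of j'] by simp
  qed
  show *: "1 \<le> k \<Longrightarrow> component n k d u = 0" for k d
    using main[of k] big[of k d] by (cases "k \<le> Suc l") auto
  show "component n 0 (Suc (Suc d)) u = 0"
    using high[of 0 d] *[of 1] by simp
qed

lemma singular_support:
  assumes "n \<ge> 2" "u \<in> spinor_ker_deg n e l" "singular n u" "cf u m r \<noteq> 0"
  shows "deg_f n m = 0" "deg_q n r \<le> 1"
proof -
  have "cf (component n (deg_f n m) (deg_q n r) u) m r \<noteq> 0"
    using assms(4) by (simp add: cf_restr)
  then have *: "component n (deg_f n m) (deg_q n r) u \<noteq> 0" by auto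
  then show f: "deg_f n m = 0"
    using singular_comp_0(1)[OF assms(1-3)] by (metis One_nat_def Suc_leI gr0I)
  show "deg_q n r \<le> 1"
  proof (rule ccontr)
    assume "\<not> deg_q n r \<le> 1"
    then obtain d where "deg_q n r = Suc (Suc d)" by (metis One_nat_def less_imp_Suc_add not_le add_Suc)
    then show False using * f singular_comp_0(2)[OF assms(1-3)] by simp
  qed
qed

section \<open>Singular vectors in each parity, and their uniqueness up to scalars\<close>

definition hw_exp :: "nat \<Rightarrow> nat \<Rightarrow> (nat \<Rightarrow>\<^sub>0 nat)" where
  "hw_exp n e = (if e = 0 then 0 else unit_exp n)"

lemma exponent_eqI:
  assumes "Poly_Mapping.keys m \<subseteq> idx n" "deg_x n m = l" "n \<ge> 1"
    and "\<And>k. k \<in> idx n \<Longrightarrow> k \<noteq> 2 \<Longrightarrow> Poly_Mapping.lookup m k = 0"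
  shows "m = Poly_Mapping.single 2 l"
proof (rule poly_mapping_eqI)
  fix k
  have "deg_x n m = Poly_Mapping.lookup m 2"
    unfolding deg_x_def by (rule sum_single_index) (use assms in \<open>auto simp: idx_def\<close>)
  then show "Poly_Mapping.lookup m k = Poly_Mapping.lookup (Poly_Mapping.single 2 l) k"
    using assms by (cases "k \<in> idx n") (auto simp: lookup_single when_def in_keys_iff)
qed

text \<open>Even q-degree at most 1 means q-degree 0. The relation \<open>singular_ef\<close> with j
  = 1 then reads b_1 du/db_i = 0, so u involves b_1 only.\<close>

lemma singular_even:
  assumes n: "n \<ge> 2" and u: "u \<in> spinor_ker_deg n 0 l" "singular n u"
  shows "(\<forall>k\<in>idx n - {2}. x_pd k u = 0) \<and> (\<forall>j\<in>{1..n}. q_pd j u = 0)"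
proof -
  have r0: "deg_f n m = 0 \<and> deg_q n r = 0" if "cf u m r \<noteq> 0" for m r
  proof -
    have "deg_q n r mod 2 = 0"
      using that u(1) by (auto simp: spinor_ker_deg_def spinor_ker_def supported_def in_range_def)
    then show ?thesis using singular_support[OF n u that] by auto
  qed
  have q: "q_pd j u = 0" if "j \<in> {1..n}" for j
  proof (rule cf_eqI)
    fix m r show "cf (q_pd j u) m r = cf 0 m r"
      using r0[of m "r + unit_exp j"] that by (auto simp: cf_q_pd deg_unit_exp simp del: of_nat_Suc)
  qed
  have f: "x_pd (2*j - 1) u = 0" if "j \<in> {1..n}" for j
  proof (rule cf_eqI)
    fix m r show "cf (x_pd (2*j - 1) u) m r = cf 0 m r"
      using r0[of "m + unit_exp (2*j - 1)" r] deg_unit_exp(3)[OF that, of m]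
      by (auto simp: cf_x_pd simp del: of_nat_Suc)
  qed
  have e: "x_pd (2*i) u = 0" if "i \<in> {1..n}" "i \<noteq> 1" for i
  proof -
    have "x_mul (2*1) (x_pd (2*i) u) = 0"
      by (subst singular_ef[OF u(2) that(1)]) (use that f[of 1] q[of 1] n in auto)
    then show ?thesis by (simp add: x_mul_eq_0)
  qed
  have "x_pd k u = 0" if "k \<in> idx n" "k \<noteq> 2" for k
    using that(1) by (cases rule: idx_cases) (use e f that(2) in auto)
  then show ?thesis using q by blast
qed

text \<open>Here u is the sum of the q_j p_j, where p_j = du/dq_j depends on the b_i only. For j <
  i, the derivative b_j dp_k/db_i is p_j if i = k and 0 otherwise. So p_1 involves b_1 only, D u = 0
  forces p_1 = 0, and this propagates to all p_j with j < n.\<close>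

lemma singular_odd:
  assumes n: "n \<ge> 2" and u: "u \<in> spinor_ker_deg n 1 l" "singular n u"
  shows "(\<forall>k\<in>idx n - {2}. x_pd k u = 0) \<and> (\<forall>j\<in>{1..<n}. q_pd j u = 0)"
proof -
  have r1: "deg_f n m = 0 \<and> deg_q n r = 1 \<and> deg_e n m = l" if "cf u m r \<noteq> 0" for m r
  proof -
    have "deg_q n r mod 2 = 1" "deg_x n m = l"
      using that u(1) by (auto simp: spinor_ker_deg_def spinor_ker_def supported_def in_range_def)
    then show ?thesis
      using singular_support[OF n u that] deg_x_split[of n m] by (cases "deg_q n r") auto
  qed
  have f: "x_pd (2*j - 1) u = 0" if "j \<in> {1..n}" for j
  proof (rule cf_eqI)
    fix m r show "cf (x_pd (2*j - 1) u) m r = cf 0 m r"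
      using r1[of "m + unit_exp (2*j - 1)" r] deg_unit_exp(3)[OF that, of m]
      by (auto simp: cf_x_pd simp del: of_nat_Suc)
  qed
  have qq: "q_pd i (q_pd j u) = 0" if "i \<in> {1..n}" "j \<in> {1..n}" for i j
  proof (rule cf_eqI)
    fix m r show "cf (q_pd i (q_pd j u)) m r = cf 0 m r"
      using r1[of m "r + unit_exp i + unit_exp j"] deg_unit_exp(2)[OF that(1), of r]
        deg_unit_exp(2)[OF that(2), of "r + unit_exp i"]
      by (auto simp: cf_q_pd simp del: of_nat_Suc)
  qed
  have rel: "x_mul (2*j) (x_pd (2*i) (q_pd k u)) = (if i = k then q_pd j u else 0)"
    if "i \<in> {1..n}" "j \<in> {1..n}" "j < i" "k \<in> {1..n}" for i j k
  proof -
    have "x_mul (2*j) (x_pd (2*i) (q_pd k u)) = q_pd k (x_mul (2*j) (x_pd (2*i) u))"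
      by (simp only: ops_commute(7,8))
    also have "\<dots> = q_pd k (q_mul i (q_pd j u))"
      unfolding singular_ef[OF u(2) that(1,2,3)] f[OF that(2)] by simp
    finally show ?thesis
      unfolding q_pd_q_mul qq[OF that(4,2)] by (cases "i = k") auto
  qed
  have D: "(\<Sum>j=1..n. x_pd (2*j) (q_pd j u)) = 0"
  proof -
    have "symp_dirac n u = 0" using u(1) by (simp add: spinor_ker_deg_def spinor_ker_def)
    then have "(\<Sum>j=1..n. x_pd (2*j) (q_pd j u)) = (\<Sum>j=1..n. x_pd (2*j - 1) (q_mul j u))"
      by (simp only: symp_dirac_eq_0)
    also have "\<dots> = 0"
    proof (rule sum.neutral, rule ballI)
      fix j assume "j \<in> {1..n}"
      then show "x_pd (2*j - 1) (q_mul j u) = 0"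
        unfolding ops_commute(6)[symmetric] by (simp only: f q_mul_linear(1))
    qed
    finally show ?thesis .
  qed
  have n1: "1 \<in> {1..n}" "n \<in> {1..n}" using n by auto
  have p1: "x_pd (2*i) (q_pd 1 u) = 0" if "i \<in> {1..n}" "i \<noteq> 1" for i
    using rel[OF that(1) n1(1) _ n1(1)] that by (simp add: x_mul_eq_0)
  have "(\<Sum>j=1..n. x_mul (2*j) (x_pd (2*j) (q_pd 1 u))) = tens_scl (of_nat l) (q_pd 1 u)"
  proof (rule euler_e, unfold supported_def, intro allI impI)
    fix m r assume "cf (q_pd 1 u) m r \<noteq> 0"
    then show "deg_e n m = l" using r1[of m "r + unit_exp 1"] by (auto simp: cf_q_pd)
  qed
  moreover have "(\<Sum>j=1..n. x_mul (2*j) (x_pd (2*j) (q_pd 1 u))) = x_mul (2*1) (x_pd (2*1) (q_pd 1 u))"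
    by (rule sum_single_index) (use n1 p1 in auto)
  ultimately have e1: "x_mul (2*1) (x_pd (2*1) (q_pd 1 u)) = tens_scl (of_nat l) (q_pd 1 u)"
    by simp
  \<comment> \<open>In b_1 times the Dirac equation the term j = 1 gives l p_1 by Euler's identity,
    and each of the other n - 1 terms gives p_1 by \<open>rel\<close>; the total factor l + n - 1 is
    nonzero.\<close>
  have "0 = x_mul (2*1) (\<Sum>j=1..n. x_pd (2*j) (q_pd j u))"
    by (simp only: D x_mul_linear)
  also have "\<dots> = (\<Sum>j=1..n. x_mul (2*1) (x_pd (2*j) (q_pd j u)))"
    by (simp only: x_mul_linear)
  also have "\<dots> = tens_scl (of_nat l) (q_pd 1 u) + (\<Sum>j\<in>{1..n} - {1}. x_mul (2*1) (x_pd (2*j) (q_pd j u)))"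
    by (simp only: sum.remove[OF _ n1(1)] finite_atLeastAtMost e1)
  also have "(\<Sum>j\<in>{1..n} - {1}. x_mul (2*1) (x_pd (2*j) (q_pd j u))) = (\<Sum>j\<in>{1..n} - {1}. q_pd 1 u)"
    by (rule sum.cong) (use rel[OF _ n1(1)] in auto)
  also have "(\<Sum>j\<in>{1..n} - {1}. q_pd 1 u) = tens_scl (of_nat (n - 1)) (q_pd 1 u)"
    by (rule cf_eqI) (use n in \<open>simp only: cf_linear, simp\<close>)
  finally have "tens_scl (of_nat (l + (n - 1))) (q_pd 1 u) = 0"
    by (simp only: tens_scl_add_left of_nat_add)
  then have q1: "q_pd 1 u = 0"
    using n unfolding tens_scl_eq_0 of_nat_eq_0_iff by simp
  \<comment> \<open>By \<open>rel\<close> with k = i, multiplication by b_1 turns this derivative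
    into p_1, which is zero.\<close>
  have pi: "x_pd (2*i) (q_pd i u) = 0" if "i \<in> {1..n}" "i \<noteq> 1" for i
    using rel[OF that(1) n1(1) _ that(1)] that q1 by (simp add: x_mul_eq_0)
  \<comment> \<open>By \<open>rel\<close> with i = k = n, p_j is b_j times dp_n/db_n, and the latter
    derivative was just shown to vanish.\<close>
  have q: "q_pd j u = 0" if "j \<in> {1..<n}" for j
    using rel[OF n1(2) _ _ n1(2), of j] pi[OF n1(2)] that n by simp
  have "x_pd (2*i) (q_pd n u) = 0" if "i \<in> {1..n}" "i \<noteq> 1" for i
  proof (cases "i = n")
    case True
    then show ?thesis using pi[OF n1(2)] n by simp
  next
    case False
    then show ?thesis using rel[OF that(1) n1(1) _ n1(2)] that by (simp add: x_mul_eq_0)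
  qed
  moreover have "u = (\<Sum>j=1..n. q_mul j (q_pd j u))"
  proof -
    have "supported (\<lambda>m r. deg_q n r = 1) u" using r1 by (simp add: supported_def)
    then show ?thesis by (simp only: euler_q of_nat_1 tens_scl_linear)
  qed
  moreover have "(\<Sum>j=1..n. q_mul j (q_pd j u)) = q_mul n (q_pd n u)"
    by (rule sum_single_index) (use n1 q in auto)
  ultimately have un: "u = q_mul n (q_pd n u)" and pn: "\<And>i. i \<in> {1..n} \<Longrightarrow> i \<noteq> 1 \<Longrightarrow> x_pd (2*i) (q_pd n u) = 0"
    by (simp_all only:)
  have e: "x_pd (2*i) u = 0" if "i \<in> {1..n}" "i \<noteq> 1" for i
    by (subst un) (simp only: ops_commute(6)[symmetric] pn[OF that] q_mul_linear(1))
  have "x_pd k u = 0" if "k \<in> idx n" "k \<noteq> 2" for k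
    using that(1) by (cases rule: idx_cases) (use e f that(2) in auto)
  then show ?thesis using q by blast
qed

definition hw_vec :: "nat \<Rightarrow> nat \<Rightarrow> nat \<Rightarrow> cpoly2" where
  "hw_vec n e l = Poly_Mapping.single (Poly_Mapping.single 2 l) (Poly_Mapping.single (hw_exp n e) 1)"

lemma cf_hw_vec: "cf (hw_vec n e l) m r = (if m = Poly_Mapping.single 2 l \<and> r = hw_exp n e then 1 else 0)"
  by (auto simp: hw_vec_def cf_def lookup_single when_def)

lemma singular_unique:
  assumes n: "n \<ge> 2" and e: "e = 0 \<or> e = 1" and u: "u \<in> spinor_ker_deg n e l" "singular n u"
  shows "u = tens_scl (cf u (Poly_Mapping.single 2 l) (hw_exp n e)) (hw_vec n e l)"
proof -
  have x: "x_pd k u = 0" if "k \<in> idx n" "k \<noteq> 2" for k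
    using singular_even[OF n] singular_odd[OF n] e u that by blast
  have q: "q_pd j u = 0" if "j \<in> {1..n}" "e = 0 \<or> j < n" for j
    using singular_even[OF n, of u l] singular_odd[OF n, of u l] e u that by auto
  have "m = Poly_Mapping.single 2 l \<and> r = hw_exp n e" if c: "cf u m r \<noteq> 0" for m r
  proof
    have rng: "Poly_Mapping.keys m \<subseteq> idx n" "Poly_Mapping.keys r \<subseteq> {1..n}" "deg_q n r mod 2 = e" "deg_x n m = l"
      using c u(1) by (auto simp: spinor_ker_deg_def spinor_ker_def supported_def in_range_def)
    show "m = Poly_Mapping.single 2 l"
      by (rule exponent_eqI[OF rng(1,4)]) (use n x_pd_eq_0[OF x] c in auto)
    have r0: "Poly_Mapping.lookup r j = 0" if "j \<noteq> n \<or> e = 0" for j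
    proof (cases "j \<in> {1..n}")
      case True
      then show ?thesis using q_pd_eq_0[OF q[OF True], of r m] c that by force
    next
      case False
      then show ?thesis using rng(2) by (auto simp: in_keys_iff)
    qed
    show "r = hw_exp n e"
    proof (rule poly_mapping_eqI)
      fix j
      have "deg_q n r = Poly_Mapping.lookup r n"
        unfolding deg_q_def by (rule sum_single_index) (use n r0 in auto)
      moreover have "deg_q n r \<le> 1" using singular_support(2)[OF n u c] .
      ultimately show "Poly_Mapping.lookup r j = Poly_Mapping.lookup (hw_exp n e) j"
        using e r0[of j] rng(3) by (auto simp: hw_exp_def lookup_unit_exp)
    qed
  qed
  then show ?thesis
    by (intro cf_eqI) (auto simp: cf_hw_vec)
qed

section \<open>A contravariant form\<close>

definition supp :: "cpoly2 \<Rightarrow> ((nat \<Rightarrow>\<^sub>0 nat) \<times> (nat \<Rightarrow>\<^sub>0 nat)) set" where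
  "supp u = {(m, r). cf u m r \<noteq> 0}"

lemma finite_supp [simp]: "finite (supp u)"
proof (rule finite_subset)
  show "supp u \<subseteq> (SIGMA m:Poly_Mapping.keys u. Poly_Mapping.keys (Poly_Mapping.lookup u m))"
    by (auto simp: supp_def cf_def in_keys_iff)
qed auto

text \<open>The Fischer form, with the sign changed once for every even-numbered variable. The sign makes
  \<open>sg k \<partial>\<^sub>k\<close> the adjoint of \<open>x\<^sub>k\<close>, as contravariance requires.\<close>
definition weight_coeff :: "nat \<Rightarrow> (nat \<Rightarrow>\<^sub>0 nat) \<Rightarrow> (nat \<Rightarrow>\<^sub>0 nat) \<Rightarrow> complex" where
  "weight_coeff n m r =
     (\<Prod>k\<in>idx n. fact (Poly_Mapping.lookup m k) * of_real (sg k) ^ Poly_Mapping.lookup m k) *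
     (\<Prod>j=1..n. fact (Poly_Mapping.lookup r j))"

text \<open>Bilinear and diagonal on monomials. Summing over the support of the first argument makes
  the sum finite; \<open>pairing_commute\<close> removes the asymmetry.\<close>

definition pairing :: "nat \<Rightarrow> cpoly2 \<Rightarrow> cpoly2 \<Rightarrow> complex" where
  "pairing n u w = (\<Sum>(m, r)\<in>supp u. weight_coeff n m r * cf u m r * cf w m r)"

lemma weight_coeff_nonzero: "weight_coeff n m r \<noteq> 0"
  by (simp add: weight_coeff_def)

lemma weight_coeff_x:
  assumes "k \<in> idx n"
  shows "weight_coeff n (m + unit_exp k) r =
    of_nat (Suc (Poly_Mapping.lookup m k)) * of_real (sg k) * weight_coeff n m r"
proof -
  let ?f = "\<lambda>m k. fact (Poly_Mapping.lookup m k) * complex_of_real (sg k) ^ Poly_Mapping.lookup m k"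
  have "(\<Prod>i\<in>idx n. ?f (m + unit_exp k) i) = ?f (m + unit_exp k) k * (\<Prod>i\<in>idx n - {k}. ?f (m + unit_exp k) i)"
    using assms by (simp add: prod.remove)
  also have "(\<Prod>i\<in>idx n - {k}. ?f (m + unit_exp k) i) = (\<Prod>i\<in>idx n - {k}. ?f m i)"
    by (rule prod.cong) (auto simp: lookup_add lookup_unit_exp)
  also have "?f (m + unit_exp k) k = of_nat (Suc (Poly_Mapping.lookup m k)) * of_real (sg k) * ?f m k"
    by (simp add: lookup_add lookup_unit_exp algebra_simps)
  also have "of_nat (Suc (Poly_Mapping.lookup m k)) * of_real (sg k) * ?f m k * (\<Prod>i\<in>idx n - {k}. ?f m i) =
      of_nat (Suc (Poly_Mapping.lookup m k)) * of_real (sg k) * (\<Prod>i\<in>idx n. ?f m i)"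
    using assms by (simp add: prod.remove[of _ k] mult.assoc)
  finally show ?thesis by (simp add: weight_coeff_def mult.assoc)
qed

lemma weight_coeff_q:
  assumes "k \<in> {1..n}"
  shows "weight_coeff n m (r + unit_exp k) = of_nat (Suc (Poly_Mapping.lookup r k)) * weight_coeff n m r"
proof -
  let ?f = "\<lambda>m k. fact (Poly_Mapping.lookup m k) :: complex"
  have "(\<Prod>i=1..n. ?f (r + unit_exp k) i) = ?f (r + unit_exp k) k * (\<Prod>i\<in>{1..n} - {k}. ?f (r + unit_exp k) i)"
    using assms by (subst prod.remove[of _ k]) auto
  also have "(\<Prod>i\<in>{1..n} - {k}. ?f (r + unit_exp k) i) = (\<Prod>i\<in>{1..n} - {k}. ?f r i)"
    by (rule prod.cong) (auto simp: lookup_add lookup_unit_exp)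
  also have "?f (r + unit_exp k) k = of_nat (Suc (Poly_Mapping.lookup r k)) * ?f r k"
    by (simp add: lookup_add lookup_unit_exp)
  also have "of_nat (Suc (Poly_Mapping.lookup r k)) * ?f r k * (\<Prod>i\<in>{1..n} - {k}. ?f r i) =
      of_nat (Suc (Poly_Mapping.lookup r k)) * (\<Prod>i=1..n. ?f r i)"
    using assms by (subst (2) prod.remove[of _ k]) (auto simp: mult.assoc)
  finally show ?thesis by (simp add: weight_coeff_def)
qed

lemma pairing_superset:
  assumes "finite S" "supp u \<subseteq> S"
  shows "pairing n u w = (\<Sum>(m, r)\<in>S. weight_coeff n m r * cf u m r * cf w m r)"
  unfolding pairing_def
  by (rule sum.mono_neutral_left[OF assms]) (auto simp: supp_def)

lemma pairing_commute: "pairing n u w = pairing n w u"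
  using pairing_superset[of "supp u \<union> supp w" u n w] pairing_superset[of "supp u \<union> supp w" w n u]
  by (simp add: mult.commute mult.left_commute)

lemma pairing_linear_right:
  "pairing n u 0 = 0" "pairing n u (w + w') = pairing n u w + pairing n u w'"
  "pairing n u (w - w') = pairing n u w - pairing n u w'" "pairing n u (- w) = - pairing n u w"
  "pairing n u (tens_scl c w) = c * pairing n u w"
  "pairing n u (sum f I) = (\<Sum>i\<in>I. pairing n u (f i))"
proof -
  show *: "pairing n u 0 = 0" "pairing n u (w + w') = pairing n u w + pairing n u w'" for w w'
    by (simp_all add: pairing_def distrib_left case_prod_beta sum.distrib)
  show "pairing n u (w - w') = pairing n u w - pairing n u w'" "pairing n u (- w) = - pairing n u w"
    by (simp_all add: pairing_def right_diff_distrib case_prod_beta sum_subtractf sum_negf)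
  show "pairing n u (tens_scl c w) = c * pairing n u w"
    by (simp add: pairing_def sum_distrib_left case_prod_beta ac_simps)
  show "pairing n u (sum f I) = (\<Sum>i\<in>I. pairing n u (f i))"
    by (induction I rule: infinite_finite_induct) (simp_all add: *)
qed

lemma pairing_linear_left:
  "pairing n 0 w = 0" "pairing n (u + u') w = pairing n u w + pairing n u' w" "pairing n (- u) w = - pairing n u w"
  "pairing n (tens_scl c u) w = c * pairing n u w"
  "pairing n (sum f I) w = (\<Sum>i\<in>I. pairing n (f i) w)"
  unfolding pairing_commute[of n _ w] by (rule pairing_linear_right)+

lemma pairing_x_mul:
  assumes k: "k \<in> idx n"
  shows "pairing n (x_mul k u) w = of_real (sg k) * pairing n u (x_pd k w)"
proof -
  let ?h = "\<lambda>(m, r). (m + unit_exp k, r :: nat \<Rightarrow>\<^sub>0 nat)"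
  have inj: "inj_on ?h (supp u)" by (auto simp: inj_on_def)
  have "supp (x_mul k u) \<subseteq> ?h ` supp u"
  proof
    fix x assume "x \<in> supp (x_mul k u)"
    then obtain m r where x: "x = (m, r)" "cf (x_mul k u) m r \<noteq> 0" by (auto simp: supp_def)
    then have "Poly_Mapping.lookup m k \<noteq> 0" "cf u (m - unit_exp k) r \<noteq> 0"
      by (auto simp: cf_x_mul split: if_splits)
    then show "x \<in> ?h ` supp u"
      using x unit_exp_diff_add[of m k] by (auto simp: supp_def intro!: image_eqI[of _ _ "(m - unit_exp k, r)"])
  qed
  then have "pairing n (x_mul k u) w =
      (\<Sum>(m, r)\<in>?h ` supp u. weight_coeff n m r * cf (x_mul k u) m r * cf w m r)"
    by (intro pairing_superset) auto
  also have "\<dots> = of_real (sg k) * pairing n u (x_pd k w)"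
    unfolding pairing_def sum.reindex[OF inj] sum_distrib_left
    by (intro sum.cong refl)
      (auto simp: weight_coeff_x[OF k] cf_x_mul cf_x_pd lookup_add lookup_unit_exp simp del: of_nat_Suc)
  finally show ?thesis .
qed

lemma pairing_q_mul:
  assumes k: "k \<in> {1..n}"
  shows "pairing n (q_mul k u) w = pairing n u (q_pd k w)"
proof -
  let ?h = "\<lambda>(m :: nat \<Rightarrow>\<^sub>0 nat, r). (m, r + unit_exp k)"
  have inj: "inj_on ?h (supp u)" by (auto simp: inj_on_def)
  have "supp (q_mul k u) \<subseteq> ?h ` supp u"
  proof
    fix x assume "x \<in> supp (q_mul k u)"
    then obtain m r where x: "x = (m, r)" "cf (q_mul k u) m r \<noteq> 0" by (auto simp: supp_def)
    then have "Poly_Mapping.lookup r k \<noteq> 0" "cf u m (r - unit_exp k) \<noteq> 0"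
      by (auto simp: cf_q_mul split: if_splits)
    then show "x \<in> ?h ` supp u"
      using x unit_exp_diff_add[of r k] by (auto simp: supp_def intro!: image_eqI[of _ _ "(m, r - unit_exp k)"])
  qed
  then have "pairing n (q_mul k u) w =
      (\<Sum>(m, r)\<in>?h ` supp u. weight_coeff n m r * cf (q_mul k u) m r * cf w m r)"
    by (intro pairing_superset) auto
  also have "\<dots> = pairing n u (q_pd k w)"
    unfolding pairing_def sum.reindex[OF inj] sum_distrib_left
    by (intro sum.cong refl)
      (auto simp: weight_coeff_q[OF k] cf_q_mul cf_q_pd lookup_add lookup_unit_exp simp del: of_nat_Suc)
  finally show ?thesis .
qed

lemma pairing_x_pd:
  assumes "k \<in> idx n"
  shows "pairing n (x_pd k u) w = of_real (sg k) * pairing n u (x_mul k w)"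
proof -
  have "pairing n u (x_mul k w) = of_real (sg k) * pairing n (x_pd k u) w"
    by (subst pairing_commute, subst pairing_x_mul[OF assms], subst pairing_commute) simp
  moreover have "complex_of_real (sg k) * complex_of_real (sg k) = 1"
    by (simp flip: of_real_mult)
  ultimately show ?thesis by (simp flip: mult.assoc)
qed

text \<open>The form is bilinear and not sesquilinear, so the imaginary unit in both kinds of
  generators passes to the other argument unchanged.\<close>

lemma pairing_zop2:
  assumes "k \<in> idx n"
  shows "pairing n (zop2 k u) w = pairing n u (zop2 (partner k) w)"
proof -
  from assms show ?thesis
  proof (cases rule: idx_cases)
    case (even i)
    then have "partner k = 2*i - 1" by simp
    then show ?thesis
      using even zop2_odd[of i] by (simp add: zop2_even pairing_linear_left pairing_q_mul pairing_linear_right del: One_nat_def)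
  next
    case (odd i)
    then have "partner k = 2*i" by simp
    moreover have "pairing n (q_pd i u) w = pairing n u (q_mul i w)"
      by (subst (1 2) pairing_commute) (rule pairing_q_mul[OF odd(1), symmetric])
    ultimately show ?thesis
      using odd zop2_odd[of i] by (simp add: zop2_even pairing_linear_left pairing_linear_right del: One_nat_def)
  qed
qed

text \<open>The transpose conjugated by the diagonal matrix of the signs \<open>sg\<close>. Being a
  transpose, it exchanges opposite root spaces.\<close>

definition adj_mat :: "nat \<Rightarrow> real mat \<Rightarrow> real mat" where
  "adj_mat n A = mat_of n (\<lambda>k l. sg k * sg l * ent A l k)"

lemma adj_mat_sp: "A \<in> sp n \<Longrightarrow> adj_mat n A \<in> sp n"
proof (rule spI)
  fix k l assume A: "A \<in> sp n" and kl: "k \<in> idx n" "l \<in> idx n"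
  have "ent A l k = - sg l * sg k * ent A (partner k) (partner l)" by (rule sp_ent[OF A kl(2,1)])
  then show "ent (adj_mat n A) k l = - sg k * sg l * ent (adj_mat n A) (partner l) (partner k)"
    using kl by (simp add: adj_mat_def ac_simps)
qed (simp add: adj_mat_def)

text \<open>The adjoint of x_l d/dx_k is sg k sg l times x_k d/dx_l, and the adjoint of z_k z_l is
  the product of the partners in reversed order. Both parts assemble to the action of the same
  matrix.\<close>

lemma pairing_tens_act:
  assumes A: "A \<in> sp n"
  shows "pairing n (tens_act n A u) w = pairing n u (tens_act n (adj_mat n A) w)"
proof -
  let ?A' = "adj_mat n A"
  have "pairing n (x_act n A u) w = - (\<Sum>k\<in>idx n. \<Sum>l\<in>idx n.
      of_real (sg l * sg k * ent A k l) * pairing n u (x_mul k (x_pd l w)))"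
    unfolding x_act_def pairing_linear_left
    by (intro arg_cong[where f = uminus] sum.cong refl) (simp add: pairing_x_mul pairing_x_pd)
  also have "\<dots> = - (\<Sum>l\<in>idx n. \<Sum>k\<in>idx n.
      of_real (ent ?A' l k) * pairing n u (x_mul k (x_pd l w)))"
    by (subst sum.swap) (simp add: adj_mat_def)
  also have "\<dots> = pairing n u (x_act n ?A' w)"
    unfolding x_act_def pairing_linear_right ..
  finally have x: "pairing n (x_act n A u) w = pairing n u (x_act n ?A' w)" .
  have qc: "quad_coeff ?A' k l = quad_coeff A (partner l) (partner k)" if "k \<in> idx n" "l \<in> idx n" for k l
    using that by (simp add: quad_coeff_def adj_mat_def)
  have sum2: "(\<Sum>k\<in>idx n. \<Sum>l\<in>idx n. G (partner k) (partner l)) = (\<Sum>k\<in>idx n. \<Sum>l\<in>idx n. G k l)"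
    for G :: "nat \<Rightarrow> nat \<Rightarrow> complex"
  proof -
    have "(\<Sum>k\<in>idx n. \<Sum>l\<in>idx n. G (partner k) (partner l)) = (\<Sum>k\<in>idx n. \<Sum>l\<in>idx n. G (partner k) l)"
      by (intro sum.cong refl sum_partner)
    also have "\<dots> = (\<Sum>k\<in>idx n. \<Sum>l\<in>idx n. G k l)"
      by (rule sum_partner)
    finally show ?thesis .
  qed
  have "pairing n (q_act n A u) w = 1/2 * (\<Sum>k\<in>idx n. \<Sum>l\<in>idx n.
      of_real (quad_coeff A k l) * pairing n u (zop2 (partner l) (zop2 (partner k) w)))"
    unfolding q_act_zop2_sum pairing_linear_left
    by (intro arg_cong[where f = "(*) _"] sum.cong refl) (simp add: pairing_zop2)
  also have "(\<Sum>k\<in>idx n. \<Sum>l\<in>idx n. of_real (quad_coeff A k l) * pairing n u (zop2 (partner l) (zop2 (partner k) w))) =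
      (\<Sum>k\<in>idx n. \<Sum>l\<in>idx n. of_real (quad_coeff A (partner k) (partner l)) * pairing n u (zop2 l (zop2 k w)))"
    by (rule trans[OF sum2[symmetric]]) simp
  also have "\<dots> = (\<Sum>l\<in>idx n. \<Sum>k\<in>idx n. of_real (quad_coeff ?A' l k) * pairing n u (zop2 l (zop2 k w)))"
    by (subst sum.swap) (simp add: qc)
  also have "1/2 * \<dots> = pairing n u (q_act n ?A' w)"
    unfolding q_act_zop2_sum pairing_linear_right ..
  finally show ?thesis
    using x by (simp add: tens_act_eq A adj_mat_sp pairing_linear_left pairing_linear_right)
qed

section \<open>Linear algebra\<close>

interpretation cpoly2: vector_space tens_scl
  by unfold_locales (simp_all add: tens_scl_add_left)

text \<open>Finitely many functionals separating K bound its dimension by their number: passing to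
  the kernel of one functional costs at most one vector \<open>u0\<close>.\<close>

lemma span_of_separating:
  assumes "finite b" "cpoly2.subspace K"
    and "\<And>u. u \<in> K \<Longrightarrow> (\<And>w. w \<in> b \<Longrightarrow> pairing n w u = 0) \<Longrightarrow> u = 0"
  shows "\<exists>T. finite T \<and> card T \<le> card b \<and> K \<subseteq> cpoly2.span T"
  using assms
proof (induction b arbitrary: K rule: finite_induct)
  case empty
  then show ?case by (intro exI[of _ "{}"]) auto
next
  case (insert w b)
  let ?K = "{u \<in> K. pairing n w u = 0}"
  have sub: "cpoly2.subspace ?K"
    using insert.prems(1) by (auto simp: cpoly2.subspace_def pairing_linear_right)
  have "\<exists>T. finite T \<and> card T \<le> card b \<and> ?K \<subseteq> cpoly2.span T"
    by (rule insert.IH[OF sub]) (use insert.prems(2) in auto)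
  then obtain T where T: "finite T" "card T \<le> card b" "?K \<subseteq> cpoly2.span T" by blast
  show ?case
  proof (cases "?K = K")
    case True
    then show ?thesis using T insert.hyps by (intro exI[of _ T]) auto
  next
    case False
    then obtain u0 where u0: "u0 \<in> K" "pairing n w u0 \<noteq> 0" by blast
    have "u \<in> cpoly2.span (insert u0 T)" if u: "u \<in> K" for u
    proof -
      let ?c = "pairing n w u / pairing n w u0"
      have "u - tens_scl ?c u0 \<in> ?K"
        using u u0 insert.prems(1)
        by (auto simp: pairing_linear_right cpoly2.subspace_diff cpoly2.subspace_scale)
      then have "u - tens_scl ?c u0 \<in> cpoly2.span T" using T by blast
      then show ?thesis using cpoly2.span_insert[of u0 T] by blast
    qed
    then show ?thesis
      using T insert.hyps by (intro exI[of _ "insert u0 T"]) (auto simp: card_insert_if)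
  qed
qed

text \<open>If no nonzero vector of K were orthogonal to W, a basis of W would separate K, so the
  dimension of K would be at most that of its proper subspace W. Being a count of dimensions, the
  argument is not disturbed by a form that degenerates on K.\<close>

lemma exists_orthogonal:
  assumes W: "cpoly2.subspace W" and K: "cpoly2.subspace K" and WK: "W \<subseteq> K" "W \<noteq> K"
    and fin: "finite S" "K \<subseteq> cpoly2.span S"
  shows "\<exists>u\<in>K. u \<noteq> 0 \<and> (\<forall>w\<in>W. pairing n w u = 0)"
proof (rule ccontr)
  assume neg: "\<not> ?thesis"
  obtain b where b: "b \<subseteq> W" "cpoly2.independent b" "W \<subseteq> cpoly2.span b"
    using cpoly2.maximal_independent_subset by blast
  have finb: "finite b"
    using cpoly2.independent_span_bound[OF fin(1) b(2)] b(1) WK(1) fin(2) by blast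
  have "\<exists>T. finite T \<and> card T \<le> card b \<and> K \<subseteq> cpoly2.span T"
  proof (rule span_of_separating[OF finb K, of n])
    fix u assume u: "u \<in> K" and 0: "\<And>w. w \<in> b \<Longrightarrow> pairing n w u = 0"
    have "cpoly2.subspace {w. pairing n w u = 0}"
      unfolding pairing_commute[of n _ u] by (auto simp: cpoly2.subspace_def pairing_linear_right)
    then have "cpoly2.span b \<subseteq> {w. pairing n w u = 0}"
      using 0 by (intro cpoly2.span_minimal) auto
    then show "u = 0" using neg u b(3) by blast
  qed
  then obtain T where T: "finite T" "card T \<le> card b" "K \<subseteq> cpoly2.span T" by blast
  obtain x where x: "x \<in> K" "x \<notin> W" using WK by blast
  have "x \<notin> cpoly2.span b"
    using x cpoly2.span_minimal[OF b(1) W] by blast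
  then have "cpoly2.independent (insert x b)"
    using b(2) by (simp add: cpoly2.independent_insert)
  moreover have "insert x b \<subseteq> cpoly2.span T"
    using x b(1) WK(1) T(3) by blast
  ultimately have "card (insert x b) \<le> card T"
    using cpoly2.independent_span_bound[OF T(1)] by blast
  moreover have "x \<notin> b" using x b(1) by blast
  ultimately show False using T(2) finb by simp
qed

lemma span_monomials:
  assumes "finite E" "supp u \<subseteq> E"
  shows "u \<in> cpoly2.span ((\<lambda>(m, r). Poly_Mapping.single m (Poly_Mapping.single r 1)) ` E)"
proof -
  let ?mono = "\<lambda>(m, r). Poly_Mapping.single m (Poly_Mapping.single r (1 :: complex))"
  have "u = (\<Sum>x\<in>E. tens_scl (cf u (fst x) (snd x)) (?mono x))"
  proof (rule cf_eqI)
    fix m r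
    have *: "cf (?mono x) m r = (if x = (m, r) then 1 else 0)" for x
      by (cases x) (auto simp: cf_def lookup_single when_def)
    have "cf (\<Sum>x\<in>E. tens_scl (cf u (fst x) (snd x)) (?mono x)) m r =
        (\<Sum>x\<in>E. if x = (m, r) then cf u m r else 0)"
      unfolding cf_linear * by (rule sum.cong) auto
    also have "\<dots> = cf u m r"
      using assms by (auto simp: supp_def)
    finally show "cf u m r = cf (\<Sum>x\<in>E. tens_scl (cf u (fst x) (snd x)) (?mono x)) m r" ..
  qed
  also have "\<dots> \<in> cpoly2.span (?mono ` E)"
    by (intro cpoly2.span_sum cpoly2.span_scale cpoly2.span_base) auto
  finally show ?thesis .
qed

lemma finite_exponents:
  assumes "finite A"
  shows "finite {m :: nat \<Rightarrow>\<^sub>0 nat. Poly_Mapping.keys m \<subseteq> A \<and> (\<forall>k. Poly_Mapping.lookup m k \<le> d)}"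
proof (rule finite_imageD)
  show "finite (Poly_Mapping.lookup ` {m :: nat \<Rightarrow>\<^sub>0 nat. Poly_Mapping.keys m \<subseteq> A \<and> (\<forall>k. Poly_Mapping.lookup m k \<le> d)})"
  proof (rule finite_subset)
    show "finite {f :: nat \<Rightarrow> nat. \<forall>x. (x \<in> A \<longrightarrow> f x \<in> {..d}) \<and> (x \<notin> A \<longrightarrow> f x = 0)}"
      using assms by (intro finite_set_of_finite_funs) auto
    show "Poly_Mapping.lookup ` {m. Poly_Mapping.keys m \<subseteq> A \<and> (\<forall>k. Poly_Mapping.lookup m k \<le> d)} \<subseteq>
        {f. \<forall>x. (x \<in> A \<longrightarrow> f x \<in> {..d}) \<and> (x \<notin> A \<longrightarrow> f x = 0)}"
    proof
      fix f assume "f \<in> Poly_Mapping.lookup ` {m. Poly_Mapping.keys m \<subseteq> A \<and> (\<forall>k. Poly_Mapping.lookup m k \<le> d)}"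
      then obtain m where m: "f = Poly_Mapping.lookup m" "Poly_Mapping.keys m \<subseteq> A" "\<forall>k. Poly_Mapping.lookup m k \<le> d"
        by blast
      have "f x = 0" if "x \<notin> A" for x
        using m(1,2) that by (metis in_keys_iff subsetD)
      then show "f \<in> {f. \<forall>x. (x \<in> A \<longrightarrow> f x \<in> {..d}) \<and> (x \<notin> A \<longrightarrow> f x = 0)}"
        using m by simp
    qed
  qed
qed (rule inj_onI, rule poly_mapping_eqI, simp)

section \<open>Simplicity of the homogeneous components\<close>

definition ker_rep :: "nat \<Rightarrow> nat \<Rightarrow> nat \<Rightarrow> cpoly2 sp_rep" where
  "ker_rep n e l = \<lparr>carr = spinor_ker_deg n e l, smul = tens_scl, act = tens_act n\<rparr>"

lemma ker_rep_simps [simp]: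
  "carr (ker_rep n e l) = spinor_ker_deg n e l" "smul (ker_rep n e l) = tens_scl"
  "act (ker_rep n e l) = tens_act n"
  by (simp_all add: ker_rep_def)

lemma spinor_ker_closed:
  "0 \<in> spinor_ker n e" "u \<in> spinor_ker n e \<Longrightarrow> w \<in> spinor_ker n e \<Longrightarrow> u + w \<in> spinor_ker n e"
  "u \<in> spinor_ker n e \<Longrightarrow> tens_scl c u \<in> spinor_ker n e"
  "A \<in> sp n \<Longrightarrow> u \<in> spinor_ker n e \<Longrightarrow> tens_act n A u \<in> spinor_ker n e"
proof -
  have "tens_act n A 0 = 0" if "A \<in> sp n"
    using that by (simp add: tens_act_eq)
  then show "A \<in> sp n \<Longrightarrow> u \<in> spinor_ker n e \<Longrightarrow> tens_act n A u \<in> spinor_ker n e"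
    by (simp add: spinor_ker_def supported_restr restr_tens_act inv_pred_in_range symp_dirac_tens_act)
qed (auto simp: spinor_ker_def supported_linear)

lemma spinor_ker_deg_closed:
  "0 \<in> spinor_ker_deg n e l"
  "u \<in> spinor_ker_deg n e l \<Longrightarrow> w \<in> spinor_ker_deg n e l \<Longrightarrow> u + w \<in> spinor_ker_deg n e l"
  "u \<in> spinor_ker_deg n e l \<Longrightarrow> tens_scl c u \<in> spinor_ker_deg n e l"
  "A \<in> sp n \<Longrightarrow> u \<in> spinor_ker_deg n e l \<Longrightarrow> tens_act n A u \<in> spinor_ker_deg n e l"
  by (auto simp: spinor_ker_deg_def spinor_ker_closed supported_linear)
    (simp add: supported_restr restr_tens_act inv_pred_deg_x)

lemma tens_sp_module:
  assumes "0 \<in> K" "\<And>u w. u \<in> K \<Longrightarrow> w \<in> K \<Longrightarrow> u + w \<in> K" "\<And>c u. u \<in> K \<Longrightarrow> tens_scl c u \<in> K"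
    "\<And>A u. A \<in> sp n \<Longrightarrow> u \<in> K \<Longrightarrow> tens_act n A u \<in> K"
  shows "sp_module n \<lparr>carr = K, smul = tens_scl, act = tens_act n\<rparr>"
  by (rule sp_moduleI) (simp_all add: assms tens_act_linear tens_scl_add_left)

lemma ker_rep_sp_module: "sp_module n (ker_rep n e l)"
  unfolding ker_rep_def by (rule tens_sp_module) (auto intro: spinor_ker_deg_closed)

lemma ker_rep_submodule:
  "sp_submodule n (ker_rep n e l) W \<longleftrightarrow> W \<subseteq> spinor_ker_deg n e l \<and> 0 \<in> W \<and>
     (\<forall>u\<in>W. \<forall>w\<in>W. u + w \<in> W) \<and> (\<forall>c. \<forall>u\<in>W. tens_scl c u \<in> W) \<and> (\<forall>A\<in>sp n. \<forall>u\<in>W. tens_act n A u \<in> W)"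
  by (simp add: sp_submodule_def)

text \<open>The height of a weight, shifted so as to be nonnegative on all monomials. Root vectors of
  positive roots decrease it.\<close>
definition depth :: "nat \<Rightarrow> (nat \<Rightarrow>\<^sub>0 nat) \<Rightarrow> (nat \<Rightarrow>\<^sub>0 nat) \<Rightarrow> int" where
  "depth n m r = (\<Sum>k\<in>idx n. (int n + 1 + height n k) * int (Poly_Mapping.lookup m k)) +
     (\<Sum>j=1..n. (int n + 1 - int j) * int (Poly_Mapping.lookup r j))"

lemma depth_nonneg: "depth n m r \<ge> 0"
proof -
  have "int n + 1 + height n k \<ge> 0" if "k \<in> idx n" for k
    using that by (cases rule: idx_cases) auto
  then have "0 \<le> (\<Sum>k\<in>idx n. (int n + 1 + height n k) * int (Poly_Mapping.lookup m k))"
    by (simp add: sum_nonneg)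
  moreover have "0 \<le> (\<Sum>j=1..n. (int n + 1 - int j) * int (Poly_Mapping.lookup r j))"
    by (rule sum_nonneg) auto
  ultimately show ?thesis unfolding depth_def by simp
qed

lemma depth_unit_exp:
  "k \<in> idx n \<Longrightarrow> depth n (m + unit_exp k) r = depth n m r + (int n + 1 + height n k)"
  "j \<in> {1..n} \<Longrightarrow> depth n m (r + unit_exp j) = depth n m r + (int n + 1 - int j)"
proof -
  show "depth n (m + unit_exp k) r = depth n m r + (int n + 1 + height n k)" if k: "k \<in> idx n"
  proof -
    have "(\<Sum>i\<in>idx n. (int n + 1 + height n i) * int (Poly_Mapping.lookup (m + unit_exp k) i)) =
        (\<Sum>i\<in>idx n. (int n + 1 + height n i) * int (Poly_Mapping.lookup m i) +
          (if i = k then int n + 1 + height n i else 0))"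
      by (rule sum.cong) (auto simp: lookup_add lookup_unit_exp algebra_simps)
    then show ?thesis using k by (simp add: depth_def sum.distrib)
  qed
  show "depth n m (r + unit_exp j) = depth n m r + (int n + 1 - int j)" if j: "j \<in> {1..n}"
  proof -
    have "(\<Sum>i=1..n. (int n + 1 - int i) * int (Poly_Mapping.lookup (r + unit_exp j) i)) =
        (\<Sum>i=1..n. (int n + 1 - int i) * int (Poly_Mapping.lookup r i) +
          (if i = j then int n + 1 - int i else 0))"
      by (rule sum.cong) (auto simp: lookup_add lookup_unit_exp algebra_simps)
    then show ?thesis using j by (simp add: depth_def sum.distrib)
  qed
qed

abbreviation depth_le :: "nat \<Rightarrow> int \<Rightarrow> cpoly2 \<Rightarrow> bool" where
  "depth_le n N \<equiv> supported (\<lambda>m r. depth n m r \<le> N)"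

lemma depth_le_ops:
  assumes "depth_le n N u"
  shows "k \<in> idx n \<Longrightarrow> depth_le n (N + (int n + 1 + height n k)) (x_mul k u)"
    "k \<in> idx n \<Longrightarrow> depth_le n (N - (int n + 1 + height n k)) (x_pd k u)"
    "k \<in> idx n \<Longrightarrow> depth_le n (N - height n k) (zop2 k u)"
proof -
  have N: "depth n m r \<le> N" if "cf u m r \<noteq> 0" for m r
    using assms that by (simp add: supported_def)
  show "depth_le n (N + (int n + 1 + height n k)) (x_mul k u)" if k: "k \<in> idx n"
    unfolding supported_def
  proof (intro allI impI)
    fix m r assume "cf (x_mul k u) m r \<noteq> 0"
    then have *: "Poly_Mapping.lookup m k \<noteq> 0" "cf u (m - unit_exp k) r \<noteq> 0"
      by (auto simp: cf_x_mul split: if_splits)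
    then show "depth n m r \<le> N + (int n + 1 + height n k)"
      using N[OF *(2)] depth_unit_exp(1)[OF k, of "m - unit_exp k" r] unit_exp_diff_add[OF *(1)] by simp
  qed
  show "depth_le n (N - (int n + 1 + height n k)) (x_pd k u)" if k: "k \<in> idx n"
    unfolding supported_def
  proof (intro allI impI)
    fix m r assume "cf (x_pd k u) m r \<noteq> 0"
    then have "cf u (m + unit_exp k) r \<noteq> 0" by (auto simp: cf_x_pd)
    from N[OF this] show "depth n m r \<le> N - (int n + 1 + height n k)"
      by (simp add: depth_unit_exp(1)[OF k])
  qed
  show "depth_le n (N - height n k) (zop2 k u)" if "k \<in> idx n"
    using that
  proof (cases rule: idx_cases)
    case (even i)
    have "depth_le n (N - height n k) (q_mul i u)"
      unfolding supported_def
    proof (intro allI impI)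
      fix m r assume "cf (q_mul i u) m r \<noteq> 0"
      then have *: "Poly_Mapping.lookup r i \<noteq> 0" "cf u m (r - unit_exp i) \<noteq> 0"
        by (auto simp: cf_q_mul split: if_splits)
      then show "depth n m r \<le> N - height n k"
        using N[OF *(2)] depth_unit_exp(2)[OF even(1), of m "r - unit_exp i"] unit_exp_diff_add[OF *(1)] even
        by simp
    qed
    then show ?thesis using even by (simp add: zop2_even supported_linear)
  next
    case (odd i)
    have "depth_le n (N - height n k) (q_pd i u)"
      unfolding supported_def
    proof (intro allI impI)
      fix m r assume "cf (q_pd i u) m r \<noteq> 0"
      then have "cf u m (r + unit_exp i) \<noteq> 0" by (auto simp: cf_q_pd)
      from N[OF this] show "depth n m r \<le> N - height n k"
        using odd by (simp add: depth_unit_exp(2)[OF odd(1)])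
    qed
    then show ?thesis using odd zop2_odd[of i] by (simp add: supported_linear del: One_nat_def)
  qed
qed

text \<open>The shift n + 1 in \<open>depth\<close> cancels between multiplication and
  differentiation, so only the height of the root remains.\<close>

lemma depth_le_sym_mat:
  assumes u: "depth_le n N u" and ab: "a \<in> idx n" "b \<in> idx n"
  shows "depth_le n (N - (height n a + height n b)) (tens_act n (sym_mat n a b) u)"
proof -
  have x: "depth_le n (N - (height n a + height n b)) (x_mul (partner a) (x_pd b u))"
    if ab: "a \<in> idx n" "b \<in> idx n" for a b
    using depth_le_ops(1)[OF depth_le_ops(2)[OF u ab(2)] partner_in[OF ab(1)]] height_partner[OF ab(1)]
    by (simp add: algebra_simps)
  have z: "depth_le n (N - (height n a + height n b)) (zop2 a (zop2 b u))"
    if ab: "a \<in> idx n" "b \<in> idx n" for a b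
    using depth_le_ops(3)[OF depth_le_ops(3)[OF u ab(2)] ab(1)] by (simp add: algebra_simps)
  show ?thesis
    unfolding tens_act_sym_mat[OF ab]
    using x[OF ab] x[OF ab(2,1)] z[OF ab] z[OF ab(2,1)]
    by (intro supported_linear) (simp_all add: add.commute)
qed

text \<open>Take a nonzero element of W whose bound on the depth is minimal. A positive root vector
  would lower the bound within W, so it has to annihilate the element.\<close>

lemma exists_singular:
  assumes W: "sp_submodule n (ker_rep n e l) W" "W \<noteq> {0}"
  shows "\<exists>u\<in>W. u \<noteq> 0 \<and> singular n u"
proof -
  let ?P = "\<lambda>N. \<exists>u\<in>W. u \<noteq> 0 \<and> depth_le n (int N) u"
  obtain u0 where u0: "u0 \<in> W" "u0 \<noteq> 0" using W by (auto simp: ker_rep_submodule)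
  let ?D = "(\<lambda>(m, r). nat (depth n m r)) ` supp u0"
  have "depth_le n (int (Max ?D)) u0"
    unfolding supported_def
  proof (intro allI impI)
    fix m r assume "cf u0 m r \<noteq> 0"
    then have "nat (depth n m r) \<in> ?D" by (force simp: supp_def)
    then have "nat (depth n m r) \<le> Max ?D" by (intro Max_ge) auto
    then show "depth n m r \<le> int (Max ?D)" by linarith
  qed
  then have ex: "?P (Max ?D)" using u0 by blast
  define N where "N = (LEAST N. ?P N)"
  have "?P N" unfolding N_def by (rule LeastI[of ?P, OF ex])
  then obtain u where u: "u \<in> W" "u \<noteq> 0" "depth_le n (int N) u" by blast
  have "tens_act n (sym_mat n a b) u = 0"
    if ab: "a \<in> idx n" "b \<in> idx n" and pos: "height n a + height n b > 0" for a b
  proof (rule ccontr)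
    let ?w = "tens_act n (sym_mat n a b) u"
    assume nz: "?w \<noteq> 0"
    then obtain m r where mr: "cf ?w m r \<noteq> 0" by (metis cf_eqI cf_linear(1))
    have d: "depth_le n (int N - (height n a + height n b)) ?w" by (rule depth_le_sym_mat[OF u(3) ab])
    then have le: "0 \<le> int N - (height n a + height n b)"
      using mr depth_nonneg[of n m r] unfolding supported_def by force
    have "?w \<in> W" using W(1) u(1) sym_mat_sp[OF ab] by (simp add: ker_rep_submodule)
    then have "?P (nat (int N - (height n a + height n b)))" using nz d le by auto
    then have "N \<le> nat (int N - (height n a + height n b))"
      unfolding N_def by (rule Least_le)
    then show False using pos le by linarith
  qed
  then show ?thesis using u unfolding singular_def by blast
qed

text \<open>The eigenvalue of the sum of all \<open>cartan n i\<close>, increased by n/2. In a fixed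
  degree in x it controls the degree in q.\<close>

definition grade :: "nat \<Rightarrow> (nat \<Rightarrow>\<^sub>0 nat) \<Rightarrow> (nat \<Rightarrow>\<^sub>0 nat) \<Rightarrow> int" where
  "grade n m r = int (deg_e n m) - int (deg_f n m) - int (deg_q n r)"

lemma cf_cartan:
  assumes "i \<in> {1..n}"
  shows "cf (tens_act n (cartan n i) u) m r =
    (of_nat (Poly_Mapping.lookup m (2*i)) - of_nat (Poly_Mapping.lookup m (2*i - 1)) -
      of_nat (Poly_Mapping.lookup r i) - 1/2) * cf u m r"
  unfolding cartan_eq[OF assms] tens_act_ef[OF assms assms]
  by (simp add: cf_x_mul_x_pd cf_q_mul_q_pd left_diff_distrib)

text \<open>The operator T preserves W and is diagonal on monomials. Lagrange interpolation over the
  finitely many grades of u writes the projection as a polynomial in T.\<close>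

lemma grade_component:
  assumes W: "sp_submodule n (ker_rep n e l) W" and u: "u \<in> W"
  shows "restr (\<lambda>m r. grade n m r = c) u \<in> W"
proof -
  have W': "0 \<in> W" "\<And>u w. u \<in> W \<Longrightarrow> w \<in> W \<Longrightarrow> u + w \<in> W" "\<And>c u. u \<in> W \<Longrightarrow> tens_scl c u \<in> W"
    "\<And>A u. A \<in> sp n \<Longrightarrow> u \<in> W \<Longrightarrow> tens_act n A u \<in> W"
    using W by (auto simp: ker_rep_submodule)
  have sumW: "(\<Sum>i\<in>I. f i) \<in> W" if "\<And>i. i \<in> I \<Longrightarrow> f i \<in> W" for f :: "nat \<Rightarrow> cpoly2" and I
    using that by (induction I rule: infinite_finite_induct) (auto intro: W')
  define T where "T w = (\<Sum>i=1..n. tens_act n (cartan n i) w) + tens_scl (of_nat n / 2) w" for w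
  have T: "T w \<in> W" if "w \<in> W" for w
    unfolding T_def using that cartan_eq by (intro W'(2,3,4) sumW) auto
  have cfT: "cf (T w) m r = of_int (grade n m r) * cf w m r" for w m r
  proof -
    have "cf (T w) m r = (\<Sum>i=1..n. (of_nat (Poly_Mapping.lookup m (2*i)) -
        of_nat (Poly_Mapping.lookup m (2*i - 1)) - of_nat (Poly_Mapping.lookup r i) - 1/2) * cf w m r) +
        of_nat n / 2 * cf w m r"
      unfolding T_def cf_linear by (simp only: cf_cartan cong: sum.cong)
    also have "\<dots> = of_int (grade n m r) * cf w m r"
      unfolding sum_distrib_right[symmetric]
      by (simp add: grade_def deg_e_def deg_f_def deg_q_def sum_subtractf left_diff_distrib)
    finally show ?thesis .
  qed
  have prod: "\<exists>w\<in>W. \<forall>m r. cf w m r = (\<Prod>d\<in>C. of_int (grade n m r - d)) * cf u m r" if "finite C" for C :: "int set"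
    using that
  proof (induction C rule: finite_induct)
    case empty
    then show ?case using u by auto
  next
    case (insert d C)
    then obtain w where w: "w \<in> W" "\<forall>m r. cf w m r = (\<Prod>d\<in>C. of_int (grade n m r - d)) * cf u m r" by blast
    have "T w + tens_scl (- of_int d) w \<in> W" using w T W' by blast
    moreover have "cf (T w + tens_scl (- of_int d) w) m r = (\<Prod>d\<in>insert d C. of_int (grade n m r - d)) * cf u m r" for m r
      using insert.hyps w(2) by (simp add: cfT algebra_simps)
    ultimately show ?case by blast
  qed
  \<comment> \<open>All grades occurring in \<open>u\<close> except c: the product over them is
    nonzero at c and vanishes at the others.\<close>
  let ?C = "(\<lambda>(m, r). grade n m r) ` supp u - {c}"
  obtain w where w: "w \<in> W" "\<And>m r. cf w m r = (\<Prod>d\<in>?C. of_int (grade n m r - d)) * cf u m r"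
    using prod[of ?C] by auto
  let ?p = "(\<Prod>d\<in>?C. of_int (c - d)) :: complex"
  have p: "?p \<noteq> 0" by simp
  have "restr (\<lambda>m r. grade n m r = c) u = tens_scl (inverse ?p) w"
  proof (rule cf_eqI)
    fix m r
    show "cf (restr (\<lambda>m r. grade n m r = c) u) m r = cf (tens_scl (inverse ?p) w) m r"
    proof (cases "grade n m r = c \<or> cf u m r = 0")
      case True
      then show ?thesis using p by (auto simp: cf_restr w(2))
    next
      case False
      then have "grade n m r \<in> ?C" by (force simp: supp_def)
      then have "(\<Prod>d\<in>?C. of_int (grade n m r - d)) = (0 :: complex)"
        by (intro prod_zero) (auto intro!: bexI[of _ "grade n m r"])
      then show ?thesis using False by (simp add: cf_restr w(2))
    qed
  qed
  then show ?thesis using W'(3)[OF w(1)] by simp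
qed

text \<open>The degree in q equals the degree in the b_j minus that in the a_j minus c, hence it is
  at most l - c; all exponents are therefore bounded.\<close>

lemma finite_grade:
  "finite {(m, r). in_range n e m r \<and> deg_x n m = l \<and> grade n m r = c}"
proof (rule finite_subset)
  let ?A = "{m. Poly_Mapping.keys m \<subseteq> idx n \<and> (\<forall>k. Poly_Mapping.lookup m k \<le> l)}"
  let ?B = "{r. Poly_Mapping.keys r \<subseteq> {1..n} \<and> (\<forall>k. Poly_Mapping.lookup r k \<le> nat (int l - c))}"
  show "finite (?A \<times> ?B)" by (intro finite_cartesian_product finite_exponents) auto
  show "{(m, r). in_range n e m r \<and> deg_x n m = l \<and> grade n m r = c} \<subseteq> ?A \<times> ?B"
  proof
    fix x assume "x \<in> {(m, r). in_range n e m r \<and> deg_x n m = l \<and> grade n m r = c}"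
    then obtain m r where x: "x = (m, r)" and *: "in_range n e m r" "deg_x n m = l" "grade n m r = c"
      by blast
    have k: "Poly_Mapping.keys m \<subseteq> idx n" "Poly_Mapping.keys r \<subseteq> {1..n}"
      using *(1) by (auto simp: in_range_def)
    have bound_m: "Poly_Mapping.lookup m k \<le> l" for k
    proof (cases "k \<in> idx n")
      case True
      then show ?thesis
        using *(2) member_le_sum[of k "idx n" "Poly_Mapping.lookup m"] by (simp add: deg_x_def)
    next
      case False
      then have "Poly_Mapping.lookup m k = 0" using k(1) by (metis in_keys_iff subsetD)
      then show ?thesis by simp
    qed
    have q: "deg_q n r \<le> nat (int l - c)"
      using *(2,3) deg_x_split[of n m] by (simp add: grade_def)
    have bound_r: "Poly_Mapping.lookup r k \<le> nat (int l - c)" for k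
    proof (cases "k \<in> {1..n}")
      case True
      then have "Poly_Mapping.lookup r k \<le> deg_q n r"
        unfolding deg_q_def by (intro member_le_sum) auto
      then show ?thesis using q by simp
    next
      case False
      then have "Poly_Mapping.lookup r k = 0" using k(2) by (metis in_keys_iff subsetD)
      then show ?thesis by simp
    qed
    show "x \<in> ?A \<times> ?B" using x k bound_m bound_r by blast
  qed
qed

lemma restr_grade_ker:
  assumes u: "u \<in> spinor_ker_deg n e l"
  shows "restr (\<lambda>m r. grade n m r = c) u \<in> spinor_ker_deg n e l"
proof -
  have "sp_submodule n (ker_rep n e l) (spinor_ker_deg n e l)"
    by (auto simp: ker_rep_submodule spinor_ker_deg_closed)
  then show ?thesis using grade_component u by blast
qed

text \<open>A proper submodule containing the highest weight vector would have a nonzero orthogonal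
  complement. The complement contains a singular vector, which is the highest weight vector up
  to a scalar; but this vector is not isotropic.\<close>
lemma ker_rep_generated:
  assumes n: "n \<ge> 2" and e: "e = 0 \<or> e = 1"
    and W: "sp_submodule n (ker_rep n e l) W" and v: "hw_vec n e l \<in> W"
  shows "W = spinor_ker_deg n e l"
proof (rule ccontr)
  let ?K = "spinor_ker_deg n e l"
  assume neq: "W \<noteq> ?K"
  have W': "W \<subseteq> ?K" "0 \<in> W" "\<And>u w. u \<in> W \<Longrightarrow> w \<in> W \<Longrightarrow> u + w \<in> W" "\<And>c u. u \<in> W \<Longrightarrow> tens_scl c u \<in> W"
    "\<And>A u. A \<in> sp n \<Longrightarrow> u \<in> W \<Longrightarrow> tens_act n A u \<in> W"
    using W by (auto simp: ker_rep_submodule)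
  let ?g = "\<lambda>c. restr (\<lambda>m r. grade n m r = c)"
  obtain u0 where u0: "u0 \<in> ?K" "u0 \<notin> W" using neq W' by blast
  \<comment> \<open>Since \<open>u0\<close> is the sum of its grade components, one of them lies
    outside W. This moves the failure into a finite-dimensional space.\<close>
  have "\<exists>c. ?g c u0 \<notin> W"
  proof (rule ccontr)
    assume "\<not> ?thesis"
    then have all: "?g c u0 \<in> W" for c by blast
    let ?C = "(\<lambda>(m, r). grade n m r) ` supp u0"
    have "(\<Sum>c\<in>C. ?g c u0) \<in> W" for C :: "int set"
      by (induction C rule: infinite_finite_induct) (auto intro: W' all)
    moreover have "(\<Sum>c\<in>?C. ?g c u0) = u0"
    proof (rule cf_eqI)
      fix m r
      have "cf (\<Sum>c\<in>?C. ?g c u0) m r = (\<Sum>c\<in>?C. if c = grade n m r then cf u0 m r else 0)"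
        unfolding cf_linear by (rule sum.cong) (auto simp: cf_restr)
      also have "\<dots> = cf u0 m r"
      proof (subst sum.delta)
        have "(m, r) \<in> supp u0 \<Longrightarrow> grade n m r \<in> ?C" by (rule image_eqI) auto
        then show "(if grade n m r \<in> ?C then cf u0 m r else 0) = cf u0 m r"
          by (auto simp: supp_def)
      qed simp
      finally show "cf (\<Sum>c\<in>?C. ?g c u0) m r = cf u0 m r" .
    qed
    ultimately show False using u0 by metis
  qed
  then obtain c where c: "?g c u0 \<notin> W" by blast
  let ?S = "{u. supported (\<lambda>m r. grade n m r = c) u}"
  have sub: "cpoly2.subspace (W \<inter> ?S)" "cpoly2.subspace (?K \<inter> ?S)"
    using W' by (auto simp: cpoly2.subspace_def spinor_ker_deg_closed supported_linear)
  have gK: "?g c u \<in> ?K \<inter> ?S" if "u \<in> ?K" for u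
    using restr_grade_ker[OF that] by (simp add: supported_restr_self)
  let ?E = "{(m, r). in_range n e m r \<and> deg_x n m = l \<and> grade n m r = c}"
  let ?mono = "(\<lambda>(m, r). Poly_Mapping.single m (Poly_Mapping.single r 1)) ` ?E :: cpoly2 set"
  have fin: "?K \<inter> ?S \<subseteq> cpoly2.span ?mono"
  proof
    fix u assume "u \<in> ?K \<inter> ?S"
    then have "supp u \<subseteq> ?E"
      by (auto simp: spinor_ker_deg_def spinor_ker_def supported_def supp_def)
    then show "u \<in> cpoly2.span ?mono" by (rule span_monomials[OF finite_grade])
  qed
  have "\<exists>u\<in>?K \<inter> ?S. u \<noteq> 0 \<and> (\<forall>w\<in>W \<inter> ?S. pairing n w u = 0)"
  proof (rule exists_orthogonal[OF sub _ _ finite_imageI[OF finite_grade] fin])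
    show "W \<inter> ?S \<subseteq> ?K \<inter> ?S" using W' by blast
    show "W \<inter> ?S \<noteq> ?K \<inter> ?S" using c gK[OF u0(1)] by blast
  qed
  then obtain u where u: "u \<in> ?K" "u \<in> ?S" "u \<noteq> 0" "\<And>w. w \<in> W \<Longrightarrow> w \<in> ?S \<Longrightarrow> pairing n w u = 0"
    by blast
  \<comment> \<open>Different grades are orthogonal because the form is diagonal on monomials, so
    orthogonality to the part of W in grade c extends to W.\<close>
  have uW: "pairing n u w = 0" if "w \<in> W" for w
  proof -
    have "pairing n u w = pairing n u (?g c w)"
      unfolding pairing_def
      by (rule sum.cong) (use u(2) in \<open>auto simp: cf_restr supp_def supported_def\<close>)
    also have "\<dots> = pairing n (?g c w) u" by (rule pairing_commute)
    also have "\<dots> = 0"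
      using u(4) grade_component[OF W that] by (simp add: supported_restr_self)
    finally show ?thesis .
  qed
  \<comment> \<open>Contravariance together with stability of W under \<open>adj_mat n A\<close>
    makes this complement a submodule.\<close>
  let ?O = "{u \<in> ?K. \<forall>w\<in>W. pairing n u w = 0}"
  have "sp_submodule n (ker_rep n e l) ?O"
    unfolding ker_rep_submodule
  proof (intro conjI ballI allI)
    show "0 \<in> ?O"
      by (simp add: spinor_ker_deg_closed pairing_linear_left)
    show "x + y \<in> ?O" if "x \<in> ?O" "y \<in> ?O" for x y
      using that by (auto simp: spinor_ker_deg_closed pairing_linear_left)
    show "tens_scl d x \<in> ?O" if "x \<in> ?O" for d x
      using that by (simp add: spinor_ker_deg_closed pairing_linear_left)
    show "tens_act n A x \<in> ?O" if "A \<in> sp n" "x \<in> ?O" for A x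
      using that W'(5)[OF adj_mat_sp] by (simp add: spinor_ker_deg_closed pairing_tens_act)
  qed auto
  moreover have "?O \<noteq> {0}" using u uW by blast
  ultimately obtain x where x: "x \<in> ?O" "x \<noteq> 0" "singular n x"
    using exists_singular by blast
  let ?d = "cf x (Poly_Mapping.single 2 l) (hw_exp n e)"
  have xv: "x = tens_scl ?d (hw_vec n e l)"
    using singular_unique[OF n e _ x(3)] x(1) by blast
  then have "?d \<noteq> 0" using x(2) by auto
  have "supp (hw_vec n e l) = {(Poly_Mapping.single 2 l, hw_exp n e)}"
    by (auto simp: supp_def cf_hw_vec)
  then have "pairing n (hw_vec n e l) x = weight_coeff n (Poly_Mapping.single 2 l) (hw_exp n e) * ?d"
    by (simp add: pairing_def cf_hw_vec)
  moreover have "pairing n (hw_vec n e l) x = 0"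
    using x(1) v pairing_commute[of n "hw_vec n e l" x] by simp
  ultimately show False using \<open>?d \<noteq> 0\<close> weight_coeff_nonzero by simp
qed

section \<open>The highest weight vector and its weight\<close>

lemma hw_vec_ops:
  assumes "n \<ge> 2"
  shows "k \<noteq> 2 \<Longrightarrow> x_pd k (hw_vec n e l) = 0" "j \<noteq> n \<or> e = 0 \<Longrightarrow> q_pd j (hw_vec n e l) = 0"
    "q_pd i (q_pd j (hw_vec n e l)) = 0"
proof -
  show "x_pd k (hw_vec n e l) = 0" if "k \<noteq> 2"
  proof (rule cf_eqI)
    fix m r
    have "m + unit_exp k \<noteq> Poly_Mapping.single 2 l"
    proof
      assume "m + unit_exp k = Poly_Mapping.single 2 l"
      then have "Poly_Mapping.lookup (m + unit_exp k) k = Poly_Mapping.lookup (Poly_Mapping.single 2 l) k" by simp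
      then show False using that by (simp add: lookup_add lookup_unit_exp lookup_single)
    qed
    then show "cf (x_pd k (hw_vec n e l)) m r = cf 0 m r" by (simp add: cf_x_pd cf_hw_vec)
  qed
  show "q_pd j (hw_vec n e l) = 0" if "j \<noteq> n \<or> e = 0"
  proof (rule cf_eqI)
    fix m r
    have "r + unit_exp j \<noteq> hw_exp n e"
    proof
      assume "r + unit_exp j = hw_exp n e"
      then have "Poly_Mapping.lookup (r + unit_exp j) j = Poly_Mapping.lookup (hw_exp n e) j" by simp
      then show False using that by (simp add: hw_exp_def lookup_add lookup_unit_exp split: if_splits)
    qed
    then show "cf (q_pd j (hw_vec n e l)) m r = cf 0 m r" by (simp add: cf_q_pd cf_hw_vec)
  qed
  show "q_pd i (q_pd j (hw_vec n e l)) = 0"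
  proof (rule cf_eqI)
    fix m r
    have "r + unit_exp i + unit_exp j \<noteq> hw_exp n e"
    proof
      assume *: "r + unit_exp i + unit_exp j = hw_exp n e"
      have "Poly_Mapping.lookup (r + unit_exp i + unit_exp j) i = Poly_Mapping.lookup (hw_exp n e) i"
        "Poly_Mapping.lookup (r + unit_exp i + unit_exp j) j = Poly_Mapping.lookup (hw_exp n e) j"
        by (simp_all only: *)
      then show False by (auto simp: hw_exp_def lookup_add lookup_unit_exp split: if_splits)
    qed
    then show "cf (q_pd i (q_pd j (hw_vec n e l))) m r = cf 0 m r" by (simp add: cf_q_pd cf_hw_vec)
  qed
qed

text \<open>Both sums in D vanish term by term: no a_j occurs, for j = 1 the variable q_1 does not
  occur since n \<ge> 2, and for other j the variable b_j does not.\<close>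

lemma hw_vec_ker:
  assumes n: "n \<ge> 2" and e: "e = 0 \<or> e = 1"
  shows "hw_vec n e l \<in> spinor_ker_deg n e l"
proof -
  have "deg_q n (hw_exp n e) = e"
    using e n by (auto simp: deg_q_def hw_exp_def lookup_unit_exp)
  moreover have "2 \<in> idx n" using n by (simp add: idx_def)
  ultimately have "in_range n e (Poly_Mapping.single 2 l) (hw_exp n e)"
    "deg_x n (Poly_Mapping.single 2 l) = l"
    using e n by (auto simp: in_range_def hw_exp_def unit_exp_def deg_x_def lookup_single when_def)
  moreover have "symp_dirac n (hw_vec n e l) = 0"
    unfolding symp_dirac_eq_0
  proof (rule sum.cong[OF refl])
    fix j assume j: "j \<in> {1..n}"
    have "x_pd (2*j - 1) (q_mul j (hw_vec n e l)) = 0"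
    proof -
      have ne: "2*j - 1 \<noteq> 2" by presburger
      show ?thesis by (simp only: ops_commute(6)[symmetric] hw_vec_ops(1)[OF n ne] q_mul_linear(1))
    qed
    moreover have "x_pd (2*j) (q_pd j (hw_vec n e l)) = 0"
    proof (cases "j = 1")
      case True
      then show ?thesis using hw_vec_ops(2)[OF n, of j e l] n by simp
    next
      case False
      then have ne: "2*j \<noteq> 2" by simp
      show ?thesis by (simp only: ops_commute(8)[symmetric] hw_vec_ops(1)[OF n ne] q_pd_linear(1))
    qed
    ultimately show "x_pd (2*j - 1) (q_mul j (hw_vec n e l)) = x_pd (2*j) (q_pd j (hw_vec n e l))" by simp
  qed
  ultimately show ?thesis
    by (auto simp: spinor_ker_deg_def spinor_ker_def supported_def cf_hw_vec split: if_splits)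
qed

text \<open>The weight of b_1^l for e = 0 and of b_1^l q_n for e = 1; the -1/2 in every coordinate
  stems from the symmetrised Cartan operators.\<close>

definition hw_weight :: "nat \<Rightarrow> nat \<Rightarrow> nat \<Rightarrow> nat \<Rightarrow> complex" where
  "hw_weight n e l j = (if j = 1 then of_nat l else 0) - (if j = n \<and> e \<noteq> 0 then 1 else 0) - 1/2"

lemma hw_vec_highest:
  assumes n: "n \<ge> 2" and e: "e = 0 \<or> e = 1" and \<mu>: "\<And>j. j \<in> {1..n} \<Longrightarrow> \<mu> j = hw_weight n e l j"
  shows "highest_weight_vector n \<mu> (ker_rep n e l) (hw_vec n e l)"
proof -
  let ?v = "hw_vec n e l"
  have "cf ?v (Poly_Mapping.single 2 l) (hw_exp n e) \<noteq> 0" by (simp add: cf_hw_vec)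
  then have nz: "?v \<noteq> 0" by auto
  have cart: "tens_act n (cartan n i) ?v = tens_scl (\<mu> i) ?v" if i: "i \<in> {1..n}" for i
  proof (rule cf_eqI)
    fix m r
    have "2*i - 1 \<noteq> (2::nat)" "2*i = 2 \<longleftrightarrow> i = 1" by presburger+
    then show "cf (tens_act n (cartan n i) ?v) m r = cf (tens_scl (\<mu> i) ?v) m r"
      unfolding cf_cartan[OF i] \<mu>[OF i]
      by (auto simp: cf_hw_vec hw_weight_def hw_exp_def lookup_single when_def lookup_unit_exp)
  qed
  have root: "tens_act n (simple_root_vec n i) ?v = 0" if i: "i \<in> {1..n}" for i
  proof -
    have s: "tens_act n ((- 1) \<cdot>\<^sub>m A) ?v = 0" if "A \<in> sp n" "tens_act n A ?v = 0" for A
      using tens_act_linear(4)[OF that(1) that(1), of "- 1" ?v] that(2) by simp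
    show ?thesis
    proof (cases "i < n")
      case True
      have i1: "i + 1 \<in> {1..n}" using True by simp
      have ne: "2*(i+1) \<noteq> 2" "2*i - 1 \<noteq> (2::nat)" using i by (simp, presburger)
      have "tens_act n (sym_mat n (2*(i+1)) (2*i - 1)) ?v = 0"
        unfolding tens_act_ef[OF i1 i] using True
        by (simp only: hw_vec_ops(1)[OF n ne(1)] hw_vec_ops(1)[OF n ne(2)] hw_vec_ops(2)[OF n disjI1[OF less_imp_neq[OF True]]] x_mul_linear q_mul_linear) simp
      then show ?thesis
        unfolding simple_root_vec_eq[OF i]
        using s[OF sym_mat_sp[OF idx_intros(1)[OF i1] idx_intros(2)[OF i]]] True by (simp only: if_True)
    next
      case False
      have nn: "n \<in> {1..n}" using n by simp
      have ne: "2*n - 1 \<noteq> (2::nat)" by presburger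
      have "tens_act n (sym_mat n (2*n - 1) (2*n - 1)) ?v = 0"
        unfolding tens_act_ff[OF nn nn]
        by (simp only: hw_vec_ops(1)[OF n ne] hw_vec_ops(3)[OF n] x_mul_linear) simp
      then show ?thesis
        unfolding simple_root_vec_eq[OF i]
        using s[OF sym_mat_sp[OF idx_intros(2)[OF nn] idx_intros(2)[OF nn]]] False by (simp only: if_False)
    qed
  qed
  show ?thesis
    unfolding highest_weight_vector_def ker_rep_simps using hw_vec_ker[OF n e] nz cart root by blast
qed

lemma ker_rep_highest_weight_module:
  assumes "n \<ge> 2" "e = 0 \<or> e = 1" "\<And>j. j \<in> {1..n} \<Longrightarrow> \<mu> j = hw_weight n e l j"
  shows "highest_weight_module n \<mu> (ker_rep n e l)"
  unfolding highest_weight_module_def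
  using ker_rep_sp_module hw_vec_highest[OF assms] ker_rep_generated[OF assms(1,2)] by auto

lemma ker_rep_simple:
  assumes n: "n \<ge> 2" and e: "e = 0 \<or> e = 1"
  shows "simple_module n (ker_rep n e l)"
  unfolding simple_module_def
proof (intro conjI allI impI ker_rep_sp_module)
  have "hw_vec n e l \<noteq> 0"
    using hw_vec_highest[OF n e, of "hw_weight n e l"] by (simp add: highest_weight_vector_def)
  then show "carr (ker_rep n e l) \<noteq> {0}" using hw_vec_ker[OF n e] by auto
next
  fix W assume W: "sp_submodule n (ker_rep n e l) W"
  show "W = {0} \<or> W = carr (ker_rep n e l)"
  proof (cases "W = {0}")
    case False
    obtain x where x: "x \<in> W" "x \<noteq> 0" "singular n x"
      using exists_singular[OF W False] by blast
    let ?d = "cf x (Poly_Mapping.single 2 l) (hw_exp n e)"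
    have "x \<in> spinor_ker_deg n e l" using W x(1) by (auto simp: ker_rep_submodule)
    then have xv: "x = tens_scl ?d (hw_vec n e l)" by (rule singular_unique[OF n e _ x(3)])
    then have d: "?d \<noteq> 0" using x(2) by auto
    have "tens_scl (inverse ?d) x \<in> W" using W x(1) by (simp add: ker_rep_submodule)
    moreover have "tens_scl (inverse ?d) x = hw_vec n e l"
      using d by (subst xv) simp
    ultimately show ?thesis using ker_rep_generated[OF n e W] by simp
  qed simp
qed

section \<open>The decomposition\<close>

text \<open>The number of the finite graph of \<open>m\<close> over its support, via the codings of
  pairs and of finite sets.\<close>

definition exp_encode :: "(nat \<Rightarrow>\<^sub>0 nat) \<Rightarrow> nat" where
  "exp_encode m = set_encode ((\<lambda>k. prod_encode (k, Poly_Mapping.lookup m k)) ` Poly_Mapping.keys m)"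

lemma inj_exp_encode: "inj exp_encode"
proof (rule injI)
  fix m m' assume "exp_encode m = exp_encode m'"
  then have eq: "(\<lambda>k. prod_encode (k, Poly_Mapping.lookup m k)) ` Poly_Mapping.keys m =
      (\<lambda>k. prod_encode (k, Poly_Mapping.lookup m' k)) ` Poly_Mapping.keys m'"
    by (simp add: exp_encode_def set_encode_eq)
  have *: "prod_encode (k, c) \<in> (\<lambda>k. prod_encode (k, Poly_Mapping.lookup m k)) ` Poly_Mapping.keys m \<longleftrightarrow>
      c \<noteq> 0 \<and> Poly_Mapping.lookup m k = c" for k c m
    by (auto simp: in_keys_iff)
  have "c \<noteq> 0 \<and> Poly_Mapping.lookup m k = c \<longleftrightarrow> c \<noteq> 0 \<and> Poly_Mapping.lookup m' k = c" for k c
    using eq * by metis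
  then show "m = m'"
    by (intro poly_mapping_eqI) metis
qed

text \<open>Numbering the monomials x^m q^r carries spinor-valued polynomials into the type on which
  \<open>L\<close> is chosen, as required by \<open>sp_iso_L\<close>.\<close>

lemma exists_additive_injection:
  "\<exists>\<phi> :: cpoly2 \<Rightarrow> nat \<Rightarrow>\<^sub>0 complex. inj \<phi> \<and> (\<forall>u w. \<phi> (u + w) = \<phi> u + \<phi> w)"
proof -
  define code where "code x = prod_encode (exp_encode (fst x), exp_encode (snd x))"
    for x :: "(nat \<Rightarrow>\<^sub>0 nat) \<times> (nat \<Rightarrow>\<^sub>0 nat)"
  have code: "inj code"
    unfolding code_def by (rule injI) (auto simp: prod_eq_iff dest: injD[OF inj_exp_encode])
  define f where "f u N = (if N \<in> range code then cf u (fst (inv_into UNIV code N)) (snd (inv_into UNIV code N)) else 0)" for u N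
  have f: "f u (code (m, r)) = cf u m r" for u m r
    using code by (simp add: f_def)
  define \<phi> where "\<phi> u = Abs_poly_mapping (f u)" for u
  have lookup: "Poly_Mapping.lookup (\<phi> u) = f u" for u
  proof -
    have "{N. f u N \<noteq> 0} \<subseteq> code ` supp u"
    proof
      fix N assume "N \<in> {N. f u N \<noteq> 0}"
      then obtain m r where "N = code (m, r)" "f u N \<noteq> 0"
        by (auto simp: f_def split: if_splits)
      then show "N \<in> code ` supp u" by (auto simp: f supp_def)
    qed
    then have "finite {N. f u N \<noteq> 0}" using finite_surj finite_supp by blast
    then show ?thesis by (simp add: \<phi>_def)
  qed
  have "inj \<phi>"
  proof (rule injI)
    fix u w assume "\<phi> u = \<phi> w"
    then have "f u = f w" by (metis lookup)
    then show "u = w" by (intro cf_eqI) (metis f)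
  qed
  moreover have "\<phi> (u + w) = \<phi> u + \<phi> w" for u w
    by (rule poly_mapping_eqI) (simp add: lookup lookup_add f_def)
  ultimately show ?thesis by blast
qed

lemma ker_rep_iso_L:
  assumes "n \<ge> 2" "e = 0 \<or> e = 1" "\<And>j. j \<in> {1..n} \<Longrightarrow> \<mu> j = hw_weight n e l j"
  shows "sp_iso n (ker_rep n e l) (L n \<mu>)"
proof -
  obtain \<phi> :: "cpoly2 \<Rightarrow> nat \<Rightarrow>\<^sub>0 complex" where \<phi>: "inj \<phi>" "\<And>u w. \<phi> (u + w) = \<phi> u + \<phi> w"
    using exists_additive_injection by blast
  show ?thesis
    by (rule sp_iso_L[OF ker_rep_simple[OF assms(1,2)] ker_rep_highest_weight_module[OF assms]
          inj_on_subset[OF \<phi>(1) subset_UNIV] \<phi>(2)])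
qed

lemma spinor_ker_decomposition:
  assumes n: "n \<ge> 2" and e: "e = 0 \<or> e = 1"
    and \<mu>: "\<And>l j. j \<in> {1..n} \<Longrightarrow> \<mu> l j = hw_weight n e l j"
  shows "sp_iso n \<lparr>carr = spinor_ker n e, smul = tens_scl, act = tens_act n\<rparr>
    (dsum (\<lambda>l. dsum2 (L n (\<mu> (2*l))) (L n (\<mu> (2*l+1)))))"
proof -
  let ?K = "\<lparr>carr = spinor_ker n e, smul = tens_scl, act = tens_act n\<rparr>"
  let ?p = "\<lambda>l. restr (\<lambda>m r. deg_x n m = l)"
  show ?thesis
  proof (rule sp_iso_dsum[where Kc = "spinor_ker_deg n e" and \<pi> = ?p])
    show "sp_module n ?K" by (rule tens_sp_module) (auto intro: spinor_ker_closed)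
    show "sp_iso n \<lparr>carr = spinor_ker_deg n e (2*l), smul = smul ?K, act = act ?K\<rparr> (L n (\<mu> (2*l)))" for l
      using ker_rep_iso_L[OF n e \<mu>, of "2*l"] by (simp add: ker_rep_def)
    show "sp_iso n \<lparr>carr = spinor_ker_deg n e (2*l+1), smul = smul ?K, act = act ?K\<rparr> (L n (\<mu> (2*l+1)))" for l
      using ker_rep_iso_L[OF n e \<mu>, of "2*l+1"] by (simp add: ker_rep_def)
    show "spinor_ker_deg n e l \<subseteq> carr ?K" for l by (auto simp: spinor_ker_deg_def)
    show "?p l u \<in> spinor_ker_deg n e l" if "u \<in> carr ?K" for l u
    proof -
      have u: "supported (in_range n e) u" "symp_dirac n u = 0"
        using that by (auto simp: spinor_ker_def)
      \<comment> \<open>The degree l of u corresponds to degree l - 1 of D u. With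
        \<open>Suc\<close> on the degree the case l = 0 is included: the predicate is then false
        everywhere.\<close>
      have "symp_dirac n (?p l u) = restr (\<lambda>m r. Suc (deg_x n m) = l) (symp_dirac n u)"
        by (rule restr_symp_dirac[symmetric]) (simp add: deg_unit_exp)
      moreover have "supported (in_range n e) (?p l u)"
        using u(1) by (auto simp: supported_def cf_restr)
      ultimately show ?thesis
        using u(2) by (simp add: spinor_ker_deg_def spinor_ker_def supported_restr_self)
    qed
    show "?p l (act ?K X u) = act ?K X (?p l u)" if "X \<in> sp n" for l X u
      using restr_tens_act[OF inv_pred_deg_x that] by simp
    show "finite {l. ?p l u \<noteq> 0}" for u
    proof (rule finite_subset)
      show "{l. ?p l u \<noteq> 0} \<subseteq> (\<lambda>(m, r). deg_x n m) ` supp u"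
      proof
        fix l assume "l \<in> {l. ?p l u \<noteq> 0}"
        then obtain m r where "cf (?p l u) m r \<noteq> 0" by (metis (mono_tags) cf_eqI cf_linear(1) mem_Collect_eq)
        then have "(m, r) \<in> supp u" "l = deg_x n m" by (auto simp: cf_restr supp_def split: if_splits)
        then show "l \<in> (\<lambda>(m, r). deg_x n m) ` supp u" by (auto intro: image_eqI[of _ _ "(m, r)"])
      qed
    qed simp
    show "u = w" if "\<And>l. ?p l u = ?p l w" for u w
    proof (rule cf_eqI)
      fix m r
      have "cf (?p (deg_x n m) u) m r = cf (?p (deg_x n m) w) m r" by (simp only: that)
      then show "cf u m r = cf w m r" by (simp add: cf_restr)
    qed
    show "?p l' u = (if l = l' then u else 0)" if "u \<in> spinor_ker_deg n e l" for l l' u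
      using that by (intro cf_eqI) (auto simp: cf_restr spinor_ker_deg_def supported_def)
  qed simp_all
qed

section \<open>Comparison with the even and odd valued polynomials, and the conclusion\<close>

lemma valued_polys_supported:
  assumes "\<And>p. p \<in> S \<longleftrightarrow> p \<in> polys n \<and> (\<forall>m\<in>Poly_Mapping.keys p. deg_q n m mod 2 = e)"
  shows "u \<in> valued_polys (2*n) S \<longleftrightarrow> supported (in_range n e) u"
proof
  assume u: "u \<in> valued_polys (2*n) S"
  show "supported (in_range n e) u"
    unfolding supported_def
  proof (intro allI impI)
    fix m r assume c: "cf u m r \<noteq> 0"
    then have "m \<in> Poly_Mapping.keys u" "r \<in> Poly_Mapping.keys (Poly_Mapping.lookup u m)"
      by (auto simp: cf_def in_keys_iff)
    then show "in_range n e m r"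
      using u by (auto simp: valued_polys_def assms in_range_def idx_def polys_def)
  qed
next
  assume u: "supported (in_range n e) u"
  have *: "in_range n e m r" if "r \<in> Poly_Mapping.keys (Poly_Mapping.lookup u m)" for m r
    using u that by (simp add: supported_def cf_def in_keys_iff)
  show "u \<in> valued_polys (2*n) S"
    unfolding valued_polys_def
  proof (intro CollectI ballI conjI)
    fix m assume "m \<in> Poly_Mapping.keys u"
    then obtain r where "r \<in> Poly_Mapping.keys (Poly_Mapping.lookup u m)"
      by (metis in_keys_iff keys_eq_empty all_not_in_conv)
    then show "Poly_Mapping.keys m \<subseteq> {1..2*n}" using * by (auto simp: in_range_def idx_def)
    show "Poly_Mapping.lookup u m \<in> S"
      using * by (auto simp: assms polys_def in_range_def)
  qed
qed

lemma Ker_eq: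
  "Ker_plus n = \<lparr>carr = spinor_ker n 0, smul = tens_scl, act = tens_act n\<rparr>"
  "Ker_minus n = \<lparr>carr = spinor_ker n 1, smul = tens_scl, act = tens_act n\<rparr>"
proof -
  have "u \<in> valued_polys (2*n) (ssw_even n) \<longleftrightarrow> supported (in_range n 0) u" for u
    by (rule valued_polys_supported) (auto simp: ssw_even_def deg_q_def even_iff_mod_2_eq_zero)
  then show "Ker_plus n = \<lparr>carr = spinor_ker n 0, smul = tens_scl, act = tens_act n\<rparr>"
    by (simp add: Ker_plus_def spinor_ker_def)
  have "u \<in> valued_polys (2*n) (ssw_odd n) \<longleftrightarrow> supported (in_range n 1) u" for u
    by (rule valued_polys_supported) (auto simp: ssw_odd_def deg_q_def odd_iff_mod_2_eq_one)
  then show "Ker_minus n = \<lparr>carr = spinor_ker n 1, smul = tens_scl, act = tens_act n\<rparr>"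
    by (simp add: Ker_minus_def spinor_ker_def)
qed

theorem corollary5p5:
  fixes n :: nat
  assumes "n \<ge> 2"
  shows "sp_iso n (Ker_plus n)
           (dsum (\<lambda>l. dsum2
              (L n (\<lambda>j. of_nat (2*l) * fund_weight 1 j - 1/2 * fund_weight n j))
              (L n (\<lambda>j. of_nat (2*l+1) * fund_weight 1 j - 1/2 * fund_weight n j))))
       \<and> sp_iso n (Ker_minus n)
           (dsum (\<lambda>l. dsum2
              (L n (\<lambda>j. of_nat (2*l) * fund_weight 1 j + fund_weight (n-1) j - 3/2 * fund_weight n j))
              (L n (\<lambda>j. of_nat (2*l+1) * fund_weight 1 j + fund_weight (n-1) j - 3/2 * fund_weight n j))))"
  unfolding Ker_eq
proof
  show "sp_iso n \<lparr>carr = spinor_ker n 0, smul = tens_scl, act = tens_act n\<rparr>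
           (dsum (\<lambda>l. dsum2
              (L n (\<lambda>j. of_nat (2*l) * fund_weight 1 j - 1/2 * fund_weight n j))
              (L n (\<lambda>j. of_nat (2*l+1) * fund_weight 1 j - 1/2 * fund_weight n j))))"
    \<comment> \<open>The weight and \<open>hw_weight\<close> agree in the coordinates 1 to n but
      not beyond; only these coordinates enter \<open>highest_weight_vector\<close>.\<close>
    by (rule spinor_ker_decomposition[OF assms, where
          \<mu> = "\<lambda>l j. of_nat l * fund_weight 1 j - 1/2 * fund_weight n j"])
      (auto simp: hw_weight_def fund_weight_def)
  show "sp_iso n \<lparr>carr = spinor_ker n 1, smul = tens_scl, act = tens_act n\<rparr>
           (dsum (\<lambda>l. dsum2
              (L n (\<lambda>j. of_nat (2*l) * fund_weight 1 j + fund_weight (n-1) j - 3/2 * fund_weight n j))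
              (L n (\<lambda>j. of_nat (2*l+1) * fund_weight 1 j + fund_weight (n-1) j - 3/2 * fund_weight n j))))"
    by (rule spinor_ker_decomposition[OF assms, where
          \<mu> = "\<lambda>l j. of_nat l * fund_weight 1 j + fund_weight (n-1) j - 3/2 * fund_weight n j"])
      (use assms in \<open>auto simp: hw_weight_def fund_weight_def\<close>)
qed

end
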